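(* Let $X$ be a Banach space and let $N\in\mathbb{N}$. Suppose that $X^*$ has the Radon-Nikod\'ym property and the approximation property. Then every symmetric tensor in $\widehat{\otimes}_{\pi,s,N}X^*$ can be approximated by symmetric tensors that attain their norms, that is, $\overline{\mathrm{NA}_{\pi,s,N}(X^* )}^{\|\cdot\|_{\pi,s,N}}=\widehat{\otimes}_{\pi,s,N}X^*$.
   Context: $\mathbb{K}$ (the scalar field) is $\mathbb{R}$ or $\mathbb{C}$; $B_E$ and $S_E$ are the closed unit ball and unit sphere of a Banach space $E$. A Banach space $E$ has the approximation property if for every compact $K\subseteq E$ and $\varepsilon>0$ there is a finite-rank bounded operator $T:E\to E$ with $\|T(x)-x\|\leq\varepsilon$ for all $x\in K$. For $z\in E$, $z^N:=z\otimes\cdots\otimes z$ ($N$ times). The $N$-fold projective symmetric tensor product $\widehat{\otimes}_{\pi,s,N}E$ is the completion of the linear span of $\{z^N:z\in E\}$ under the norm $\|z\|_{\pi,s,N}=\inf\{\sum_{k=1}^n|\lambda_k|: z=\sum_{k=1}^n\lambda_k x_k^N,\ n\in\mathbb{N},\ x_k\in S_E,\ \lambda_k\in\mathbb{K}\}$. An element $z\in\widehat{\otimes}_{\pi,s,N}E$ attains its norm if there are bounded sequences $(\lambda_n)_{n=1}^\infty\subset\mathbb{K}$ and $(x_n)_{n=1}^\infty\subset B_E$ with $z=\sum_{n=1}^\infty\lambda_n x_n^N$ and $\|z\|_{\pi,s,N}=\sum_{n=1}^\infty|\lambda_n|$; the set of all such $z$ is denoted $\mathrm{NA}_{\pi,s,N}(E)$.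 *)

theory Defs
  imports "HOL-Analysis.Analysis"
begin

section \<open>The scalar field\<close>

text \<open>The scalar field is the real or the complex field with its usual absolute value; the class
  covers exactly these two fields up to isometric isomorphism.\<close>

class rc_field = real_normed_field + banach +
  assumes real_or_complex:
    "(\<forall>z. \<exists>a. z = a *\<^sub>R 1) \<or>
     (\<exists>i. i * i = - 1 \<and> (\<forall>z. \<exists>a b. z = a *\<^sub>R 1 + b *\<^sub>R i) \<and>
          (\<forall>a b. norm (a *\<^sub>R 1 + b *\<^sub>R i) = sqrt (a\<^sup>2 + b\<^sup>2)))"

instance real :: rc_field
  by standard simp

instance complex :: rc_field
proof
  have "norm (a *\<^sub>R 1 + b *\<^sub>R \<i>) = sqrt (a\<^sup>2 + b\<^sup>2)" for a b
    by (simp add: cmod_def)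
  moreover have "\<exists>a b. z = a *\<^sub>R 1 + b *\<^sub>R \<i>" for z
    by (rule exI[of _ "Re z"], rule exI[of _ "Im z"]) (simp add: complex_eq_iff)
  ultimately show "(\<forall>z::complex. \<exists>a. z = a *\<^sub>R 1) \<or>
     (\<exists>i::complex. i * i = - 1 \<and> (\<forall>z. \<exists>a b. z = a *\<^sub>R 1 + b *\<^sub>R i) \<and>
          (\<forall>a b. norm (a *\<^sub>R 1 + b *\<^sub>R i) = sqrt (a\<^sup>2 + b\<^sup>2)))"
    using i_squared by blast
qed


section \<open>Banach spaces over the scalar field and their duals\<close>

text \<open>The norm and the underlying real Banach space come from the type; \<open>smul\<close> is the
  multiplication by scalars of \<open>'k\<close>, which extends the real one.\<close>

locale banach_space_over = vector_space smul
  for smul :: "'k::rc_field \<Rightarrow> 'a::banach \<Rightarrow> 'a" +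
  assumes scale_of_real: "smul (of_real r) x = r *\<^sub>R x"
    and norm_scale: "norm (smul c x) = norm c * norm x"

text \<open>The topological dual, as a closed subspace of the bounded real-linear maps into \<open>'k\<close>
  with the operator norm.\<close>

definition dual_space :: "('k::rc_field \<Rightarrow> 'a::banach \<Rightarrow> 'a) \<Rightarrow> ('a \<Rightarrow>\<^sub>L 'k) set" where
  "dual_space smul = {f. \<forall>c x. blinfun_apply f (smul c x) = c * blinfun_apply f x}"

definition dual_scale :: "'k::rc_field \<Rightarrow> ('a::banach \<Rightarrow>\<^sub>L 'k) \<Rightarrow> ('a \<Rightarrow>\<^sub>L 'k)" where
  "dual_scale c f = blinfun_mult_right c o\<^sub>L f"

text \<open>From here on a Banach space \<open>E\<close> over \<open>'k\<close> is given by a closed subspace \<open>E\<close> of a type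
  \<open>'e\<close> and a scalar multiplication on \<open>'e\<close>, so that the notions apply to
  \<open>dual_space smul\<close> with \<open>dual_scale\<close>.\<close>

definition approximation_property ::
    "'e::real_normed_vector set \<Rightarrow> ('k::rc_field \<Rightarrow> 'e \<Rightarrow> 'e) \<Rightarrow> bool" where
  "approximation_property E smul \<longleftrightarrow>
     (\<forall>K \<epsilon>. K \<subseteq> E \<and> compact K \<and> \<epsilon> > 0 \<longrightarrow>
        (\<exists>T. (\<forall>x\<in>E. T x \<in> E) \<and>
             (\<forall>x\<in>E. \<forall>y\<in>E. T (x + y) = T x + T y) \<and>
             (\<forall>c. \<forall>x\<in>E. T (smul c x) = smul c (T x)) \<and>
             (\<exists>C. \<forall>x\<in>E. norm (T x) \<le> C * norm x) \<and>
             (\<exists>B. finite B \<and> T ` E \<subseteq> module.span smul B) \<and>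
             (\<forall>x\<in>K. norm (T x - x) \<le> \<epsilon>)))"


section \<open>The Radon-Nikodym property\<close>

text \<open>The definition of \<^const>\<open>has_bochner_integral\<close> without its restriction to second countable
  spaces, since duals need not be separable. The approximating simple functions force \<open>f\<close> to be
  almost everywhere separably valued.\<close>

definition bochner_has_integral ::
    "'m measure \<Rightarrow> ('m \<Rightarrow> 'e::real_normed_vector) \<Rightarrow> 'e \<Rightarrow> bool" where
  "bochner_has_integral M f I \<longleftrightarrow>
     f \<in> borel_measurable M \<and>
     (\<exists>s. (\<forall>i. Bochner_Integration.simple_bochner_integrable M (s i)) \<and>
          (\<lambda>i. \<integral>\<^sup>+x. norm (f x - s i x) \<partial>M) \<longlonglongrightarrow> 0 \<and>
          (\<lambda>i. Bochner_Integration.simple_bochner_integral M (s i)) \<longlonglongrightarrow> I)"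

definition vector_measure ::
    "'m measure \<Rightarrow> 'e::real_normed_vector set \<Rightarrow> ('m set \<Rightarrow> 'e) \<Rightarrow> bool" where
  "vector_measure M E G \<longleftrightarrow>
     (\<forall>A\<in>sets M. G A \<in> E) \<and>
     (\<forall>A. range A \<subseteq> sets M \<and> disjoint_family A \<longrightarrow> (\<lambda>n. G (A n)) sums G (\<Union>n. A n))"

definition bounded_variation ::
    "'m measure \<Rightarrow> ('m set \<Rightarrow> 'e::real_normed_vector) \<Rightarrow> bool" where
  "bounded_variation M G \<longleftrightarrow>
     (\<exists>C. \<forall>P. finite P \<and> P \<subseteq> sets M \<and> partition_on (space M) P \<longrightarrow> (\<Sum>A\<in>P. norm (G A)) \<le> C)"

text \<open>Every vector measure of bounded variation with values in \<open>E\<close> that is absolutely continuous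
  with respect to a finite measure has a Bochner integrable density. The measure spaces range over
  all sample spaces and sigma-algebras inside the type \<open>'m\<close>. As soon as \<open>'m\<close> has at least the
  cardinality of the continuum this is no restriction: the property for all finite measure spaces
  follows from the one for Lebesgue measure on the unit interval.\<close>

definition radon_nikodym_property :: "'m itself \<Rightarrow> 'e::real_normed_vector set \<Rightarrow> bool" where
  "radon_nikodym_property _ E \<longleftrightarrow>
     (\<forall>(M :: 'm measure) G.
        finite_measure M \<and> vector_measure M E G \<and> bounded_variation M G \<and>
        (\<forall>A\<in>null_sets M. G A = 0) \<longrightarrow>
        (\<exists>g. (\<forall>x. g x \<in> E) \<and>
             (\<forall>A\<in>sets M. bochner_has_integral M (\<lambda>x. indicator A x *\<^sub>R g x) (G A))))"


section \<open>Completion of a pseudometric space\<close>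

definition cauchy_seqs :: "'b set \<Rightarrow> ('b \<Rightarrow> 'b \<Rightarrow> real) \<Rightarrow> (nat \<Rightarrow> 'b) set" where
  "cauchy_seqs S d =
     {u. range u \<subseteq> S \<and> (\<forall>\<epsilon>>0. \<exists>n0. \<forall>m\<ge>n0. \<forall>n\<ge>n0. d (u m) (u n) < \<epsilon>)}"

definition null_rel :: "'b set \<Rightarrow> ('b \<Rightarrow> 'b \<Rightarrow> real) \<Rightarrow> ((nat \<Rightarrow> 'b) \<times> (nat \<Rightarrow> 'b)) set" where
  "null_rel S d = {(u, v). u \<in> cauchy_seqs S d \<and> v \<in> cauchy_seqs S d \<and>
     (\<lambda>n. d (u n) (v n)) \<longlonglongrightarrow> 0}"

definition cauchy_completion :: "'b set \<Rightarrow> ('b \<Rightarrow> 'b \<Rightarrow> real) \<Rightarrow> (nat \<Rightarrow> 'b) set set" where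
  "cauchy_completion S d = cauchy_seqs S d // null_rel S d"

definition cauchy_completion_embed :: "'b set \<Rightarrow> ('b \<Rightarrow> 'b \<Rightarrow> real) \<Rightarrow> 'b \<Rightarrow> (nat \<Rightarrow> 'b) set" where
  "cauchy_completion_embed S d z = null_rel S d `` {\<lambda>_. z}"

text \<open>The value 0 outside the carrier is there because \<^locale>\<open>Metric_space\<close> asks for
  nonnegativity and symmetry on the whole type.\<close>

definition cauchy_completion_dist ::
    "'b set \<Rightarrow> ('b \<Rightarrow> 'b \<Rightarrow> real) \<Rightarrow> (nat \<Rightarrow> 'b) set \<Rightarrow> (nat \<Rightarrow> 'b) set \<Rightarrow> real" where
  "cauchy_completion_dist S d Z W =
     (if Z \<in> cauchy_completion S d \<and> W \<in> cauchy_completion S d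
      then THE r. \<forall>u\<in>Z. \<forall>v\<in>W. (\<lambda>n. d (u n) (v n)) \<longlonglongrightarrow> r else 0)"


section \<open>Projective symmetric tensor products\<close>

text \<open>Only the values of \<open>A\<close> on lists of length \<open>N\<close> with entries in \<open>E\<close> matter.\<close>

definition multilinear_form ::
    "nat \<Rightarrow> 'e::real_normed_vector set \<Rightarrow> ('k::rc_field \<Rightarrow> 'e \<Rightarrow> 'e) \<Rightarrow> ('e list \<Rightarrow> 'k) \<Rightarrow> bool" where
  "multilinear_form N E smul A \<longleftrightarrow>
     (\<forall>xs i x y c. length xs = N \<and> set xs \<subseteq> E \<and> i < N \<and> x \<in> E \<and> y \<in> E \<longrightarrow>
        A (xs[i := smul c x + y]) = c * A (xs[i := x]) + A (xs[i := y]))"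

locale sym_tensor =
  fixes N :: nat
    and E :: "'e::real_normed_vector set"
    and smul :: "'k::rc_field \<Rightarrow> 'e \<Rightarrow> 'e"
begin

text \<open>The algebraic tensor product is realised inside the functionals on the space of all
  \<open>N\<close>-linear forms on \<open>E\<close>: the elementary tensor of \<open>xs\<close> is evaluation at \<open>xs\<close>.\<close>

definition tensor :: "'e list \<Rightarrow> ('e list \<Rightarrow> 'k) \<Rightarrow> 'k" where
  "tensor xs = (\<lambda>A. if multilinear_form N E smul A then A xs else 0)"

definition tensor_power :: "'e \<Rightarrow> ('e list \<Rightarrow> 'k) \<Rightarrow> 'k" where
  "tensor_power z = tensor (replicate N z)"

definition tensor_sum :: "nat \<Rightarrow> (nat \<Rightarrow> 'k) \<Rightarrow> (nat \<Rightarrow> 'e) \<Rightarrow> ('e list \<Rightarrow> 'k) \<Rightarrow> 'k" where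
  "tensor_sum n l x = (\<lambda>A. \<Sum>k<n. l k * tensor_power (x k) A)"

definition sym_span :: "(('e list \<Rightarrow> 'k) \<Rightarrow> 'k) set" where
  "sym_span = {tensor_sum n l x |n l x. \<forall>k<n. x k \<in> E}"

text \<open>The empty sum \<open>n = 0\<close> is allowed; this only matters for \<open>E = {0}\<close>, whose unit sphere is
  empty.\<close>

definition proj_norm :: "(('e list \<Rightarrow> 'k) \<Rightarrow> 'k) \<Rightarrow> real" where
  "proj_norm z = Inf {\<Sum>k<n. norm (l k) |n l x.
     z = tensor_sum n l x \<and> (\<forall>k<n. x k \<in> E \<and> norm (x k) = 1)}"

definition proj_dist :: "(('e list \<Rightarrow> 'k) \<Rightarrow> 'k) \<Rightarrow> (('e list \<Rightarrow> 'k) \<Rightarrow> 'k) \<Rightarrow> real" where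
  "proj_dist z w = proj_norm (\<lambda>A. z A - w A)"

definition proj_sym_tensor :: "(nat \<Rightarrow> ('e list \<Rightarrow> 'k) \<Rightarrow> 'k) set set" where
  "proj_sym_tensor = cauchy_completion sym_span proj_dist"

definition pst_embed :: "(('e list \<Rightarrow> 'k) \<Rightarrow> 'k) \<Rightarrow> (nat \<Rightarrow> ('e list \<Rightarrow> 'k) \<Rightarrow> 'k) set" where
  "pst_embed = cauchy_completion_embed sym_span proj_dist"

definition pst_dist ::
    "(nat \<Rightarrow> ('e list \<Rightarrow> 'k) \<Rightarrow> 'k) set \<Rightarrow> (nat \<Rightarrow> ('e list \<Rightarrow> 'k) \<Rightarrow> 'k) set \<Rightarrow> real" where
  "pst_dist = cauchy_completion_dist sym_span proj_dist"

definition pst_norm :: "(nat \<Rightarrow> ('e list \<Rightarrow> 'k) \<Rightarrow> 'k) set \<Rightarrow> real" where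
  "pst_norm Z = pst_dist Z (pst_embed (\<lambda>_. 0))"

definition norm_attaining :: "(nat \<Rightarrow> ('e list \<Rightarrow> 'k) \<Rightarrow> 'k) set set" where
  "norm_attaining = {Z \<in> proj_sym_tensor. \<exists>l x.
     bounded (range l) \<and> (\<forall>n. x n \<in> E \<and> norm (x n) \<le> 1) \<and>
     (\<lambda>m. pst_dist (pst_embed (tensor_sum m l x)) Z) \<longlonglongrightarrow> 0 \<and>
     (\<lambda>n. norm (l n)) sums pst_norm Z}"

abbreviation "pst_topology \<equiv> Metric_space.mtopology proj_sym_tensor pst_dist"

end


section \<open>Well-definedness of the metric on the completion\<close>

locale pseudometric_on =
  fixes S :: "'b set" and d :: "'b \<Rightarrow> 'b \<Rightarrow> real"
  assumes nonneg: "x \<in> S \<Longrightarrow> y \<in> S \<Longrightarrow> 0 \<le> d x y"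
    and refl0: "x \<in> S \<Longrightarrow> d x x = 0"
    and symm: "x \<in> S \<Longrightarrow> y \<in> S \<Longrightarrow> d x y = d y x"
    and tri: "x \<in> S \<Longrightarrow> y \<in> S \<Longrightarrow> z \<in> S \<Longrightarrow> d x z \<le> d x y + d y z"
begin

lemma cs: "u \<in> cauchy_seqs S d \<Longrightarrow> u n \<in> S"
  by (auto simp: cauchy_seqs_def)

lemma quad:
  assumes "a \<in> S" "b \<in> S" "a' \<in> S" "b' \<in> S"
  shows "\<bar>d a b - d a' b'\<bar> \<le> d a a' + d b b'"
  using tri[of a a' b] tri[of a' b' b] tri[of a' a b'] tri[of a b b'] symm[of a a'] symm[of b b'] assms
  by linarith

lemma conv:
  assumes u: "u \<in> cauchy_seqs S d" and v: "v \<in> cauchy_seqs S d"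
  shows "\<exists>r. (\<lambda>n. d (u n) (v n)) \<longlonglongrightarrow> r"
proof -
  have "Cauchy (\<lambda>n. d (u n) (v n))"
  proof (rule metric_CauchyI)
    fix e :: real assume "e > 0"
    then have "e/2 > 0" by simp
    obtain n1 where 1: "\<forall>m\<ge>n1. \<forall>n\<ge>n1. d (u m) (u n) < e/2"
      using u \<open>e/2 > 0\<close> unfolding cauchy_seqs_def by blast
    obtain n2 where 2: "\<forall>m\<ge>n2. \<forall>n\<ge>n2. d (v m) (v n) < e/2"
      using v \<open>e/2 > 0\<close> unfolding cauchy_seqs_def by blast
    have "dist (d (u m) (v m)) (d (u n) (v n)) < e" if "m \<ge> max n1 n2" "n \<ge> max n1 n2" for m n
    proof -
      have "d (u m) (u n) < e/2" "d (v m) (v n) < e/2" using that 1 2 by auto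
      then show ?thesis using quad[OF cs[OF u] cs[OF v] cs[OF u] cs[OF v], of m m n n]
        unfolding dist_real_def by linarith
    qed
    then show "\<exists>M. \<forall>m\<ge>M. \<forall>n\<ge>M. dist (d (u m) (v m)) (d (u n) (v n)) < e" by blast
  qed
  then show ?thesis using real_Cauchy_convergent unfolding convergent_def by blast
qed

lemma equiv_null_rel: "equiv (cauchy_seqs S d) (null_rel S d)"
proof (rule equivI)
  show "null_rel S d \<subseteq> cauchy_seqs S d \<times> cauchy_seqs S d" by (auto simp: null_rel_def)
  show "refl_on (cauchy_seqs S d) (null_rel S d)"
    by (auto simp: refl_on_def null_rel_def cs refl0)
  show "sym_on UNIV (null_rel S d)"
  proof (rule symI)
    fix u v assume "(u,v) \<in> null_rel S d"
    moreover from this have "d (u n) (v n) = d (v n) (u n)" for n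
      using cs symm unfolding null_rel_def by blast
    ultimately show "(v,u) \<in> null_rel S d" by (simp add: null_rel_def)
  qed
  show "trans_on UNIV (null_rel S d)"
  proof (rule transI)
    fix u v w assume "(u,v) \<in> null_rel S d" "(v,w) \<in> null_rel S d"
    then have *: "u \<in> cauchy_seqs S d" "v \<in> cauchy_seqs S d" "w \<in> cauchy_seqs S d"
      "(\<lambda>n. d (u n) (v n)) \<longlonglongrightarrow> 0" "(\<lambda>n. d (v n) (w n)) \<longlonglongrightarrow> 0" by (auto simp: null_rel_def)
    have a: "(\<lambda>n. d (u n) (v n) + d (v n) (w n)) \<longlonglongrightarrow> 0" using tendsto_add[OF *(4,5)] by simp
    have b: "norm (d (u n) (w n)) \<le> d (u n) (v n) + d (v n) (w n)" for n
      using tri[OF cs[OF *(1)] cs[OF *(2)] cs[OF *(3)]] nonneg[OF cs[OF *(1)] cs[OF *(3)]] by simp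
    have "(\<lambda>n. d (u n) (w n)) \<longlonglongrightarrow> 0"
      by (rule Lim_null_comparison[OF always_eventually a]) (rule allI, rule b)
    then show "(u,w) \<in> null_rel S d" using * by (auto simp: null_rel_def)
  qed
qed

lemma cauchy_completion_dist_eq:
  assumes "Z \<in> cauchy_completion S d" "W \<in> cauchy_completion S d" "u \<in> Z" "v \<in> W"
  shows "(\<lambda>n. d (u n) (v n)) \<longlonglongrightarrow> cauchy_completion_dist S d Z W"
proof -
  have uv: "u \<in> cauchy_seqs S d" "v \<in> cauchy_seqs S d"
    using assms in_quotient_imp_subset[OF equiv_null_rel] unfolding cauchy_completion_def by blast+
  obtain r where r: "(\<lambda>n. d (u n) (v n)) \<longlonglongrightarrow> r" using conv[OF uv] by blast
  have "(\<lambda>n. d (u' n) (v' n)) \<longlonglongrightarrow> r" if "u' \<in> Z" "v' \<in> W" for u' v'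
  proof -
    have "(u,u') \<in> null_rel S d" "(v,v') \<in> null_rel S d"
      using that assms in_quotient_imp_in_rel[OF equiv_null_rel] unfolding cauchy_completion_def by blast+
    then have *: "u' \<in> cauchy_seqs S d" "v' \<in> cauchy_seqs S d"
      "(\<lambda>n. d (u n) (u' n)) \<longlonglongrightarrow> 0" "(\<lambda>n. d (v n) (v' n)) \<longlonglongrightarrow> 0" by (auto simp: null_rel_def)
    have a: "(\<lambda>n. d (u n) (u' n) + d (v n) (v' n)) \<longlonglongrightarrow> 0" using tendsto_add[OF *(3,4)] by simp
    have b: "norm (d (u n) (v n) - d (u' n) (v' n)) \<le> d (u n) (u' n) + d (v n) (v' n)" for n
      using quad[OF cs[OF uv(1)] cs[OF uv(2)] cs[OF *(1)] cs[OF *(2)]] by simp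
    have "(\<lambda>n. d (u n) (v n) - d (u' n) (v' n)) \<longlonglongrightarrow> 0"
      by (rule Lim_null_comparison[OF always_eventually a]) (rule allI, rule b)
    from tendsto_diff[OF r this] show ?thesis by simp
  qed
  then have "\<forall>u\<in>Z. \<forall>v\<in>W. (\<lambda>n. d (u n) (v n)) \<longlonglongrightarrow> r" by blast
  moreover have "s = r" if "\<forall>u\<in>Z. \<forall>v\<in>W. (\<lambda>n. d (u n) (v n)) \<longlonglongrightarrow> s" for s
    using that r assms LIMSEQ_unique by blast
  ultimately have "(THE r. \<forall>u\<in>Z. \<forall>v\<in>W. (\<lambda>n. d (u n) (v n)) \<longlonglongrightarrow> r) = r"
    by (rule the_equality)
  then have "cauchy_completion_dist S d Z W = r"
    using assms(1,2) by (simp only: cauchy_completion_dist_def simp_thms if_True)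
  with r show ?thesis by simp
qed

lemma Metric_space_completion: "Metric_space (cauchy_completion S d) (cauchy_completion_dist S d)"
proof -
  have ne: "\<exists>u. u \<in> Z \<and> u \<in> cauchy_seqs S d" if "Z \<in> cauchy_completion S d" for Z
    using that in_quotient_imp_subset[OF equiv_null_rel] in_quotient_imp_non_empty[OF equiv_null_rel]
    unfolding cauchy_completion_def by blast
  note L = cauchy_completion_dist_eq
  have sy: "cauchy_completion_dist S d Z W = cauchy_completion_dist S d W Z"
    if ZW: "Z \<in> cauchy_completion S d" "W \<in> cauchy_completion S d" for Z W
  proof -
    obtain u v where uv: "u \<in> Z" "u \<in> cauchy_seqs S d" "v \<in> W" "v \<in> cauchy_seqs S d"
      using ne ZW by meson
    have "d (u n) (v n) = d (v n) (u n)" for n using uv cs symm by blast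
    then show ?thesis using L[OF ZW uv(1,3)] L[OF ZW(2,1) uv(3,1)] LIMSEQ_unique by simp
  qed
  have nn: "0 \<le> cauchy_completion_dist S d Z W"
    if ZW: "Z \<in> cauchy_completion S d" "W \<in> cauchy_completion S d" for Z W
  proof -
    obtain u v where uv: "u \<in> Z" "u \<in> cauchy_seqs S d" "v \<in> W" "v \<in> cauchy_seqs S d"
      using ne ZW by meson
    show ?thesis using LIMSEQ_le_const[OF L[OF ZW uv(1,3)]] uv cs nonneg by blast
  qed
  have tr: "cauchy_completion_dist S d Z Y \<le> cauchy_completion_dist S d Z W + cauchy_completion_dist S d W Y"
    if ZW: "Z \<in> cauchy_completion S d" "W \<in> cauchy_completion S d" "Y \<in> cauchy_completion S d" for Z W Y
  proof -
    obtain u v w where uv: "u \<in> Z" "u \<in> cauchy_seqs S d" "v \<in> W" "v \<in> cauchy_seqs S d"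
       "w \<in> Y" "w \<in> cauchy_seqs S d"
      using ne ZW by meson
    show ?thesis
      by (rule LIMSEQ_le[OF L[OF ZW(1,3) uv(1,5)]
            tendsto_add[OF L[OF ZW(1,2) uv(1,3)] L[OF ZW(2,3) uv(3,5)]]])
         (use uv cs tri in blast)
  qed
  have z: "cauchy_completion_dist S d Z W = 0 \<longleftrightarrow> Z = W"
    if ZW: "Z \<in> cauchy_completion S d" "W \<in> cauchy_completion S d" for Z W
  proof -
    obtain u v where uv: "u \<in> Z" "u \<in> cauchy_seqs S d" "v \<in> W" "v \<in> cauchy_seqs S d"
      using ne ZW by meson
    have "cauchy_completion_dist S d Z W = 0 \<longleftrightarrow> (\<lambda>n. d (u n) (v n)) \<longlonglongrightarrow> 0"
      using L[OF ZW uv(1,3)] LIMSEQ_unique by metis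
    also have "\<dots> \<longleftrightarrow> (u,v) \<in> null_rel S d" using uv by (auto simp: null_rel_def)
    also have "\<dots> \<longleftrightarrow> Z = W"
      using ZW uv quotient_eq_iff[OF equiv_null_rel] unfolding cauchy_completion_def by metis
    finally show ?thesis .
  qed
  have out: "cauchy_completion_dist S d Z W = 0" if "\<not> (Z \<in> cauchy_completion S d \<and> W \<in> cauchy_completion S d)" for Z W
    using that unfolding cauchy_completion_dist_def by (rule if_not_P)
  show ?thesis
  proof
    show "0 \<le> cauchy_completion_dist S d Z W" for Z W using nn out by (metis order_refl)
    show "cauchy_completion_dist S d Z W = cauchy_completion_dist S d W Z" for Z W using sy out by metis
    show "cauchy_completion_dist S d Z W = 0 \<longleftrightarrow> Z = W"
      if "Z \<in> cauchy_completion S d" "W \<in> cauchy_completion S d" for Z W using z that .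
    show "cauchy_completion_dist S d Z Y \<le> cauchy_completion_dist S d Z W + cauchy_completion_dist S d W Y"
      if "Z \<in> cauchy_completion S d" "W \<in> cauchy_completion S d" "Y \<in> cauchy_completion S d" for Z W Y
      using tr that .
  qed
qed
end

context sym_tensor begin

context
  assumes bs: "vector_space smul"
    and norm_smul: "\<And>c x. norm (smul c x) = norm c * norm x"
    and smul_E: "\<And>c x. x \<in> E \<Longrightarrow> smul c x \<in> E"
    and zero_E: "0 \<in> E"
    and N: "N \<ge> 1"
begin

lemma ml_zero:
  assumes "multilinear_form N E smul A" "length xs = N" "set xs \<subseteq> E" "i < N"
  shows "A (xs[i := 0]) = 0"
proof -
  interpret vector_space smul by (rule bs)
  have "A (xs[i := smul 1 0 + 0]) = 1 * A (xs[i := 0]) + A (xs[i := 0])"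
    using assms zero_E unfolding multilinear_form_def by blast
  then show ?thesis by simp
qed

lemma ml_smul:
  assumes "multilinear_form N E smul A" "length xs = N" "set xs \<subseteq> E" "i < N" "x \<in> E"
  shows "A (xs[i := smul c x]) = c * A (xs[i := x])"
proof -
  have "A (xs[i := smul c x + 0]) = c * A (xs[i := x]) + A (xs[i := 0])"
    using assms zero_E unfolding multilinear_form_def by blast
  then show ?thesis using ml_zero[OF assms(1-4)] by simp
qed

lemma ml_replicate:
  assumes A: "multilinear_form N E smul A" and x: "x \<in> E" and "j \<le> N"
  shows "A (replicate j (smul c x) @ replicate (N - j) x) = c ^ j * A (replicate N x)"
  using \<open>j \<le> N\<close>
proof (induction j)
  case (Suc j)
  let ?xs = "replicate j (smul c x) @ replicate (N - j) x"
  have e: "replicate (N - j) x = x # replicate (N - Suc j) x"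
    using Suc.prems by (metis Suc_diff_Suc Suc_le_lessD replicate_Suc)
  have "?xs[j := smul c x] = replicate j (smul c x) @ smul c x # replicate (N - Suc j) x"
    by (simp add: e list_update_append)
  also have "\<dots> = replicate (Suc j) (smul c x) @ replicate (N - Suc j) x"
    by (simp add: replicate_app_Cons_same)
  finally have 1: "?xs[j := smul c x] = replicate (Suc j) (smul c x) @ replicate (N - Suc j) x" .
  have 2: "?xs[j := x] = ?xs" by (simp add: e list_update_append)
  have "A (?xs[j := smul c x]) = c * A (?xs[j := x])"
    by (rule ml_smul[OF A]) (use Suc.prems x smul_E in auto)
  then show ?case using 1 2 Suc by simp
qed simp

lemma tensor_power_smul:
  assumes "x \<in> E" shows "tensor_power (smul c x) B = c ^ N * tensor_power x B"
  using ml_replicate[of B x N c] assms by (simp add: tensor_power_def tensor_def)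

lemma tensor_power_0: "tensor_power 0 B = 0"
proof -
  interpret vector_space smul by (rule bs)
  show ?thesis using tensor_power_smul[OF zero_E, of 0 B] N by (simp add: zero_power)
qed

definition urep :: "(('e list \<Rightarrow> 'k) \<Rightarrow> 'k) \<Rightarrow> real \<Rightarrow> bool" where
  "urep z s \<longleftrightarrow> (\<exists>n l x. s = (\<Sum>k<n. norm (l k)) \<and> z = tensor_sum n l x \<and> (\<forall>k<n. x k \<in> E \<and> norm (x k) = 1))"

lemma proj_norm_urep: "proj_norm z = Inf {s. urep z s}"
  unfolding proj_norm_def urep_def by simp

lemma urep_nonneg: "urep z s \<Longrightarrow> 0 \<le> s"
  unfolding urep_def by (auto intro: sum_nonneg)

lemma urep_0: "urep (\<lambda>_. 0) 0"
  unfolding urep_def by (rule exI[of _ 0]) (simp add: tensor_sum_def)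

lemma urep_neg: assumes "urep z s" shows "urep (\<lambda>A. - z A) s"
proof -
  from assms obtain n l x where "s = (\<Sum>k<n. norm (l k))" "z = tensor_sum n l x" "\<forall>k<n. x k \<in> E \<and> norm (x k) = 1"
    unfolding urep_def by blast
  then show ?thesis unfolding urep_def
    by (intro exI[of _ n] exI[of _ "\<lambda>k. - l k"] exI[of _ x]) (simp add: tensor_sum_def sum_negf)
qed

lemma sum_concat: "(\<Sum>k<n+m. f k) = (\<Sum>k<n. f k) + (\<Sum>k<m. f (n + k))" for f :: "nat \<Rightarrow> 'z::comm_monoid_add"
  by (induction m) (simp_all add: algebra_simps)

lemma tensor_sum_concat:
  "(\<lambda>A. tensor_sum n l x A + tensor_sum m l' x' A) =
   tensor_sum (n + m) (\<lambda>k. if k < n then l k else l' (k - n)) (\<lambda>k. if k < n then x k else x' (k - n))"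
  by (simp add: tensor_sum_def sum_concat fun_eq_iff)

lemma urep_add: assumes "urep z s" "urep w t" shows "urep (\<lambda>A. z A + w A) (s + t)"
proof -
  from assms(1) obtain n l x where 1: "s = (\<Sum>k<n. norm (l k))" "z = tensor_sum n l x" "\<forall>k<n. x k \<in> E \<and> norm (x k) = 1"
    unfolding urep_def by blast
  from assms(2) obtain m l' x' where 2: "t = (\<Sum>k<m. norm (l' k))" "w = tensor_sum m l' x'" "\<forall>k<m. x' k \<in> E \<and> norm (x' k) = 1"
    unfolding urep_def by blast
  show ?thesis unfolding urep_def 1 2 tensor_sum_concat
    by (intro exI conjI) (auto simp: sum_concat 1 2)
qed

lemma urep_power: assumes "x \<in> E" shows "\<exists>s. urep (\<lambda>A. c * tensor_power x A) s"
proof (cases "x = 0")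
  case True then show ?thesis using urep_0 by (auto simp: tensor_power_0)
next
  case False
  interpret vector_space smul by (rule bs)
  let ?r = "of_real (norm x) :: 'k"
  let ?y = "smul (inverse ?r) x"
  have r: "?r \<noteq> 0" using False by simp
  have y: "?y \<in> E" "norm ?y = 1" using assms smul_E False by (auto simp: norm_smul norm_inverse)
  have "smul ?r ?y = x" using r by simp
  then have "tensor_power x A = ?r ^ N * tensor_power ?y A" for A
    using tensor_power_smul[OF y(1), of ?r A] by simp
  then have "urep (\<lambda>A. c * tensor_power x A) (norm (c * ?r ^ N))"
    unfolding urep_def
    by (intro exI[of _ 1] exI[of _ "\<lambda>_. c * ?r ^ N"] exI[of _ "\<lambda>_. ?y"])
       (simp add: tensor_sum_def y(1) y(2) fun_eq_iff)
  then show ?thesis by blast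
qed

lemma span_urep: assumes "z \<in> sym_span" shows "\<exists>s. urep z s"
proof -
  have "(\<forall>k<n. x k \<in> E) \<Longrightarrow> \<exists>s. urep (tensor_sum n l x) s" for n l x
  proof (induction n)
    case 0 show ?case using urep_0 by (auto simp: tensor_sum_def)
  next
    case (Suc n)
    then obtain s where s: "urep (tensor_sum n l x) s" by auto
    obtain t where t: "urep (\<lambda>A. l n * tensor_power (x n) A) t" using urep_power Suc.prems by blast
    have "tensor_sum (Suc n) l x = (\<lambda>A. tensor_sum n l x A + l n * tensor_power (x n) A)"
      by (simp add: tensor_sum_def)
    then show ?case using urep_add[OF s t] by metis
  qed
  then show ?thesis using assms by (auto simp: sym_span_def)
qed

lemma span_diff: assumes "z \<in> sym_span" "w \<in> sym_span" shows "(\<lambda>A. z A - w A) \<in> sym_span"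
proof -
  from assms(1) obtain n l x where 1: "z = tensor_sum n l x" "\<forall>k<n. x k \<in> E" by (auto simp: sym_span_def)
  from assms(2) obtain m l' x' where 2: "w = tensor_sum m l' x'" "\<forall>k<m. x' k \<in> E" by (auto simp: sym_span_def)
  have "(\<lambda>A. z A - w A) = (\<lambda>A. tensor_sum n l x A + tensor_sum m (\<lambda>k. - l' k) x' A)"
    by (simp add: 1 2 tensor_sum_def sum_negf)
  also have "\<dots> \<in> sym_span" unfolding tensor_sum_concat sym_span_def using 1 2
    by (auto simp: intro!: exI)
  finally show ?thesis .
qed

lemma pn_le: "urep z s \<Longrightarrow> proj_norm z \<le> s"
  unfolding proj_norm_urep by (rule cInf_lower) (auto intro: bdd_belowI[of _ 0] urep_nonneg)

lemma pn_ge: "urep z s \<Longrightarrow> (\<And>t. urep z t \<Longrightarrow> a \<le> t) \<Longrightarrow> a \<le> proj_norm z"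
  unfolding proj_norm_urep by (rule cInf_greatest) auto

lemma pseudometric_sym_span: "pseudometric_on sym_span proj_dist"
proof
  fix x y assume "x \<in> sym_span" "y \<in> sym_span"
  then obtain s where s: "urep (\<lambda>A. x A - y A) s" using span_urep span_diff by blast
  show "0 \<le> proj_dist x y" unfolding proj_dist_def by (rule pn_ge[OF s]) (rule urep_nonneg)
  have "{t. urep (\<lambda>A. x A - y A) t} = {t. urep (\<lambda>A. y A - x A) t}"
    using urep_neg[of "\<lambda>A. x A - y A"] urep_neg[of "\<lambda>A. y A - x A"] by auto
  then show "proj_dist x y = proj_dist y x" unfolding proj_dist_def proj_norm_urep by (rule arg_cong)
next
  fix x assume x: "x \<in> sym_span"
  have "proj_norm (\<lambda>_. 0) = 0"
    by (rule order_antisym[OF pn_le[OF urep_0] pn_ge[OF urep_0 urep_nonneg]])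
  then show "proj_dist x x = 0" by (simp add: proj_dist_def)
next
  fix x y z assume "x \<in> sym_span" "y \<in> sym_span" "z \<in> sym_span"
  then obtain s t where s: "urep (\<lambda>A. x A - y A) s" and t: "urep (\<lambda>A. y A - z A) t"
    using span_urep span_diff by meson
  have *: "proj_dist x z \<le> s' + t'" if "urep (\<lambda>A. x A - y A) s'" "urep (\<lambda>A. y A - z A) t'" for s' t'
    using pn_le[OF urep_add[OF that]] by (simp add: proj_dist_def)
  have "proj_dist x z - t' \<le> proj_dist x y" if "urep (\<lambda>A. y A - z A) t'" for t'
    unfolding proj_dist_def[of x y]
    by (rule pn_ge[OF s]) (simp add: *[OF _ that] diff_le_eq)
  then have "proj_dist x z - proj_dist x y \<le> proj_dist y z"
    unfolding proj_dist_def[of y z] by (intro pn_ge[OF t]) (simp add: diff_le_eq add.commute)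
  then show "proj_dist x z \<le> proj_dist x y + proj_dist y z" by linarith
qed

end
end

lemma dual_banach: assumes "banach_space_over smul"
  shows "vector_space (dual_scale :: 'k::rc_field \<Rightarrow> ('a::banach \<Rightarrow>\<^sub>L 'k) \<Rightarrow> _)"
    "norm (dual_scale c f) = norm c * norm (f :: 'a::banach \<Rightarrow>\<^sub>L 'k::rc_field)"
    "f \<in> dual_space smul \<Longrightarrow> dual_scale c f \<in> dual_space smul" "0 \<in> dual_space smul"
    "banach_space_over (dual_scale :: 'k::rc_field \<Rightarrow> ('a::banach \<Rightarrow>\<^sub>L 'k) \<Rightarrow> _)"
proof -
  have ap: "blinfun_apply (dual_scale c f) x = c * blinfun_apply f x" for c and f :: "'a \<Rightarrow>\<^sub>L 'k" and x
    by (simp add: dual_scale_def)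
  show v: "vector_space (dual_scale :: 'k \<Rightarrow> ('a \<Rightarrow>\<^sub>L 'k) \<Rightarrow> _)"
    by standard (auto intro!: blinfun_eqI simp: ap blinfun.add_left algebra_simps)
  show n: "norm (dual_scale c f) = norm c * norm f" for c and f :: "'a \<Rightarrow>\<^sub>L 'k"
  proof -
    have le: "norm (dual_scale c f) \<le> norm c * norm f" for c and f :: "'a \<Rightarrow>\<^sub>L 'k"
      by (rule norm_blinfun_bound)
         (auto simp: ap norm_mult mult.assoc intro!: mult_left_mono norm_blinfun)
    show ?thesis
    proof (cases "c = 0")
      case True then show ?thesis using le[of c f] by simp
    next
      case False
      have "f = dual_scale (inverse c) (dual_scale c f)" using False by (intro blinfun_eqI) (simp add: ap)
      then have "norm f \<le> norm (inverse c) * norm (dual_scale c f)" using le by metis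
      then have "norm c * norm f \<le> norm (dual_scale c f)" using False
        by (simp only: norm_inverse) (simp add: field_simps)
      then show ?thesis using le[of c f] by simp
    qed
  qed
  show "f \<in> dual_space smul \<Longrightarrow> dual_scale c f \<in> dual_space smul" "0 \<in> dual_space smul"
    by (auto simp: dual_space_def ap)
  show "banach_space_over (dual_scale :: 'k::rc_field \<Rightarrow> ('a::banach \<Rightarrow>\<^sub>L 'k) \<Rightarrow> _)"
    by (intro banach_space_over.intro v banach_space_over_axioms.intro n)
       (auto intro!: blinfun_eqI simp: ap blinfun.scaleR_left scaleR_conv_of_real)
qed

lemma Metric_space_proj_sym_tensor_dual:
  assumes "banach_space_over smul" and "N \<ge> 1"
  shows "Metric_space (sym_tensor.proj_sym_tensor N (dual_space smul) dual_scale)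
           (sym_tensor.pst_dist N (dual_space smul) dual_scale)"
  unfolding sym_tensor.proj_sym_tensor_def sym_tensor.pst_dist_def
  by (intro pseudometric_on.Metric_space_completion sym_tensor.pseudometric_sym_span
        dual_banach[OF assms(1)] assms(2))

end

theory Submission
  imports Defs "HOL-Probability.Discrete_Topology" "HOL-Probability.Probability_Measure"
begin

text \<open>Let \<open>P\<close> be the space of \<open>N\<close>-homogeneous polynomials of finite type on the dual \<open>E\<close> of \<open>X\<close>, with the
  supremum norm over the unit ball \<open>B\<close> of \<open>E\<close>. Symmetric tensors act on \<open>P\<close>. By Bishop--Phelps a
  tensor \<open>z\<close> is close, as a functional, to one that attains its norm at some \<open>y\<close> in the closure of
  \<open>P\<close>. By Hahn--Banach this functional is a mean \<open>\<Lambda>\<close> over the weak* compact set of pairs of a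
  unimodular scalar and a point of \<open>B\<close>, and \<open>\<Lambda>\<close> is carried by the set \<open>K\<close> where \<open>y\<close> takes its maximum.
  The Radon--Nikodym property makes \<open>B\<close> norm-fragmented in the weak* topology, and this allows to
  replace \<open>\<Lambda>\<close> by a finite combination of points of \<open>K\<close>, that is, by a tensor \<open>w\<close> that attains its norm,
  as \<open>y\<close> witnesses. So \<open>z - w\<close> is small as a functional on \<open>P\<close>.

  It remains to see that it is small in the projective norm. Without the norm-attaining \<open>y\<close> the same
  argument, iterated, represents a tensor of functional norm \<open>\<theta>\<close> on \<open>P\<close> by an absolutely convergent
  series of total mass at most \<open>2 * \<theta>\<close>. The approximation property shows that this series converges to
  the tensor in the projective norm, because a series that vanishes on \<open>P\<close> is null.\<close>

section \<open>Hahn--Banach and Bishop--Phelps\<close>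

text \<open>Finite type makes the polynomials weak* continuous on the ball, which is where
  compactness is available; the price is that \<open>P\<close> sees a tensor only through a possibly
  smaller norm. The unimodular scalar attached to each point turns complex polynomials into real
  functions whose supremum is their norm, so positivity arguments apply over both fields. The mean
  \<Lambda> comes from Hahn-Banach as a functional on all bounded functions; it is not known to be
  regular or countably additive, and exhaustion by compact sets stands in for regularity.
  Bishop-Phelps asks for a complete space, hence the closure of \<open>P\<close>. This suffices: a
  function bounded by 1 that is a uniform limit of polynomials still certifies a lower bound for the
  projective norm. The two norms are compared with the constant 3, namely mass 2 from the geometric
  iteration and 1 for cutting the series off.\<close>

definition sublinear :: "('v::real_vector \<Rightarrow> real) \<Rightarrow> bool" where
  "sublinear p \<longleftrightarrow> (\<forall>x y. p (x + y) \<le> p x + p y) \<and> (\<forall>c x. 0 \<le> c \<longrightarrow> p (c *\<^sub>R x) = c * p x)"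

text \<open>A partial functional is encoded by its graph, a subspace of the product, so that
  extension is inclusion and chains have their unions as upper bounds. Single-valuedness follows
  from domination by a sublinear \<open>p\<close>.\<close>

definition linear_part :: "('v::real_vector \<Rightarrow> real) \<Rightarrow> ('v \<times> real) set \<Rightarrow> bool" where
  "linear_part p g \<longleftrightarrow> subspace g \<and> (\<forall>(x, a) \<in> g. a \<le> p x)"

lemma linear_part_functional:
  assumes p: "sublinear p" and g: "linear_part p g" and xa: "(x, a) \<in> g" "(x, b) \<in> g"
  shows "a = b"
proof -
  have p0: "p 0 = 0" using p unfolding sublinear_def by (metis order_refl mult_zero_left scale_zero_left)
  have sub: "subspace g" using g by (simp add: linear_part_def)
  have "(0, a - b) \<in> g" "(0, b - a) \<in> g"
    using subspace_diff[OF sub xa] subspace_diff[OF sub xa(2,1)] by simp_all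
  then have "a - b \<le> p 0" "b - a \<le> p 0" using g unfolding linear_part_def by blast+
  then show ?thesis using p0 by simp
qed

lemma hahn_banach_extend:
  fixes p :: "'v::real_vector \<Rightarrow> real"
  assumes p: "sublinear p" and g: "linear_part p g" and v: "v \<notin> fst ` g"
  shows "\<exists>h. linear_part p h \<and> g \<subset> h"
proof -
  have add: "p (x + y) \<le> p x + p y" for x y using p by (simp add: sublinear_def)
  have hom: "0 \<le> c \<Longrightarrow> p (c *\<^sub>R x) = c * p x" for c x using p by (simp add: sublinear_def)
  have sub: "subspace g" using g by (simp add: linear_part_def)
  have dom: "a \<le> p x" if "(x, a) \<in> g" for x a using g that by (auto simp: linear_part_def)
  have le: "a - p (x - v) \<le> p (y + v) - b" if "(x, a) \<in> g" "(y, b) \<in> g" for x y a b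
  proof -
    have "(x + y, a + b) \<in> g" using subspace_add[OF sub that] by simp
    then have "a + b \<le> p ((x - v) + (y + v))" using dom by (simp add: algebra_simps)
    also have "\<dots> \<le> p (x - v) + p (y + v)" by (rule add)
    finally show ?thesis by simp
  qed
  have z: "(0, 0) \<in> g" using subspace_0[OF sub] by (simp add: zero_prod_def)
  \<comment> \<open>The value at \<open>v\<close> may be any number between all
    \<open>a - p (x - v)\<close> and all \<open>p (y + v) - b\<close>; the supremum of the former is
    taken.\<close>
  define L where "L = {a - p (x - v) |x a. (x, a) \<in> g}"
  define c where "c = Sup L"
  have bdd: "bdd_above L" unfolding L_def bdd_above_def using le[OF _ z] by auto
  have cl: "a - p (x - v) \<le> c" if "(x, a) \<in> g" for x a
    unfolding c_def by (rule cSup_upper[OF _ bdd]) (use that in \<open>auto simp: L_def\<close>)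
  have cu: "c \<le> p (y + v) - b" if "(y, b) \<in> g" for y b
    unfolding c_def by (rule cSup_least) (use z le that in \<open>auto simp: L_def\<close>)
  define h where "h = {(x + t *\<^sub>R v, a + t * c) |x a t. (x, a) \<in> g}"
  have hI: "(x + t *\<^sub>R v, a + t * c) \<in> h" if "(x, a) \<in> g" for x a t
    using that unfolding h_def by blast
  have "subspace h" unfolding subspace_def
  proof (intro conjI ballI allI)
    show "0 \<in> h" using hI[OF z, of 0] by (simp add: zero_prod_def)
  next
    fix q r assume "q \<in> h" "r \<in> h"
    then obtain x a t y b s where *: "q = (x + t *\<^sub>R v, a + t * c)" "(x, a) \<in> g"
      "r = (y + s *\<^sub>R v, b + s * c)" "(y, b) \<in> g" unfolding h_def by blast
    have "(x + y, a + b) \<in> g" using subspace_add[OF sub *(2,4)] by simp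
    from hI[OF this, of "t + s"] show "q + r \<in> h" by (simp add: * algebra_simps)
  next
    fix k q assume "q \<in> h"
    then obtain x a t where *: "q = (x + t *\<^sub>R v, a + t * c)" "(x, a) \<in> g" unfolding h_def by blast
    have "(k *\<^sub>R x, k * a) \<in> g" using subspace_scale[OF sub *(2), of k] by simp
    from hI[OF this, of "k * t"] show "k *\<^sub>R q \<in> h" by (simp add: * algebra_simps)
  qed
  moreover have "a + t * c \<le> p (x + t *\<^sub>R v)" if xa: "(x, a) \<in> g" for x a t
  proof -
    consider "t = 0" | "t > 0" | "t < 0" by linarith
    then show ?thesis
    proof cases
      case 1 then show ?thesis using dom[OF xa] by simp
    next
      case 2
      have "((1/t) *\<^sub>R x, (1/t) * a) \<in> g" using subspace_scale[OF sub xa, of "1/t"] by simp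
      from cu[OF this] have "t * c \<le> t * (p ((1/t) *\<^sub>R x + v) - (1/t) * a)" using 2 by (intro mult_left_mono) auto
      also have "\<dots> = p (t *\<^sub>R ((1/t) *\<^sub>R x + v)) - a" using 2 by (subst hom) (auto simp: algebra_simps)
      also have "t *\<^sub>R ((1/t) *\<^sub>R x + v) = x + t *\<^sub>R v" using 2 by (simp add: algebra_simps)
      finally show ?thesis by simp
    next
      case 3
      define s where "s = - t"
      have s: "s > 0" using 3 by (simp add: s_def)
      have "((1/s) *\<^sub>R x, (1/s) * a) \<in> g" using subspace_scale[OF sub xa, of "1/s"] by simp
      from cl[OF this] have "s * ((1/s) * a - p ((1/s) *\<^sub>R x - v)) \<le> s * c" using s by (intro mult_left_mono) auto
      also have "s * ((1/s) * a - p ((1/s) *\<^sub>R x - v)) = a - p (s *\<^sub>R ((1/s) *\<^sub>R x - v))"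
        using s by (subst hom) (auto simp: algebra_simps)
      also have "s *\<^sub>R ((1/s) *\<^sub>R x - v) = x - s *\<^sub>R v" using s by (simp add: algebra_simps)
      finally show ?thesis by (simp add: s_def)
    qed
  qed
  ultimately have "linear_part p h" unfolding linear_part_def h_def by blast
  moreover have "g \<subseteq> h"
  proof
    fix q assume "q \<in> g" then show "q \<in> h" using hI[of "fst q" "snd q" 0] by simp
  qed
  moreover have "(v, c) \<in> h" using hI[OF z, of 1] by simp
  moreover have "(v, c) \<notin> g" using v by force
  ultimately show ?thesis by blast
qed

theorem hahn_banach:
  fixes p :: "'v::real_vector \<Rightarrow> real"
  assumes p: "sublinear p" and Y: "subspace Y"
    and add: "\<And>x y. x \<in> Y \<Longrightarrow> y \<in> Y \<Longrightarrow> f (x + y) = f x + f y"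
    and scale: "\<And>c x. x \<in> Y \<Longrightarrow> f (c *\<^sub>R x) = c * f x"
    and dom: "\<And>x. x \<in> Y \<Longrightarrow> f x \<le> p x"
  obtains F where "linear F" "\<And>x. x \<in> Y \<Longrightarrow> F x = f x" "\<And>x. F x \<le> p x"
proof -
  define g0 where "g0 = (\<lambda>x. (x, f x)) ` Y"
  have f0: "f 0 = 0" using scale[OF subspace_0[OF Y], of 0] by simp
  have g0: "linear_part p g0"
    unfolding linear_part_def subspace_def g0_def
    using subspace_0[OF Y] subspace_add[OF Y] subspace_scale[OF Y] f0
    by (auto simp: add scale dom zero_prod_def image_iff)
  define \<A> where "\<A> = {g. linear_part p g \<and> g0 \<subseteq> g}"
  have "\<exists>U\<in>\<A>. \<forall>X\<in>\<C>. X \<subseteq> U" if ch: "subset.chain \<A> \<C>" for \<C>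
  proof (cases "\<C> = {}")
    case True then show ?thesis using g0 by (auto simp: \<A>_def)
  next
    case False
    have mem: "linear_part p X \<and> g0 \<subseteq> X" if "X \<in> \<C>" for X
      using ch that unfolding subset.chain_def \<A>_def by blast
    have common: "\<exists>X\<in>\<C>. q \<in> X \<and> r \<in> X" if "q \<in> \<Union>\<C>" "r \<in> \<Union>\<C>" for q r
      using that ch unfolding subset.chain_def by blast
    have "subspace (\<Union>\<C>)" unfolding subspace_def
    proof (intro conjI ballI allI)
      show "0 \<in> \<Union>\<C>" using False mem subspace_0 unfolding linear_part_def by blast
      fix q assume q: "q \<in> \<Union>\<C>"
      show "c *\<^sub>R q \<in> \<Union>\<C>" for c using q mem subspace_scale unfolding linear_part_def by blast
      fix r assume r: "r \<in> \<Union>\<C>"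
      show "q + r \<in> \<Union>\<C>" using common[OF q r] mem subspace_add unfolding linear_part_def by blast
    qed
    then have "\<Union>\<C> \<in> \<A>" using mem False unfolding \<A>_def linear_part_def by blast
    then show ?thesis by blast
  qed
  then obtain g where g: "g \<in> \<A>" and max: "\<forall>X\<in>\<A>. g \<subseteq> X \<longrightarrow> X = g"
    using subset_Zorn'[of \<A>] subset_Zorn[of \<A>] by metis
  have lg: "linear_part p g" "g0 \<subseteq> g" using g by (auto simp: \<A>_def)
  have sub: "subspace g" using lg by (simp add: linear_part_def)
  have tot: "v \<in> fst ` g" for v
  proof (rule ccontr)
    assume "v \<notin> fst ` g"
    from hahn_banach_extend[OF p lg(1) this] obtain h where h: "linear_part p h" "g \<subset> h" by blast
    then have "h \<in> \<A>" using lg by (auto simp: \<A>_def)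
    then show False using max h by blast
  qed
  define F where "F v = (SOME a. (v, a) \<in> g)" for v
  have F: "(v, F v) \<in> g" for v unfolding F_def by (rule someI_ex) (use tot[of v] in auto)
  have uniq: "(v, a) \<in> g \<Longrightarrow> F v = a" for v a using linear_part_functional[OF p lg(1) F] by blast
  have "linear F"
  proof (rule linearI)
    fix x y show "F (x + y) = F x + F y" by (rule uniq) (use subspace_add[OF sub F F, of x y] in simp)
    fix c show "F (c *\<^sub>R x) = c *\<^sub>R F x" by (rule uniq) (use subspace_scale[OF sub F, of c x] in simp)
  qed
  moreover have "F x = f x" if "x \<in> Y" for x by (rule uniq) (use that lg in \<open>auto simp: g0_def\<close>)
  moreover have "F x \<le> p x" for x using F[of x] lg(1) unfolding linear_part_def by blast
  ultimately show thesis using that by blast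
qed

text \<open>Ekeland's variational principle, for maxima. \<open>S y\<close> collects the points
  whose gain over \<open>y\<close> pays for the distance to \<open>y\<close>. Choosing almost best
  points of these sets in turn gives increasing bounded values; distances are bounded by gains, so
  the points converge as well.\<close>

lemma ekeland:
  fixes C :: "'v::banach set" and f :: "'v \<Rightarrow> real"
  assumes C: "closed C" "a \<in> C" and f: "continuous_on C f" and bd: "\<And>y. y \<in> C \<Longrightarrow> f y \<le> M"
    and e: "e > 0"
  obtains y where "y \<in> C" "\<And>x. x \<in> C \<Longrightarrow> f x \<le> f y + e * norm (x - y)"
proof -
  define S where "S y = {x \<in> C. f y + e * norm (x - y) \<le> f x}" for y
  have "\<exists>x. x \<in> S y \<and> (\<forall>z\<in>S y. f z \<le> f x + (1/2)^n)" if "y \<in> C" for y and n :: nat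
  proof -
    have ne: "f ` S y \<noteq> {}" using that by (auto simp: S_def)
    have bdd: "bdd_above (f ` S y)" using bd by (auto simp: S_def bdd_above_def)
    have "\<exists>t\<in>f ` S y. Sup (f ` S y) - (1/2)^n < t"
      by (rule less_cSupD[OF ne]) simp
    then obtain x where x: "x \<in> S y" "Sup (f ` S y) - (1/2)^n < f x" by blast
    then show ?thesis using cSup_upper[OF imageI bdd] by (intro exI[of _ x]) fastforce
  qed
  then obtain nx where nx: "\<And>y n. y \<in> C \<Longrightarrow> nx y n \<in> S y"
    "\<And>y n z. y \<in> C \<Longrightarrow> z \<in> S y \<Longrightarrow> f z \<le> f (nx y n) + (1/2)^n" by metis
  define u where "u = rec_nat a (\<lambda>n y. nx y n)"
  have u0: "u 0 = a" and uS: "u (Suc n) = nx (u n) n" for n by (simp_all add: u_def)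
  have uC: "u n \<in> C" for n
    by (induction n) (use C nx(1) in \<open>auto simp: u0 uS S_def\<close>)
  have step: "u (Suc n) \<in> S (u n)" for n using nx(1)[OF uC] by (simp add: uS)
  have dist: "f (u m) + e * norm (u n - u m) \<le> f (u n)" if "m \<le> n" for m n
    using that
  proof (induction n rule: dec_induct)
    case base then show ?case by simp
  next
    case (step n)
    have "norm (u (Suc n) - u m) \<le> norm (u (Suc n) - u n) + norm (u n - u m)"
      using norm_triangle_ineq[of "u (Suc n) - u n" "u n - u m"] by simp
    then have "e * norm (u (Suc n) - u m) \<le> e * norm (u (Suc n) - u n) + e * norm (u n - u m)"
      using e by (simp add: distrib_left[symmetric])
    then show ?case using step \<open>u (Suc n) \<in> S (u n)\<close> by (simp add: S_def)
  qed
  have inc: "incseq (\<lambda>n. f (u n))"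
  proof (rule incseq_SucI)
    fix n show "f (u n) \<le> f (u (Suc n))"
    proof -
      have "0 \<le> e * norm (u (Suc n) - u n)" using e by simp
      then show ?thesis using dist[of n "Suc n"] by linarith
    qed
  qed
  have "\<exists>l. (\<lambda>n. f (u n)) \<longlonglongrightarrow> l"
    using incseq_convergent[OF inc, of M] bd uC by blast
  then have cf: "Cauchy (\<lambda>n. f (u n))" using LIMSEQ_imp_Cauchy by blast
  have "Cauchy u"
  proof (rule metric_CauchyI)
    fix r :: real assume r: "r > 0"
    then obtain n0 where n0: "\<And>m n. m \<ge> n0 \<Longrightarrow> n \<ge> n0 \<Longrightarrow> \<bar>f (u m) - f (u n)\<bar> < e * r"
      using cf e unfolding Cauchy_def dist_real_def by (meson mult_pos_pos)
    have *: "dist (u m) (u n) < r" if "m \<ge> n0" "m \<le> n" for m n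
    proof -
      have "e * norm (u n - u m) < e * r" using dist[OF that(2)] n0[of m n] that by linarith
      then show ?thesis using e by (simp add: dist_norm norm_minus_commute)
    qed
    show "\<exists>M. \<forall>m\<ge>M. \<forall>n\<ge>M. dist (u m) (u n) < r"
      using * by (intro exI[of _ n0]) (metis dist_commute nle_le)
  qed
  then obtain y where y: "u \<longlonglongrightarrow> y" using Cauchy_convergent_iff convergent_def by blast
  have yC: "y \<in> C" using closed_sequentially[OF C(1)] uC y by blast
  have fy: "(\<lambda>n. f (u n)) \<longlonglongrightarrow> f y"
    using f y yC uC unfolding continuous_on_sequentially comp_def by blast
  have yS: "f (u m) + e * norm (y - u m) \<le> f y" for m
  proof (rule LIMSEQ_le)
    show "(\<lambda>n. f (u m) + e * norm (u n - u m)) \<longlonglongrightarrow> f (u m) + e * norm (y - u m)"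
      by (intro tendsto_intros y)
    show "(\<lambda>n. f (u n)) \<longlonglongrightarrow> f y" by (rule fy)
    show "\<exists>N. \<forall>n\<ge>N. f (u m) + e * norm (u n - u m) \<le> f (u n)" using dist by blast
  qed
  \<comment> \<open>A violating \<open>x\<close> would lie in every \<open>S (u m)\<close>, because
    \<open>y\<close> does and gains add up; the almost optimal choices then force
    \<open>f x \<le> f y\<close>.\<close>
  have "f x \<le> f y + e * norm (x - y)" if xC: "x \<in> C" for x
  proof (rule ccontr)
    assume neg: "\<not> ?thesis"
    have "x \<in> S (u m)" for m
    proof -
      have "norm (x - u m) \<le> norm (x - y) + norm (y - u m)"
        using norm_triangle_ineq[of "x - y" "y - u m"] by simp
      then have "e * norm (x - u m) \<le> e * norm (x - y) + e * norm (y - u m)"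
        using e by (simp add: distrib_left[symmetric])
      then show ?thesis using xC yS[of m] neg by (simp add: S_def)
    qed
    then have "f x \<le> f (u (Suc n)) + (1/2)^n" for n using nx(2)[OF uC] by (simp add: uS)
    moreover have "(\<lambda>n. f (u (Suc n)) + (1/2)^n) \<longlonglongrightarrow> f y + 0"
      by (intro tendsto_add LIMSEQ_Suc[OF fy] LIMSEQ_realpow_zero) auto
    ultimately have "f x \<le> f y" using LIMSEQ_le_const by fastforce
    moreover have "0 \<le> e * norm (x - y)" using e by simp
    ultimately show False using neg by linarith
  qed
  then show thesis using that yC by blast
qed

text \<open>Ekeland's principle gives a point \<open>y0\<close> of the ball that is maximal up to
  the nonlinear error \<open>e * norm (x - y0)\<close>; Hahn-Banach replaces this error by a linear
  functional below \<open>e * norm\<close>.\<close>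

theorem bishop_phelps:
  fixes Y :: "'v::banach set" and \<psi> :: "'v \<Rightarrow> real"
  assumes Y: "subspace Y" "closed Y" and psi: "bounded_linear \<psi>" and e: "e > 0"
  shows "\<exists>\<eta> y0. linear \<eta> \<and> (\<forall>v. \<eta> v \<le> e * norm v) \<and> y0 \<in> Y \<and> norm y0 \<le> 1 \<and>
    (\<forall>y\<in>Y. norm y \<le> 1 \<longrightarrow> \<psi> y - \<eta> y \<le> \<psi> y0 - \<eta> y0)"
proof -
  interpret bounded_linear \<psi> by (rule psi)
  define C where "C = Y \<inter> cball 0 1"
  obtain M where M: "\<And>x. norm (\<psi> x) \<le> norm x * M" "M \<ge> 0" using nonneg_bounded by blast
  have "closed C" "0 \<in> C" "continuous_on C \<psi>"
    using Y by (auto simp: C_def subspace_0 linear_continuous_on psi)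
  moreover have "\<psi> y \<le> M" if "y \<in> C" for y
  proof -
    have "norm y * M \<le> 1 * M" using that M(2) by (intro mult_right_mono) (auto simp: C_def)
    then show ?thesis using M(1)[of y] by simp
  qed
  ultimately obtain y0 where y0: "y0 \<in> C" and max: "\<And>x. x \<in> C \<Longrightarrow> \<psi> x \<le> \<psi> y0 + e * norm (x - y0)"
    using ekeland[of C 0 \<psi> M e] e by blast
  have conv: "convex C" unfolding C_def by (intro convex_Int convex_cball subspace_imp_convex Y)
  \<comment> \<open>The cone of directions from \<open>y0\<close> into the ball. On it
    \<open>\<psi> \<le> e * norm\<close>, and its being a convex cone makes \<open>p\<close> below
    sublinear.\<close>
  define D where "D = {t *\<^sub>R (x - y0) |t x. 0 \<le> t \<and> x \<in> C}"
  have D0: "0 \<in> D" unfolding D_def by (intro CollectI exI[of _ 0] exI[of _ y0]) (simp add: y0)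
  have Dle: "\<psi> d \<le> e * norm d" if "d \<in> D" for d
  proof -
    obtain t x where d: "d = t *\<^sub>R (x - y0)" "0 \<le> t" "x \<in> C" using \<open>d \<in> D\<close> unfolding D_def by blast
    have "t * \<psi> (x - y0) \<le> t * (e * norm (x - y0))"
      using max[OF d(3)] d(2) by (intro mult_left_mono) (auto simp: diff)
    then show ?thesis using d by (simp add: scaleR mult.left_commute)
  qed
  have Dadd: "d + d' \<in> D" if "d \<in> D" "d' \<in> D" for d d'
  proof -
    obtain t x where d: "d = t *\<^sub>R (x - y0)" "0 \<le> t" "x \<in> C" using \<open>d \<in> D\<close> unfolding D_def by blast
    obtain s z where d': "d' = s *\<^sub>R (z - y0)" "0 \<le> s" "z \<in> C" using \<open>d' \<in> D\<close> unfolding D_def by blast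
    show ?thesis
    proof (cases "t + s = 0")
      case True then have "t = 0" "s = 0" using d d' by auto
      then show ?thesis using d d' D0 by simp
    next
      case False
      let ?z = "(t / (t + s)) *\<^sub>R x + (s / (t + s)) *\<^sub>R z"
      have "?z \<in> C" by (rule convexD[OF conv d(3) d'(3)]) (use d d' False in \<open>simp_all flip: add_divide_distrib\<close>)
      moreover have "(t + s) *\<^sub>R ?z = t *\<^sub>R x + s *\<^sub>R z" using False by (simp add: scaleR_add_right)
      then have "(t + s) *\<^sub>R (?z - y0) = d + d'"
        unfolding d d' by (simp only: scaleR_diff_right scaleR_add_left) simp
      ultimately show ?thesis unfolding D_def using d d'
        by (auto intro!: exI[of _ "t + s"] exI[of _ ?z])
    qed
  qed
  have Dscale: "c *\<^sub>R d \<in> D" if "d \<in> D" "0 \<le> c" for d c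
  proof -
    obtain t x where d: "d = t *\<^sub>R (x - y0)" "0 \<le> t" "x \<in> C" using \<open>d \<in> D\<close> unfolding D_def by blast
    then show ?thesis unfolding D_def using that by (intro CollectI exI[of _ "c * t"] exI[of _ x]) auto
  qed
  \<comment> \<open>A linear \<open>\<eta> \<le> p\<close> does both jobs: the direction
    \<open>d = 0\<close> gives \<open>\<eta> v \<le> e * norm v\<close>, and \<open>v = - d\<close>
    gives \<open>\<psi> d \<le> \<eta> d\<close> on the cone.\<close>
  define p where "p v = (INF d\<in>D. e * norm (v + d) - \<psi> d)" for v
  have lb: "- e * norm v \<le> e * norm (v + d) - \<psi> d" if "d \<in> D" for v d
  proof -
    have "norm d \<le> norm (v + d) + norm v" using norm_triangle_ineq4[of "v + d" v] by simp
    then have "e * norm d \<le> e * norm (v + d) + e * norm v" using e by (simp add: distrib_left[symmetric])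
    then show ?thesis using Dle[OF that] by simp
  qed
  have bdd: "bdd_below ((\<lambda>d. e * norm (v + d) - \<psi> d) ` D)" for v
    using lb[of _ v] by (auto simp: bdd_below_def intro!: exI[of _ "- e * norm v"])
  have p_le: "p v \<le> e * norm (v + d) - \<psi> d" if "d \<in> D" for v d
    unfolding p_def by (rule cINF_lower[OF bdd that])
  have p_ge: "a \<le> p v" if "\<And>d. d \<in> D \<Longrightarrow> a \<le> e * norm (v + d) - \<psi> d" for a v
    unfolding p_def by (rule cINF_greatest) (use D0 that in auto)
  have p_scale_le: "p (c *\<^sub>R v) \<le> c * p v" if c: "c > 0" for c v
  proof -
    have "p (c *\<^sub>R v) / c \<le> p v"
    proof (rule p_ge)
      fix d assume d: "d \<in> D"
      have "p (c *\<^sub>R v) \<le> e * norm (c *\<^sub>R v + c *\<^sub>R d) - \<psi> (c *\<^sub>R d)"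
        by (rule p_le) (use Dscale d c in auto)
      also have "c *\<^sub>R v + c *\<^sub>R d = c *\<^sub>R (v + d)" by (simp add: scaleR_add_right)
      also have "e * norm (c *\<^sub>R (v + d)) - \<psi> (c *\<^sub>R d) = c * (e * norm (v + d) - \<psi> d)"
        using c by (simp add: scaleR right_diff_distrib)
      finally show "p (c *\<^sub>R v) / c \<le> e * norm (v + d) - \<psi> d" using c by (simp add: divide_le_eq mult.commute)
    qed
    then show ?thesis using c by (simp add: divide_le_eq mult.commute)
  qed
  have "sublinear p" unfolding sublinear_def
  proof (intro conjI allI impI)
    fix x y
    have "p (x + y) - p y \<le> p x"
    proof (rule p_ge)
      fix d assume d: "d \<in> D"
      have "p (x + y) - (e * norm (x + d) - \<psi> d) \<le> p y"
      proof (rule p_ge)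
        fix d' assume d': "d' \<in> D"
        have "p (x + y) \<le> e * norm ((x + y) + (d + d')) - \<psi> (d + d')" by (rule p_le[OF Dadd[OF d d']])
        moreover have "norm ((x + y) + (d + d')) \<le> norm (x + d) + norm (y + d')"
          using norm_triangle_ineq[of "x + d" "y + d'"] by (simp add: algebra_simps)
        then have "e * norm ((x + y) + (d + d')) \<le> e * norm (x + d) + e * norm (y + d')"
          using e by (metis distrib_left less_imp_le mult_left_mono)
        ultimately show "p (x + y) - (e * norm (x + d) - \<psi> d) \<le> e * norm (y + d') - \<psi> d'"
          by (simp add: add)
      qed
      then show "p (x + y) - p y \<le> e * norm (x + d) - \<psi> d" by simp
    qed
    then show "p (x + y) \<le> p x + p y" by simp
  next
    fix c :: real and x assume c: "0 \<le> c"
    show "p (c *\<^sub>R x) = c * p x"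
    proof (cases "c = 0")
      case True
      have "p 0 = 0" using p_le[OF D0, of 0] p_ge[of 0 0] lb[of _ 0] by (simp add: zero)
      then show ?thesis using True by simp
    next
      case False
      then have c: "c > 0" using c by simp
      have "p ((1 / c) *\<^sub>R (c *\<^sub>R x)) \<le> (1 / c) * p (c *\<^sub>R x)" by (rule p_scale_le) (use c in simp)
      then have "c * p x \<le> p (c *\<^sub>R x)" using c by (simp add: field_simps)
      then show ?thesis using p_scale_le[OF c, of x] by simp
    qed
  qed
  moreover have "0 \<le> p 0" using p_ge[of 0 0] lb[of _ 0] by simp
  ultimately obtain \<eta> where eta: "linear \<eta>" "\<And>v. \<eta> v \<le> p v"
    using hahn_banach[of p "{0}" "\<lambda>_. 0"] by (auto simp: subspace_def)
  interpret eta: linear \<eta> by (rule eta)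
  show ?thesis
  proof (intro exI conjI allI ballI impI)
    show "linear \<eta>" by (rule eta(1))
    show "\<eta> v \<le> e * norm v" for v using eta(2)[of v] p_le[OF D0, of v] by (simp add: zero)
    show "y0 \<in> Y" "norm y0 \<le> 1" using y0 by (auto simp: C_def)
    fix y assume y: "y \<in> Y" "norm y \<le> 1"
    have "y - y0 \<in> D" unfolding D_def using y by (auto simp: C_def intro!: exI[of _ 1] exI[of _ y])
    from p_le[OF this, of "- (y - y0)"] eta(2)[of "- (y - y0)"]
    have "\<eta> (- (y - y0)) \<le> - \<psi> (y - y0)" by (simp add: zero)
    then show "\<psi> y - \<eta> y \<le> \<psi> y0 - \<eta> y0" by (simp add: eta.neg eta.diff diff)
  qed
qed

section \<open>Compactness and the scalar field\<close>

lemma hausdorff_fun: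
  fixes f g :: "'a \<Rightarrow> 'b::t2_space"
  assumes "f \<noteq> g"
  shows "\<exists>U V. open U \<and> open V \<and> f \<in> U \<and> g \<in> V \<and> U \<inter> V = {}"
proof -
  from assms obtain x where "f x \<noteq> g x" by auto
  then obtain U V where UV: "open U" "open V" "f x \<in> U" "g x \<in> V" "U \<inter> V = {}"
    using hausdorff by metis
  have "continuous_on UNIV (\<lambda>h. h x :: 'b)" by (rule continuous_on_product_coordinates)
  then have "open ((\<lambda>h. h x) -` U)" "open ((\<lambda>h. h x) -` V)" using UV open_vimage by blast+
  with UV show ?thesis
    by - (rule exI[of _ "(\<lambda>h. h x) -` U"], rule exI[of _ "(\<lambda>h. h x) -` V"], auto)
qed

lemma compact_cball_rc_field: "compact (cball (0 :: 'k::rc_field) r)"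
  using real_or_complex[where 'a = 'k]
proof
  assume *: "\<forall>z::'k. \<exists>a. z = a *\<^sub>R 1"
  have "cball (0::'k) r \<subseteq> (\<lambda>a. a *\<^sub>R 1) ` {- r..r}"
  proof
    fix z :: 'k assume z: "z \<in> cball 0 r"
    obtain a where "z = a *\<^sub>R 1" using * by blast
    then show "z \<in> (\<lambda>a. a *\<^sub>R 1) ` {- r..r}" using z by (intro image_eqI[of _ _ a]) auto
  qed
  moreover have "compact ((\<lambda>a. a *\<^sub>R (1::'k)) ` {- r..r})"
    by (intro compact_continuous_image continuous_intros compact_Icc)
  ultimately show ?thesis by (metis closed_cball compact_Int_closed inf.absorb2)
next
  assume "\<exists>i::'k. i * i = - 1 \<and> (\<forall>z. \<exists>a b. z = a *\<^sub>R 1 + b *\<^sub>R i) \<and>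
          (\<forall>a b. norm (a *\<^sub>R 1 + b *\<^sub>R i) = sqrt (a\<^sup>2 + b\<^sup>2))"
  then obtain i :: 'k where i: "\<And>z. \<exists>a b. z = a *\<^sub>R 1 + b *\<^sub>R i"
    "\<And>a b. norm (a *\<^sub>R 1 + b *\<^sub>R i) = sqrt (a\<^sup>2 + b\<^sup>2)" by blast
  let ?f = "\<lambda>(a, b). a *\<^sub>R 1 + b *\<^sub>R i"
  have "cball (0::'k) r \<subseteq> ?f ` ({- r..r} \<times> {- r..r})"
  proof
    fix z :: 'k assume z: "z \<in> cball 0 r"
    obtain a b where ab: "z = a *\<^sub>R 1 + b *\<^sub>R i" using i by blast
    have "\<bar>a\<bar> \<le> sqrt (a\<^sup>2 + b\<^sup>2)" "\<bar>b\<bar> \<le> sqrt (a\<^sup>2 + b\<^sup>2)" by (simp_all add: real_le_rsqrt)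
    moreover have "sqrt (a\<^sup>2 + b\<^sup>2) \<le> r" using z ab by (simp flip: i(2))
    ultimately have "\<bar>a\<bar> \<le> r" "\<bar>b\<bar> \<le> r" by linarith+
    then show "z \<in> ?f ` ({- r..r} \<times> {- r..r})" using ab by (auto intro!: image_eqI[of _ _ "(a, b)"])
  qed
  moreover have "compact (?f ` ({- r..r} \<times> {- r..r}))"
    by (intro compact_continuous_image compact_Times compact_Icc)
       (auto simp: case_prod_beta intro!: continuous_intros)
  ultimately show ?thesis by (metis closed_cball compact_Int_closed inf.absorb2)
qed

text \<open>Tychonoff's theorem, as functions carry the topology of pointwise convergence. It is
  behind both the weak* compactness of the ball and the cluster points that define vector
  measures.\<close>

lemma compact_bounded_functions:
  "compact {F :: 'i \<Rightarrow> 'k::rc_field. \<forall>i. norm (F i) \<le> b i}"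
proof -
  have "compactin (product_topology (\<lambda>_. euclidean) UNIV) (PiE UNIV (\<lambda>i. cball (0::'k) (b i)))"
    by (subst compactin_PiE) (auto simp: compact_cball_rc_field)
  moreover have "PiE UNIV (\<lambda>i. cball (0::'k) (b i)) = {F. \<forall>i. norm (F i) \<le> b i}"
    by (auto simp: PiE_def Pi_def)
  ultimately show ?thesis by (simp add: euclidean_product_topology)
qed

text \<open>Hahn-Banach extends the identity of the real line to the whole field below the norm,
  which gives a real part for both fields without a case distinction.\<close>

lemma rc_field_Re_exists:
  "\<exists>f :: 'k::rc_field \<Rightarrow> real. linear f \<and> (\<forall>r. f (of_real r) = r) \<and> (\<forall>z. \<bar>f z\<bar> \<le> norm z)"
proof -
  have inj: "inj (of_real :: real \<Rightarrow> 'k)" by (simp add: inj_def)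
  let ?g = "inv (of_real :: real \<Rightarrow> 'k)"
  have g: "?g (of_real r) = r" for r by (rule inv_f_f[OF inj])
  have "sublinear (norm :: 'k \<Rightarrow> real)" by (auto simp: sublinear_def norm_triangle_ineq)
  then obtain f :: "'k \<Rightarrow> real" where f: "linear f" "\<And>x. x \<in> range of_real \<Longrightarrow> f x = ?g x" "\<And>x. f x \<le> norm x"
  proof (rule hahn_banach[of norm "range of_real" ?g])
    show "subspace (range (of_real :: real \<Rightarrow> 'k))"
      unfolding subspace_def by (auto simp flip: of_real_add simp: scaleR_conv_of_real simp flip: of_real_mult intro: range_eqI[of _ _ 0])
    show "?g (x + y) = ?g x + ?g y" if "x \<in> range of_real" "y \<in> range of_real" for x y
      using that by (auto simp: g simp flip: of_real_add)
    show "?g (c *\<^sub>R x) = c * ?g x" if "x \<in> range of_real" for c x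
      using that by (auto simp: g scaleR_conv_of_real simp flip: of_real_mult)
    show "?g x \<le> norm x" if "x \<in> range of_real" for x using that by (auto simp: g)
  qed auto
  have "\<bar>f z\<bar> \<le> norm z" for z
    using f(3)[of z] f(3)[of "- z"] linear_neg[OF f(1), of z] by simp
  moreover have "f (of_real r) = r" for r using f(2)[of "of_real r"] g by simp
  ultimately show ?thesis using f(1) by blast
qed

definition scalar_Re :: "'k::rc_field \<Rightarrow> real" where
  "scalar_Re = (SOME f. linear f \<and> (\<forall>r. f (of_real r) = r) \<and> (\<forall>z. \<bar>f z\<bar> \<le> norm z))"

lemma scalar_Re:
  shows linear_scalar_Re: "linear (scalar_Re :: 'k::rc_field \<Rightarrow> real)"
    and scalar_Re_of_real [simp]: "scalar_Re (of_real r :: 'k) = r"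
    and abs_scalar_Re_le: "\<bar>scalar_Re (z :: 'k)\<bar> \<le> norm z"
  using someI_ex[OF rc_field_Re_exists[where 'k = 'k]] unfolding scalar_Re_def by blast+

lemma bounded_linear_scalar_Re: "bounded_linear (scalar_Re :: 'k::rc_field \<Rightarrow> real)"
  by (rule bounded_linear_intro[where K = 1])
     (auto simp: linear_add[OF linear_scalar_Re] linear_scale[OF linear_scalar_Re] abs_scalar_Re_le)

lemma scalar_Re_add [simp]: "scalar_Re (a + b) = scalar_Re a + scalar_Re b"
  and scalar_Re_diff [simp]: "scalar_Re (a - b) = scalar_Re a - scalar_Re b"
  and scalar_Re_minus [simp]: "scalar_Re (- a) = - scalar_Re a"
  and scalar_Re_0 [simp]: "scalar_Re 0 = 0"
  and scalar_Re_scaleR [simp]: "scalar_Re (r *\<^sub>R a) = r * scalar_Re a"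
  and scalar_Re_of_real_mult [simp]: "scalar_Re (of_real r * a) = r * scalar_Re a"
  and scalar_Re_sum: "scalar_Re (sum f A) = (\<Sum>x\<in>A. scalar_Re (f x))"
  by (simp_all add: linear_add[OF linear_scalar_Re] linear_diff[OF linear_scalar_Re]
      linear_neg[OF linear_scalar_Re] linear_0[OF linear_scalar_Re] linear_scale[OF linear_scalar_Re]
      linear_sum[OF linear_scalar_Re] flip: scaleR_conv_of_real)

lemma unimodular_rotation:
  obtains u :: "'k::rc_field" where "norm u = 1" "u * z = of_real (norm z)"
proof (cases "z = 0")
  case True then show ?thesis using that[of 1] by simp
next
  case False then show ?thesis using that[of "of_real (norm z) / z"] by (simp add: norm_divide)
qed

text \<open>Dividing by the square roots \<open>s n\<close> of the tails preserves summability: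
  \<open>k i / s i\<close> is at most \<open>2 * (s i - s (Suc i))\<close>, which
  telescopes.\<close>

lemma rescaling_sequence:
  fixes l :: "nat \<Rightarrow> real"
  assumes l: "summable l" "\<And>i. 0 \<le> l i"
  obtains r where "\<And>i. 1 \<le> r i" "filterlim r at_top sequentially" "summable (\<lambda>i. l i * r i)"
proof -
  \<comment> \<open>The geometric summand keeps all tails positive even if \<open>l\<close> vanishes
    from some index on.\<close>
  define k where "k i = l i + (1/2)^i" for i
  have k: "summable k" unfolding k_def by (intro summable_add l summable_geometric) simp
  have kpos: "k i > 0" for i using l(2)[of i] by (simp add: k_def add_nonneg_pos)
  define T where "T n = (\<Sum>i. k (i + n))" for n
  have ks: "summable (\<lambda>i. k (i + n))" for n using k by (simp add: summable_iff_shift)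
  have Tpos: "T n > 0" for n unfolding T_def by (rule suminf_pos[OF ks]) (rule kpos)
  have Teq: "T n = suminf k - (\<Sum>i<n. k i)" for n
    unfolding T_def by (rule suminf_minus_initial_segment[OF k])
  have T0: "T \<longlonglongrightarrow> 0"
    unfolding Teq using tendsto_diff[OF tendsto_const[of "suminf k"] summable_LIMSEQ[OF k]] by simp
  define s where "s n = sqrt (T n)" for n
  have spos: "s n > 0" for n using Tpos by (simp add: s_def)
  have s2: "s n * s n = T n" for n using Tpos[of n] by (simp add: s_def)
  have s0: "s \<longlonglongrightarrow> 0" unfolding s_def using tendsto_real_sqrt[OF T0] by simp
  have dec: "s (Suc n) \<le> s n" for n
    unfolding s_def using kpos[of n] by (simp add: Teq)
  have bound: "k i / s i \<le> 2 * (s i - s (Suc i))" for i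
  proof -
    have "k i = s i * s i - s (Suc i) * s (Suc i)" unfolding s2 by (simp add: Teq)
    also have "\<dots> = (s i - s (Suc i)) * (s i + s (Suc i))" by (simp add: algebra_simps)
    also have "\<dots> \<le> (s i - s (Suc i)) * (2 * s i)" using dec[of i] by (intro mult_left_mono) auto
    finally show ?thesis using spos[of i] by (simp add: pos_divide_le_eq mult.assoc mult.left_commute mult.commute)
  qed
  have "summable (\<lambda>i. s i - s (Suc i))"
    using telescope_summable'[OF s0] by simp
  then have "summable (\<lambda>i. 2 * (s i - s (Suc i)))" by (rule summable_mult)
  then have sk: "summable (\<lambda>i. k i / s i)"
    by (rule summable_comparison_test'[where N = 0])
       (use bound kpos spos in \<open>simp add: abs_of_pos\<close>)
  show thesis
  proof (rule that[of "\<lambda>i. 1 + 1 / s i"])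
    show "1 \<le> 1 + 1 / s i" for i using spos[of i] by simp
    have "filterlim s (at_right 0) sequentially"
      using s0 spos by (simp add: tendsto_imp_filterlim_at_right)
    then have "filterlim (\<lambda>i. inverse (s i)) at_top sequentially"
      by (rule filterlim_compose[OF filterlim_inverse_at_top_right])
    then show "filterlim (\<lambda>i. 1 + 1 / s i) at_top sequentially"
      by (intro filterlim_tendsto_add_at_top[OF tendsto_const]) (simp add: inverse_eq_divide)
    have "summable (\<lambda>i. l i / s i)"
      by (rule summable_comparison_test'[OF sk, of 0])
         (use l(2) spos in \<open>simp add: k_def abs_of_pos divide_right_mono less_imp_le abs_of_nonneg\<close>)
    from summable_add[OF l(1) this] show "summable (\<lambda>i. l i * (1 + 1 / s i))"
      by (simp add: algebra_simps)
  qed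
qed


section \<open>Finite-dimensional function spaces\<close>

definition lin_comb :: "('s \<Rightarrow> 'k::field) set \<Rightarrow> 's set \<Rightarrow> ('s \<Rightarrow> 'k) \<Rightarrow> bool" where
  "lin_comb B S f \<longleftrightarrow> (\<exists>c. \<forall>s\<in>S. f s = (\<Sum>b\<in>B. c b * b s))"

lemma lin_comb_member:
  assumes "finite B" "b \<in> B"
  shows "lin_comb B S b"
proof -
  have "(\<Sum>x\<in>B. (if x = b then 1 else 0) * x s) = (\<Sum>x\<in>B. if x = b then x s else 0)" for s
    by (rule sum.cong) auto
  then show ?thesis
    unfolding lin_comb_def using assms by (intro exI[of _ "\<lambda>x. if x = b then 1 else 0"]) simp
qed

lemma lin_comb_add: "lin_comb B S f \<Longrightarrow> lin_comb B S g \<Longrightarrow> lin_comb B S (\<lambda>s. f s + g s)"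
  unfolding lin_comb_def
proof (elim exE)
  fix c d assume "\<forall>s\<in>S. f s = (\<Sum>b\<in>B. c b * b s)" "\<forall>s\<in>S. g s = (\<Sum>b\<in>B. d b * b s)"
  then show "\<exists>c. \<forall>s\<in>S. f s + g s = (\<Sum>b\<in>B. c b * b s)"
    by (intro exI[of _ "\<lambda>b. c b + d b"]) (simp add: distrib_right sum.distrib)
qed

lemma lin_comb_scale: "lin_comb B S f \<Longrightarrow> lin_comb B S (\<lambda>s. k * f s)"
  unfolding lin_comb_def
proof (elim exE)
  fix c assume "\<forall>s\<in>S. f s = (\<Sum>b\<in>B. c b * b s)"
  then show "\<exists>c. \<forall>s\<in>S. k * f s = (\<Sum>b\<in>B. c b * b s)"
    by (intro exI[of _ "\<lambda>b. k * c b"]) (simp add: sum_distrib_left mult.assoc)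
qed

lemma lin_comb_sum: "(\<And>i. i \<in> I \<Longrightarrow> lin_comb B S (f i)) \<Longrightarrow> lin_comb B S (\<lambda>s. \<Sum>i\<in>I. f i s)"
proof (induction I rule: infinite_finite_induct)
  case (insert i I) then show ?case using lin_comb_add[of B S "f i" "\<lambda>s. \<Sum>i\<in>I. f i s"] by simp
qed (auto simp: lin_comb_def intro!: exI[of _ "\<lambda>_. 0"])

lemma lin_comb_mono: "lin_comb B S f \<Longrightarrow> finite C \<Longrightarrow> B \<subseteq> C \<Longrightarrow> lin_comb C S f"
  unfolding lin_comb_def
proof (elim exE)
  fix c assume *: "\<forall>s\<in>S. f s = (\<Sum>b\<in>B. c b * b s)" "finite C" "B \<subseteq> C"
  have "(\<Sum>b\<in>C. (if b \<in> B then c b else 0) * b s) = (\<Sum>b\<in>B. c b * b s)" for s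
    by (rule sum.mono_neutral_cong_right) (use * in auto)
  with * show "\<exists>c. \<forall>s\<in>S. f s = (\<Sum>b\<in>C. c b * b s)"
    by (intro exI[of _ "\<lambda>b. if b \<in> B then c b else 0"]) simp
qed

text \<open>Nodes are found one at a time: if the error \<open>b'\<close> of interpolating a new
  function is nonzero somewhere on \<open>S\<close>, such a point becomes the next node. The
  induction carries only the reproduction formula, not a duality between nodes and
  functions.\<close>

lemma interpolation:
  fixes B :: "('s \<Rightarrow> 'k::field) set"
  assumes "finite B"
  shows "\<exists>(m::nat) y h. (\<forall>j<m. y j \<in> S \<and> lin_comb B S (h j)) \<and>
    (\<forall>f. lin_comb B S f \<longrightarrow> (\<forall>s\<in>S. f s = (\<Sum>j<m. f (y j) * h j s)))"
proof -
  have "\<exists>(m::nat) y h. (\<forall>j<m. y j \<in> S \<and> lin_comb B S (h j)) \<and>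
      (\<forall>b\<in>B. \<forall>s\<in>S. b s = (\<Sum>j<m. b (y j) * h j s))"
    using assms
  proof (induction B)
    case empty then show ?case by (intro exI[of _ 0]) auto
  next
    case (insert b B)
    then obtain m :: nat and y h where IH: "\<And>j. j < m \<Longrightarrow> y j \<in> S" "\<And>j. j < m \<Longrightarrow> lin_comb B S (h j)"
      "\<And>g s. g \<in> B \<Longrightarrow> s \<in> S \<Longrightarrow> g s = (\<Sum>j<m. g (y j) * h j s)" by blast
    have fin: "finite (insert b B)" using insert by simp
    have hB: "lin_comb (insert b B) S (h j)" if "j < m" for j
      by (rule lin_comb_mono[OF IH(2)[OF that] fin]) auto
    define b' where "b' s = b s + (\<Sum>j<m. (- b (y j)) * h j s)" for s
    have b'1: "lin_comb (insert b B) S b'" unfolding b'_def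
      by (rule lin_comb_add[OF lin_comb_member[OF fin insertI1] lin_comb_sum[OF lin_comb_scale[OF hB]]]) auto
    have bb': "b s = b' s + (\<Sum>j<m. b (y j) * h j s)" for s by (simp add: b'_def sum_negf)
    show ?case
    proof (cases "\<forall>s\<in>S. b' s = 0")
      case True
      have "g s = (\<Sum>j<m. g (y j) * h j s)" if "g \<in> insert b B" "s \<in> S" for g s
        using that True IH(3) bb'[of s] by (cases "g = b") auto
      then show ?thesis using IH(1) hB by blast
    next
      case False
      then obtain z where z: "z \<in> S" "b' z \<noteq> 0" by blast
      \<comment> \<open>\<open>hn\<close> is 1 at the new node \<open>z\<close>, and multiples of it
        make the old functions vanish there; by \<open>expand\<close> the new sum adds
        \<open>hn\<close> times the old error at \<open>z\<close>.\<close>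
      define hn where "hn s = (1 / b' z) * b' s" for s
      have hn1: "lin_comb (insert b B) S hn" unfolding hn_def by (intro lin_comb_scale b'1)
      have hnz: "b' z * hn s = b' s" for s using z by (simp add: hn_def)
      define h' where "h' j s = (if j < m then h j s + (- h j z) * hn s else hn s)" for j s
      define y' where "y' j = (if j < m then y j else z)" for j
      have expand: "(\<Sum>j<Suc m. g (y' j) * h' j s) = (\<Sum>j<m. g (y j) * h j s) + (g z - (\<Sum>j<m. g (y j) * h j z)) * hn s" for g s
        by (simp add: h'_def y'_def algebra_simps sum.distrib sum_negf sum_distrib_left sum_distrib_right sum_subtractf)
      have "g s = (\<Sum>j<Suc m. g (y' j) * h' j s)" if "g \<in> insert b B" "s \<in> S" for g s
      proof (cases "g = b")
        case True then show ?thesis unfolding expand using bb'[of z] bb'[of s] hnz[of s] by simp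
      next
        case False then show ?thesis unfolding expand using IH(3)[of g z] IH(3)[of g s] that z by simp
      qed
      moreover have "lin_comb (insert b B) S (h' j)" if "j < Suc m" for j
      proof (cases "j < m")
        case True
        then show ?thesis
          unfolding h'_def using lin_comb_add[OF hB[OF True] lin_comb_scale[OF hn1, of "- h j z"]] by simp
      next
        case False then show ?thesis unfolding h'_def using hn1 by simp
      qed
      moreover have "y' j \<in> S" for j using IH(1) z by (simp add: y'_def)
      ultimately show ?thesis by blast
    qed
  qed
  then obtain m :: nat and y h where *: "\<And>j. j < m \<Longrightarrow> y j \<in> S" "\<And>j. j < m \<Longrightarrow> lin_comb B S (h j)"
    "\<And>b s. b \<in> B \<Longrightarrow> s \<in> S \<Longrightarrow> b s = (\<Sum>j<m. b (y j) * h j s)" by blast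
  have "f s = (\<Sum>j<m. f (y j) * h j s)" if f: "lin_comb B S f" and s: "s \<in> S" for f s
  proof -
    obtain c where c: "\<And>s. s \<in> S \<Longrightarrow> f s = (\<Sum>b\<in>B. c b * b s)" using f by (auto simp: lin_comb_def)
    have "(\<Sum>j<m. f (y j) * h j s) = (\<Sum>j<m. \<Sum>b\<in>B. c b * (b (y j) * h j s))"
      by (intro sum.cong refl) (simp add: c[OF *(1)] sum_distrib_right mult.assoc)
    also have "\<dots> = (\<Sum>b\<in>B. c b * (\<Sum>j<m. b (y j) * h j s))"
      by (subst sum.swap) (simp add: sum_distrib_left)
    also have "\<dots> = f s" unfolding c[OF s] by (intro sum.cong refl) (simp flip: *(3)[OF _ s])
    finally show ?thesis by simp
  qed
  then show ?thesis using *(1,2) by blast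
qed

section \<open>Positive functionals on bounded functions\<close>

lemma sum_lessThan_add:
  "(\<Sum>k<n + m. f k) = (\<Sum>k<n. f k) + (\<Sum>k<m. f (n + k))" for f :: "nat \<Rightarrow> 'z::comm_monoid_add"
  by (induction m) (simp_all add: add.assoc)

locale positive_functional =
  fixes Q :: "'q::topological_space set" and \<Lambda> :: "('q \<Rightarrow> real) \<Rightarrow> real"
  assumes add: "bounded (f ` Q) \<Longrightarrow> bounded (g ` Q) \<Longrightarrow> \<Lambda> (\<lambda>q. f q + g q) = \<Lambda> f + \<Lambda> g"
    and scale: "bounded (f ` Q) \<Longrightarrow> \<Lambda> (\<lambda>q. c * f q) = c * \<Lambda> f"
    and nonneg: "bounded (f ` Q) \<Longrightarrow> (\<And>q. q \<in> Q \<Longrightarrow> 0 \<le> f q) \<Longrightarrow> 0 \<le> \<Lambda> f"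
    and one: "\<Lambda> (\<lambda>_. 1) = 1"
    and compact_Q: "compact Q"
    and hausdorff_Q: "p \<in> Q \<Longrightarrow> q \<in> Q \<Longrightarrow> p \<noteq> q \<Longrightarrow> \<exists>U V. open U \<and> open V \<and> p \<in> U \<and> q \<in> V \<and> U \<inter> V = {}"
begin

abbreviation bdd :: "('q \<Rightarrow> real) \<Rightarrow> bool" where "bdd f \<equiv> bounded (f ` Q)"

lemma bddI: "(\<And>q. q \<in> Q \<Longrightarrow> \<bar>f q\<bar> \<le> M) \<Longrightarrow> bdd f"
  unfolding bounded_iff by auto

lemma bdd_add: "bdd f \<Longrightarrow> bdd g \<Longrightarrow> bdd (\<lambda>q. f q + g q)"
  by (rule bounded_plus_comp)

lemma bdd_scale: "bdd f \<Longrightarrow> bdd (\<lambda>q. c * f q)"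
  using bounded_scaling[of "f ` Q" c] by (simp add: image_image)

lemma bdd_indicator: "bdd f \<Longrightarrow> bdd (\<lambda>q. indicator A q * f q)"
proof -
  assume "bdd f"
  then obtain M where "\<And>q. q \<in> Q \<Longrightarrow> \<bar>f q\<bar> \<le> M" unfolding bounded_iff by auto
  then show ?thesis by (intro bddI[of _ "max M 0"]) (auto simp: indicator_def le_max_iff_disj)
qed

lemma diff: "bdd f \<Longrightarrow> bdd g \<Longrightarrow> \<Lambda> (\<lambda>q. f q - g q) = \<Lambda> f - \<Lambda> g"
  using add[of f "\<lambda>q. (-1) * g q"] bdd_scale[of g "-1"] scale[of g "-1"] by simp

lemma mono:
  assumes "bdd f" "bdd g" "\<And>q. q \<in> Q \<Longrightarrow> f q \<le> g q"
  shows "\<Lambda> f \<le> \<Lambda> g"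
proof -
  have "bdd (\<lambda>q. g q - f q)" using bdd_add[OF assms(2) bdd_scale[OF assms(1), of "-1"]] by simp
  from nonneg[OF this] have "0 \<le> \<Lambda> (\<lambda>q. g q - f q)" using assms(3) by simp
  then show ?thesis by (simp add: diff assms)
qed

lemma cong: "bdd f \<Longrightarrow> bdd g \<Longrightarrow> (\<And>q. q \<in> Q \<Longrightarrow> f q = g q) \<Longrightarrow> \<Lambda> f = \<Lambda> g"
  by (intro order_antisym mono) auto

definition mass :: "'q set \<Rightarrow> real" where "mass A = \<Lambda> (indicator A)"

lemma bdd_ind [simp]: "bdd (indicator A)"
  by (rule bddI[of _ 1]) (simp add: indicator_def)

lemma mass_nonneg: "0 \<le> mass A"
  unfolding mass_def by (rule nonneg) auto

lemma mass_mono: "A \<inter> Q \<subseteq> B \<Longrightarrow> mass A \<le> mass B"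
  unfolding mass_def by (rule mono[OF bdd_ind bdd_ind]) (auto simp: indicator_def)

lemma mass_split: "mass A = mass (A \<inter> C) + mass (A - C)"
proof -
  have "\<Lambda> (indicator A) = \<Lambda> (\<lambda>q. indicator (A \<inter> C) q + indicator (A - C) q)"
    by (rule cong[OF bdd_ind bdd_add[OF bdd_ind bdd_ind]]) (auto simp: indicator_def)
  then show ?thesis by (simp only: mass_def add[OF bdd_ind bdd_ind])
qed

lemma mass_empty: "mass {} = 0"
  using mass_split[of "{}" "{}"] by simp

lemma mass_Q: "mass Q = 1"
proof -
  have "\<Lambda> (indicator Q) = \<Lambda> (\<lambda>_. 1)" by (rule cong[OF bdd_ind bddI[of _ 1]]) auto
  then show ?thesis by (simp add: mass_def one)
qed

lemma integral_split:
  "bdd f \<Longrightarrow> \<Lambda> (\<lambda>q. indicator A q * f q) =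
     \<Lambda> (\<lambda>q. indicator (A \<inter> C) q * f q) + \<Lambda> (\<lambda>q. indicator (A - C) q * f q)"
proof -
  assume f: "bdd f"
  note bi = bdd_indicator[OF f]
  have "\<Lambda> (\<lambda>q. indicator A q * f q) = \<Lambda> (\<lambda>q. indicator (A \<inter> C) q * f q + indicator (A - C) q * f q)"
    by (rule cong[OF bi bdd_add[OF bi bi]]) (auto simp: indicator_def)
  then show ?thesis by (simp only: add[OF bi bi])
qed

lemma abs_integral_le:
  assumes f: "bdd f" and b: "\<And>q. q \<in> A \<inter> Q \<Longrightarrow> \<bar>f q\<bar> \<le> b + c * indicator D q"
  shows "\<bar>\<Lambda> (\<lambda>q. indicator A q * f q)\<bar> \<le> b * mass A + c * mass (A \<inter> D)"
proof -
  let ?g = "\<lambda>q. b * indicator A q + c * indicator (A \<inter> D) q"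
  have g: "bdd ?g" by (intro bdd_add bdd_scale bdd_ind)
  have eq: "\<Lambda> ?g = b * mass A + c * mass (A \<inter> D)"
    by (simp add: add scale bdd_scale mass_def)
  have *: "\<bar>indicator A q * f q\<bar> \<le> ?g q" if "q \<in> Q" for q
    using b[of q] that by (auto simp: indicator_def split: if_splits)
  have "\<Lambda> (\<lambda>q. indicator A q * f q) \<le> \<Lambda> ?g"
    by (rule mono[OF bdd_indicator[OF f] g]) (use * in \<open>fastforce simp: abs_le_iff\<close>)
  moreover have "\<Lambda> (\<lambda>q. - 1 * (indicator A q * f q)) \<le> \<Lambda> ?g"
    by (rule mono[OF bdd_scale[OF bdd_indicator[OF f]] g]) (use * in \<open>fastforce simp: abs_le_iff\<close>)
  ultimately show ?thesis
    unfolding scale[OF bdd_indicator[OF f]] eq by simp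
qed

definition approximable :: "'q set \<Rightarrow> ('q \<Rightarrow> real) set \<Rightarrow> real \<Rightarrow> 'q set \<Rightarrow> bool" where
  "approximable K Y e A \<longleftrightarrow> (\<exists>(n::nat) c q. (\<forall>k<n. 0 \<le> c k \<and> q k \<in> K) \<and> (\<Sum>k<n. c k) \<le> mass A \<and>
     (\<forall>y\<in>Y. \<bar>\<Lambda> (\<lambda>q. indicator A q * y q) - (\<Sum>k<n. c k * y (q k))\<bar> \<le> e))"

text \<open>The error is proportional to the mass of \<open>A\<close> up to an arbitrarily small amount, which makes it
  additive over disjoint unions.\<close>

definition discretisable :: "'q set \<Rightarrow> ('q \<Rightarrow> real) set \<Rightarrow> real \<Rightarrow> 'q set \<Rightarrow> bool" where
  "discretisable K Y \<epsilon> A \<longleftrightarrow> (\<forall>\<eta>>0. approximable K Y (\<epsilon> * mass A + \<eta>) A)"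

text \<open>Masses and errors add over \<open>A \<inter> C\<close> and \<open>A - C\<close>. The cut
  \<open>C\<close> may depend on \<open>\<eta>\<close>, as it does in an exhaustion by compact
  sets.\<close>

lemma discretisable_split:
  assumes Y: "\<And>y. y \<in> Y \<Longrightarrow> bdd y"
    and split: "\<And>\<eta>. 0 < \<eta> \<Longrightarrow> \<exists>C. approximable K Y (\<epsilon> * mass (A \<inter> C) + \<eta>) (A \<inter> C) \<and>
      approximable K Y (\<epsilon> * mass (A - C) + \<eta>) (A - C)"
  shows "discretisable K Y \<epsilon> A"
  unfolding discretisable_def
proof (intro allI impI)
  fix \<eta> :: real assume "\<eta> > 0"
  then have "\<eta> / 2 > 0" by simp
  from split[OF this] obtain C where
    "approximable K Y (\<epsilon> * mass (A \<inter> C) + \<eta> / 2) (A \<inter> C)"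
    "approximable K Y (\<epsilon> * mass (A - C) + \<eta> / 2) (A - C)" by blast
  then obtain n m :: nat and c d :: "nat \<Rightarrow> real" and q r where
    n: "\<forall>k<n. 0 \<le> c k \<and> q k \<in> K" "(\<Sum>k<n. c k) \<le> mass (A \<inter> C)"
     "\<forall>y\<in>Y. \<bar>\<Lambda> (\<lambda>q. indicator (A \<inter> C) q * y q) - (\<Sum>k<n. c k * y (q k))\<bar> \<le> \<epsilon> * mass (A \<inter> C) + \<eta> / 2"
    and m: "\<forall>k<m. 0 \<le> d k \<and> r k \<in> K" "(\<Sum>k<m. d k) \<le> mass (A - C)"
     "\<forall>y\<in>Y. \<bar>\<Lambda> (\<lambda>q. indicator (A - C) q * y q) - (\<Sum>k<m. d k * y (r k))\<bar> \<le> \<epsilon> * mass (A - C) + \<eta> / 2"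
    unfolding approximable_def by blast
  define e where "e k = (if k < n then c k else d (k - n))" for k
  define s where "s k = (if k < n then q k else r (k - n))" for k
  have sum: "(\<Sum>k<n + m. e k * y (s k)) = (\<Sum>k<n. c k * y (q k)) + (\<Sum>k<m. d k * y (r k))" for y
    by (simp add: sum_lessThan_add e_def s_def)
  have "\<bar>\<Lambda> (\<lambda>q. indicator A q * y q) - (\<Sum>k<n + m. e k * y (s k))\<bar> \<le> \<epsilon> * mass A + \<eta>" if "y \<in> Y" for y
    using n(3)[rule_format, OF that] m(3)[rule_format, OF that]
    unfolding sum integral_split[OF Y[OF that], of A C] mass_split[of A C] distrib_left by linarith
  moreover have "(\<Sum>k<n + m. e k) \<le> mass A"
    using sum[of "\<lambda>_. 1"] n m mass_split[of A C] by simp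
  moreover have "\<forall>k<n + m. 0 \<le> e k \<and> s k \<in> K" using n m by (auto simp: e_def s_def)
  ultimately show "approximable K Y (\<epsilon> * mass A + \<eta>) A" unfolding approximable_def by blast
qed

text \<open>Asking for all subsets makes the property pass to finite unions, which have to be cut
  into disjoint pieces before masses add.\<close>

definition hereditary :: "'q set \<Rightarrow> ('q \<Rightarrow> real) set \<Rightarrow> real \<Rightarrow> 'q set \<Rightarrow> bool" where
  "hereditary K Y \<epsilon> A \<longleftrightarrow> (\<forall>B. B \<subseteq> A \<inter> Q \<longrightarrow> discretisable K Y \<epsilon> B)"

lemma hereditary_Un:
  assumes Y: "\<And>y. y \<in> Y \<Longrightarrow> bdd y" and "hereditary K Y \<epsilon> A" "hereditary K Y \<epsilon> B"
  shows "hereditary K Y \<epsilon> (A \<union> B)"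
  unfolding hereditary_def
proof (intro allI impI)
  fix C assume C: "C \<subseteq> (A \<union> B) \<inter> Q"
  have "C \<inter> A \<subseteq> A \<inter> Q" "C - A \<subseteq> B \<inter> Q" using C by auto
  then have "discretisable K Y \<epsilon> (C \<inter> A)" "discretisable K Y \<epsilon> (C - A)"
    using assms(2,3) by (simp_all only: hereditary_def)
  then show "discretisable K Y \<epsilon> C"
    by (intro discretisable_split[OF Y]) (auto simp: discretisable_def intro!: exI[of _ A])
qed

lemma hereditary_null:
  assumes "\<epsilon> \<ge> 0" and Y: "\<And>y. y \<in> Y \<Longrightarrow> bdd y" and "mass (A \<inter> Q) = 0"
  shows "hereditary K Y \<epsilon> A"
  unfolding hereditary_def discretisable_def
proof (intro allI impI)
  fix B and \<eta> :: real assume B: "B \<subseteq> A \<inter> Q" and eta: "\<eta> > 0"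
  have m: "mass B = 0" using mass_mono[of B "A \<inter> Q"] mass_nonneg[of B] B assms(3) by auto
  have "\<bar>\<Lambda> (\<lambda>q. indicator B q * y q)\<bar> \<le> 0" if y: "y \<in> Y" for y
  proof -
    obtain M where "\<And>q. q \<in> Q \<Longrightarrow> \<bar>y q\<bar> \<le> M" using Y[OF y] unfolding bounded_iff by auto
    then show ?thesis using abs_integral_le[OF Y[OF y], of B M 0 "{}"] m by simp
  qed
  then show "approximable K Y (\<epsilon> * mass B + \<eta>) B"
    unfolding approximable_def using eta m by (intro exI[of _ 0]) auto
qed

lemma hereditary_compact:
  assumes "\<epsilon> \<ge> 0" and Y: "\<And>y. y \<in> Y \<Longrightarrow> bdd y" and C: "compact C"
    and cov: "C \<subseteq> \<Union>{U. open U \<and> hereditary K Y \<epsilon> U}"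
  shows "hereditary K Y \<epsilon> C"
proof -
  obtain \<F> where F: "\<F> \<subseteq> {U. open U \<and> hereditary K Y \<epsilon> U}" "finite \<F>" "C \<subseteq> \<Union>\<F>"
    using compactE[OF C cov] by (metis (no_types, lifting) mem_Collect_eq)
  have "hereditary K Y \<epsilon> (\<Union>\<F>)"
    using F(2,1)
  proof (induction \<F> rule: finite_induct)
    case empty
    show ?case by (rule hereditary_null[OF assms(1) Y]) (simp_all add: mass_empty)
  next
    case (insert U \<F>)
    then show ?case using hereditary_Un[OF Y, where A = U and B = "\<Union>\<F>"] by auto
  qed
  then show ?thesis using F(3) unfolding hereditary_def by blast
qed

lemma separate_compact:
  assumes p: "p \<in> Q" and C: "compact C" "C \<subseteq> Q" "p \<notin> C"
  shows "\<exists>U V. open U \<and> open V \<and> p \<in> U \<and> C \<subseteq> V \<and> U \<inter> V = {}"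
proof -
  let ?\<C> = "{V. open V \<and> (\<exists>U. open U \<and> p \<in> U \<and> U \<inter> V = {})}"
  have "C \<subseteq> \<Union>?\<C>" 
  proof
    fix q assume "q \<in> C"
    then have "q \<in> Q" "p \<noteq> q" using C by auto
    from hausdorff_Q[OF p this] show "q \<in> \<Union>?\<C>" by blast
  qed
  from compactE[OF C(1) this] obtain \<F> where F: "\<F> \<subseteq> ?\<C>" "finite \<F>" "C \<subseteq> \<Union>\<F>" by auto
  have "\<exists>U. open U \<and> p \<in> U \<and> U \<inter> \<Union>\<F> = {}"
    using F(2,1)
  proof (induction \<F> rule: finite_induct)
    case empty then show ?case by (intro exI[of _ UNIV]) auto
  next
    case (insert V \<F>)
    then obtain U U' where "open U" "p \<in> U" "U \<inter> \<Union>\<F> = {}" "open U'" "p \<in> U'" "U' \<inter> V = {}" by auto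
    then show ?case by (intro exI[of _ "U \<inter> U'"]) auto
  qed
  moreover have "open (\<Union>\<F>)" using F by auto
  ultimately show ?thesis using F(3) by blast
qed

text \<open>The union \<open>G\<close> of the open sets all of whose subsets can be discretised is everything:
  near a point at which the remainder \<open>Q - G\<close> has small oscillation, the mass outside a large
  compact subset of \<open>G\<close> sits essentially on \<open>Q - G\<close> and is replaced by a point mass.\<close>

theorem discretisation:
  assumes Ybd: "\<And>y q. y \<in> Y \<Longrightarrow> q \<in> Q \<Longrightarrow> \<bar>y q\<bar> \<le> 1"
    and Ycont: "\<And>y. y \<in> Y \<Longrightarrow> continuous_on Q y"
    and frag: "\<And>L \<epsilon>. L \<subseteq> Q \<Longrightarrow> L \<noteq> {} \<Longrightarrow> \<epsilon> > 0 \<Longrightarrow>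
      \<exists>p\<in>L. \<exists>U. open U \<and> p \<in> U \<and> (\<forall>q\<in>L \<inter> U. \<forall>y\<in>Y. \<bar>y q - y p\<bar> \<le> \<epsilon>)"
    and y0: "continuous_on Q y0" "bdd y0" "\<And>q. q \<in> Q \<Longrightarrow> y0 q \<le> 1" "\<Lambda> y0 = 1"
    and e: "\<epsilon> > 0"
  shows "\<exists>(n::nat) c q. (\<forall>k<n. 0 \<le> c k \<and> q k \<in> Q \<and> y0 (q k) = 1) \<and> (\<Sum>k<n. c k) \<le> 1 \<and>
     (\<forall>y\<in>Y. \<bar>\<Lambda> y - (\<Sum>k<n. c k * y (q k))\<bar> \<le> \<epsilon>)"
proof -
  define K where "K = {q \<in> Q. y0 q = 1}"
  have Y: "bdd y" if "y \<in> Y" for y by (rule bddI[of _ 1]) (rule Ybd[OF that])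
  define G where "G = \<Union>{U. open U \<and> hereditary K Y (\<epsilon>/2) U}"
  have Gopen: "open G" unfolding G_def by auto
  \<comment> \<open>Chebyshev's inequality: \<open>\<Lambda> y0 = 1\<close> forces mass 0 on the
    region \<open>y0 < 1 - \<delta>\<close>. So a point outside \<open>G\<close> satisfies
    \<open>y0 = 1\<close> and may carry a point mass.\<close>
  have outK: "q \<in> G" if q: "q \<in> Q" "y0 q < 1" for q
  proof -
    define \<delta> where "\<delta> = (1 - y0 q) / 2"
    have d: "\<delta> > 0" "y0 q < 1 - \<delta>" using q by (auto simp: \<delta>_def field_simps)
    obtain U where U: "open U" "U \<inter> Q = y0 -` {..<1 - \<delta>} \<inter> Q"
      using y0(1) open_lessThan unfolding continuous_on_open_invariant by blast
    have "\<delta> * mass (U \<inter> Q) \<le> \<Lambda> (\<lambda>q. 1 - y0 q)"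
      unfolding mass_def scale[OF bdd_ind, symmetric]
    proof (rule mono)
      show "bdd (\<lambda>q. \<delta> * indicator (U \<inter> Q) q)" by (intro bdd_scale bdd_ind)
      show "bdd (\<lambda>q. 1 - y0 q)"
        using bdd_add[OF bddI[of "\<lambda>_. 1" 1] bdd_scale[OF y0(2), of "-1"]] by simp
      show "\<delta> * indicator (U \<inter> Q) q \<le> 1 - y0 q" if "q \<in> Q" for q
        using U(2) y0(3)[OF that] by (auto simp: indicator_def)
    qed
    also have "\<dots> = 0" using diff[OF bddI[of "\<lambda>_. 1" 1] y0(2)] by (simp add: one y0(4))
    finally have "mass (U \<inter> Q) = 0" using d mass_nonneg[of "U \<inter> Q"] by (simp add: mult_le_0_iff)
    then have "hereditary K Y (\<epsilon>/2) U" using e by (intro hereditary_null Y) auto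
    then show ?thesis using U d q unfolding G_def by blast
  qed
  have "Q \<subseteq> G"
  proof (rule ccontr)
    assume "\<not> Q \<subseteq> G"
    then have "Q - G \<noteq> {}" by blast
    from frag[OF _ this, of "\<epsilon>/8"] e obtain p U where p: "p \<in> Q - G" "open U" "p \<in> U"
      and osc: "\<And>q y. q \<in> (Q - G) \<inter> U \<Longrightarrow> y \<in> Y \<Longrightarrow> \<bar>y q - y p\<bar> \<le> \<epsilon>/8" by auto
    have pK: "p \<in> K" using outK[of p] y0(3)[of p] p(1) unfolding K_def by force
    \<comment> \<open>\<open>V\<close> covers what lies outside \<open>U\<close>: a compact subset
      of \<open>Q\<close> avoiding \<open>V\<close> stays in \<open>U\<close>, where the remainder
      has small oscillation, while subsets of \<open>U'\<close> avoid \<open>V\<close>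
      anyway.\<close>
    have "compact (Q - U)" by (rule compact_diff[OF compact_Q p(2)])
    moreover have "p \<in> Q" "Q - U \<subseteq> Q" "p \<notin> Q - U" using p by auto
    ultimately obtain U' V where
      U': "open U'" "p \<in> U'" and V: "open V" "Q - U \<subseteq> V" and UV: "U' \<inter> V = {}"
      using separate_compact by metis
    have "hereditary K Y (\<epsilon>/2) U'"
      unfolding hereditary_def
    proof (intro allI impI)
      fix A assume A: "A \<subseteq> U' \<inter> Q"
      \<comment> \<open>The supremum replaces inner regularity: beyond an almost optimal compact
        \<open>C\<close>, any further compact part of \<open>G\<close> adds little mass.\<close>
      define S where "S = {mass (A \<inter> C) |C. compact C \<and> C \<subseteq> Q \<inter> G}"
      define \<sigma> where "\<sigma> = Sup S"
      have Sne: "S \<noteq> {}" unfolding S_def by auto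
      have Sbd: "bdd_above S" unfolding S_def bdd_above_def
        by (auto intro!: exI[of _ "mass A"] mass_mono)
      have sup: "mass (A \<inter> C) \<le> \<sigma>" if "compact C" "C \<subseteq> Q \<inter> G" for C
        unfolding \<sigma>_def by (rule cSup_upper[OF _ Sbd]) (use that in \<open>auto simp: S_def\<close>)
      show "discretisable K Y (\<epsilon>/2) A"
      proof (rule discretisable_split[OF Y])
        fix \<eta> :: real assume eta: "0 < \<eta>"
        have "\<exists>s\<in>S. \<sigma> - \<eta>/2 < s" unfolding \<sigma>_def by (rule less_cSupD[OF Sne]) (use eta in auto)
        then obtain C where C: "compact C" "C \<subseteq> Q \<inter> G" "\<sigma> - \<eta>/2 < mass (A \<inter> C)"
          unfolding S_def by blast
        have "hereditary K Y (\<epsilon>/2) C"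
          by (rule hereditary_compact[OF _ Y C(1)]) (use C(2) e in \<open>auto simp: G_def\<close>)
        then have 1: "discretisable K Y (\<epsilon>/2) (A \<inter> C)" using C(2) unfolding hereditary_def by auto
        have 2: "\<bar>\<Lambda> (\<lambda>q. indicator (A - C) q * y q) - mass (A - C) * y p\<bar> \<le> (\<epsilon>/2) * mass (A - C) + \<eta>"
          if y: "y \<in> Y" for y
        proof -
          have bd: "bdd (\<lambda>q. y q - y p)"
            using Ybd[OF y] p by (intro bddI[of _ 2]) (smt (verit, best) DiffD1)
          have "continuous_on Q (\<lambda>q. \<bar>y q - y p\<bar>)" by (intro continuous_intros Ycont y)
          from continuous_on_open_invariant[THEN iffD1, rule_format, OF this open_lessThan]
          obtain W where W: "open W" "W \<inter> Q = (\<lambda>q. \<bar>y q - y p\<bar>) -` {..<\<epsilon>/2} \<inter> Q" by blast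
          \<comment> \<open>The points that may violate the bound \<open>\<epsilon>/2\<close> form a
            compact set, and the gap between \<open>\<epsilon>/8\<close> and
            \<open>\<epsilon>/2\<close> puts it inside \<open>G\<close>, so it has mass at most
            \<open>\<eta>/2\<close> beyond \<open>C\<close>. It depends on \<open>y\<close>, whereas
            \<open>C\<close> and \<open>p\<close> do not; hence one point mass serves all of
            \<open>Y\<close>.\<close>
          define D where "D = Q - (V \<union> W)"
          have Dc: "compact D" unfolding D_def using V W by (intro compact_diff compact_Q open_Un)
          have "q \<in> G" if "q \<in> D" for q
          proof (rule ccontr)
            assume "q \<notin> G"
            then have "\<bar>y q - y p\<bar> \<le> \<epsilon>/8" using that V by (intro osc y) (auto simp: D_def)
            moreover have "\<not> \<bar>y q - y p\<bar> < \<epsilon>/2" using that W unfolding D_def by blast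
            ultimately show False using e by simp
          qed
          then have "mass (A \<inter> (C \<union> D)) \<le> \<sigma>" using C Dc by (intro sup) (auto simp: D_def)
          moreover have "mass (A \<inter> (C \<union> D)) = mass (A \<inter> C) + mass ((A - C) \<inter> D)"
          proof -
            have "A \<inter> (C \<union> D) \<inter> C = A \<inter> C" "A \<inter> (C \<union> D) - C = (A - C) \<inter> D" by blast+
            then show ?thesis using mass_split[of "A \<inter> (C \<union> D)" C] by simp
          qed
          ultimately have small: "mass ((A - C) \<inter> D) \<le> \<eta>/2" using C(3) by linarith
          have "\<bar>\<Lambda> (\<lambda>q. indicator (A - C) q * (y q - y p))\<bar> \<le> (\<epsilon>/2) * mass (A - C) + 2 * mass ((A - C) \<inter> D)"
          proof (rule abs_integral_le[OF bd])
            fix q assume q: "q \<in> (A - C) \<inter> Q"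
            show "\<bar>y q - y p\<bar> \<le> \<epsilon>/2 + 2 * indicator D q"
            proof (cases "q \<in> D")
              case True
              have "\<bar>y q\<bar> \<le> 1" "\<bar>y p\<bar> \<le> 1" using Ybd[OF y] q p by auto
              then show ?thesis using True e by simp
            next
              case False
              then have "q \<in> W \<inter> Q" using q A UV unfolding D_def by blast
              then show ?thesis unfolding W(2) using False by simp
            qed
          qed
          also have "\<Lambda> (\<lambda>q. indicator (A - C) q * (y q - y p)) =
              \<Lambda> (\<lambda>q. indicator (A - C) q * y q) - mass (A - C) * y p"
            using diff[OF bdd_indicator[OF Y[OF y]] bdd_scale[OF bdd_ind], of "A - C" "y p" "A - C"]
              scale[OF bdd_ind, of "y p" "A - C"]
            by (simp add: right_diff_distrib left_diff_distrib mult.commute mass_def)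
          finally show ?thesis using small by linarith
        qed
        have "approximable K Y (\<epsilon>/2 * mass (A - C) + \<eta>) (A - C)"
          unfolding approximable_def using 2 pK mass_nonneg
          by (intro exI[of _ "1::nat"] exI[of _ "\<lambda>_. mass (A - C)"] exI[of _ "\<lambda>_. p"]) simp
        then show "\<exists>C. approximable K Y (\<epsilon>/2 * mass (A \<inter> C) + \<eta>) (A \<inter> C) \<and>
           approximable K Y (\<epsilon>/2 * mass (A - C) + \<eta>) (A - C)"
          using 1 eta unfolding discretisable_def by blast
      qed
    qed
    then show False using p U' unfolding G_def by blast
  qed
  then have "hereditary K Y (\<epsilon>/2) Q"
    by (intro hereditary_compact[OF _ Y compact_Q]) (use e in \<open>auto simp: G_def\<close>)
  then have "discretisable K Y (\<epsilon>/2) Q" unfolding hereditary_def by blast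
  then have "approximable K Y (\<epsilon>/2 * mass Q + \<epsilon>/2) Q" using e by (simp add: discretisable_def)
  then obtain n :: nat and c q where *: "\<forall>k<n. 0 \<le> c k \<and> q k \<in> K" "(\<Sum>k<n. c k) \<le> mass Q"
     "\<forall>y\<in>Y. \<bar>\<Lambda> (\<lambda>q. indicator Q q * y q) - (\<Sum>k<n. c k * y (q k))\<bar> \<le> \<epsilon>/2 * mass Q + \<epsilon>/2"
    unfolding approximable_def by blast
  have eq: "\<Lambda> (\<lambda>q. indicator Q q * y q) = \<Lambda> y" if "y \<in> Y" for y
    by (rule cong[OF bdd_indicator[OF Y[OF that]] Y[OF that]]) simp
  have "\<forall>k<n. 0 \<le> c k \<and> q k \<in> Q \<and> y0 (q k) = 1" using *(1) by (simp add: K_def)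
  moreover have "(\<Sum>k<n. c k) \<le> 1" using *(2) by (simp add: mass_Q)
  moreover have "\<forall>y\<in>Y. \<bar>\<Lambda> y - (\<Sum>k<n. c k * y (q k))\<bar> \<le> \<epsilon>"
    using *(3) by (simp add: mass_Q eq)
  ultimately show ?thesis by (intro exI conjI)
qed

end

section \<open>The Radon--Nikodym property yields weak* fragmentability\<close>

text \<open>In a space that need not be separable a difference of measurable functions need not be
  measurable. Here \<open>s\<close> has finitely many values, and on each level set the function is
  \<open>norm (f x - v)\<close> for a fixed \<open>v\<close>.\<close>

lemma borel_measurable_norm_diff_simple:
  fixes f s :: "'m \<Rightarrow> 'e::real_normed_vector"
  assumes f: "f \<in> borel_measurable M" and s: "simple_function M s"
  shows "(\<lambda>x. norm (f x - s x)) \<in> borel_measurable M"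
proof (rule measurable_compose_countable'[where f = "\<lambda>v x. norm (f x - v)" and g = s and I = "s ` space M"])
  have "(\<lambda>u. norm (u - v)) \<in> borel_measurable borel" for v :: 'e
    by (intro borel_measurable_continuous_onI continuous_intros)
  from measurable_compose[OF f this] show "(\<lambda>x. norm (f x - v)) \<in> borel_measurable M" for v .
  show "s \<in> measurable M (count_space (s ` space M))"
    using measurable_sets[OF measurable_simple_function[OF s]] by (intro measurableI) auto
  show "countable (s ` space M)" using s by (simp add: simple_function_def countable_finite)
qed

text \<open>The mean value inequality. It is proved for the approximating simple functions, since
  the integral is accessible only as the limit of theirs.\<close>

lemma (in finite_measure) bochner_has_integral_norm_le:
  fixes f :: "'a \<Rightarrow> 'e::real_normed_vector"
  assumes f: "bochner_has_integral M f I" and C: "C \<in> sets M" and e: "0 \<le> \<eta>"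
    and le: "\<And>x. x \<in> space M \<Longrightarrow> norm (f x - indicator C x *\<^sub>R v) \<le> \<eta> * indicator C x"
  shows "norm (I - measure M C *\<^sub>R v) \<le> \<eta> * measure M C"
proof -
  obtain s where fm: "f \<in> borel_measurable M"
    and s: "\<And>i. Bochner_Integration.simple_bochner_integrable M (s i)"
    and lim0: "(\<lambda>i. \<integral>\<^sup>+x. norm (f x - s i x) \<partial>M) \<longlonglongrightarrow> 0"
    and limI: "(\<lambda>i. Bochner_Integration.simple_bochner_integral M (s i)) \<longlonglongrightarrow> I"
    using f unfolding bochner_has_integral_def by blast
  let ?B = "Bochner_Integration.simple_bochner_integral M"
  have sf: "simple_function M (s i)" for i using s[of i] by (auto elim: simple_bochner_integrable.cases)
  have fin: "emeasure M X \<noteq> \<infinity>" for X using emeasure_finite by simp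
  have ind: "Bochner_Integration.simple_bochner_integrable M (indicator C :: 'a \<Rightarrow> real)"
    using C fin by (intro simple_bochner_integrable.intros) auto
  have indv: "Bochner_Integration.simple_bochner_integrable M (\<lambda>x. indicator C x *\<^sub>R v)"
    using simple_bochner_integrable_compose2[of "\<lambda>r _. r *\<^sub>R v", OF _ ind ind] by simp
  have "ennreal (?B (indicator C :: 'a \<Rightarrow> real)) = emeasure M C"
    using simple_bochner_integral_eq_nn_integral[OF ind] C by (simp add: ennreal_indicator)
  moreover have "0 \<le> ?B (indicator C :: 'a \<Rightarrow> real)"
    unfolding simple_bochner_integral_def by (intro sum_nonneg) (auto simp: indicator_def)
  ultimately have "?B (indicator C :: 'a \<Rightarrow> real) = measure M C"
    unfolding measure_def by (metis enn2real_ennreal)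
  then have Bv: "?B (\<lambda>x. indicator C x *\<^sub>R v) = measure M C *\<^sub>R v"
    using simple_bochner_integral_linear[OF _ ind, of "\<lambda>r. r *\<^sub>R v"]
    by (simp add: linear_iff scaleR_add_left)
  have bound: "ennreal (norm (?B (s i) - measure M C *\<^sub>R v))
      \<le> (\<integral>\<^sup>+x. norm (f x - s i x) \<partial>M) + ennreal (\<eta> * measure M C)" for i
  proof -
    have t: "Bochner_Integration.simple_bochner_integrable M (\<lambda>x. s i x - indicator C x *\<^sub>R v)"
      by (rule simple_bochner_integrable_compose2[OF _ s indv]) simp
    have tn: "Bochner_Integration.simple_bochner_integrable M (\<lambda>x. norm (s i x - indicator C x *\<^sub>R v))"
      using simple_bochner_integrable_compose2[of "\<lambda>r _. norm r", OF _ t t] by simp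
    have "?B (\<lambda>x. s i x - indicator C x *\<^sub>R v) = ?B (s i) - measure M C *\<^sub>R v"
      using simple_bochner_integral_diff[OF s indv] Bv by simp
    then have "ennreal (norm (?B (s i) - measure M C *\<^sub>R v)) \<le> ennreal (?B (\<lambda>x. norm (s i x - indicator C x *\<^sub>R v)))"
      using simple_bochner_integral_norm_bound[OF t] by (simp add: ennreal_leI)
    also have "\<dots> = (\<integral>\<^sup>+x. norm (s i x - indicator C x *\<^sub>R v) \<partial>M)"
      by (rule simple_bochner_integral_eq_nn_integral[OF tn]) simp
    also have "\<dots> \<le> (\<integral>\<^sup>+x. ennreal (norm (f x - s i x)) + ennreal \<eta> * indicator C x \<partial>M)"
    proof (rule nn_integral_mono)
      fix x assume x: "x \<in> space M"
      have "norm (s i x - indicator C x *\<^sub>R v) \<le> norm (f x - s i x) + norm (f x - indicator C x *\<^sub>R v)"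
        using norm_triangle_ineq[of "s i x - f x" "f x - indicator C x *\<^sub>R v"] by (simp add: norm_minus_commute)
      also have "\<dots> \<le> norm (f x - s i x) + \<eta> * indicator C x" using le[OF x] by simp
      finally have "ennreal (norm (s i x - indicator C x *\<^sub>R v)) \<le> ennreal (norm (f x - s i x) + \<eta> * indicator C x)"
        by (rule ennreal_leI)
      also have "\<dots> = ennreal (norm (f x - s i x)) + ennreal \<eta> * indicator C x"
        using e by (subst ennreal_plus) (auto simp: indicator_def)
      finally show "ennreal (norm (s i x - indicator C x *\<^sub>R v)) \<le> ennreal (norm (f x - s i x)) + ennreal \<eta> * indicator C x" .
    qed
    also have "\<dots> = (\<integral>\<^sup>+x. norm (f x - s i x) \<partial>M) + ennreal \<eta> * emeasure M C"
      using C borel_measurable_norm_diff_simple[OF fm sf[of i]]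
      by (subst nn_integral_add) (auto simp: nn_integral_cmult_indicator)
    also have "ennreal \<eta> * emeasure M C = ennreal (\<eta> * measure M C)"
      using e by (simp add: emeasure_eq_measure ennreal_mult)
    finally show ?thesis .
  qed
  have "ennreal (norm (I - measure M C *\<^sub>R v)) \<le> 0 + ennreal (\<eta> * measure M C)"
  proof (rule LIMSEQ_le)
    show "(\<lambda>i. ennreal (norm (?B (s i) - measure M C *\<^sub>R v))) \<longlonglongrightarrow> ennreal (norm (I - measure M C *\<^sub>R v))"
      by (intro tendsto_ennrealI tendsto_intros limI)
    show "(\<lambda>i. (\<integral>\<^sup>+x. norm (f x - s i x) \<partial>M) + ennreal (\<eta> * measure M C)) \<longlonglongrightarrow> 0 + ennreal (\<eta> * measure M C)"
      by (intro tendsto_add lim0 tendsto_const)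
  qed (use bound in blast)
  then show ?thesis using e by (simp add: ennreal_le_iff)
qed

text \<open>Markov's inequality: a simple function within \<open>\<eta> / 2\<close> of
  \<open>g\<close> in mean is within \<open>\<eta>\<close> of it on a set of measure above 1/2, and
  one of its finitely many level sets meets this set in positive measure.\<close>

lemma (in prob_space) bochner_density_almost_constant:
  fixes g :: "'a \<Rightarrow> 'e::real_normed_vector"
  assumes g: "\<And>A. A \<in> sets M \<Longrightarrow> bochner_has_integral M (\<lambda>x. indicator A x *\<^sub>R g x) (G A)"
    and e: "\<eta> > 0"
  shows "\<exists>A v. A \<in> sets M \<and> measure M A > 0 \<and>
    (\<forall>C\<in>sets M. C \<subseteq> A \<longrightarrow> norm (G C - measure M C *\<^sub>R v) \<le> \<eta> * measure M C)"
proof -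
  let ?f = "\<lambda>x. indicator (space M) x *\<^sub>R g x"
  obtain s where fm: "?f \<in> borel_measurable M"
    and s: "\<And>i. Bochner_Integration.simple_bochner_integrable M (s i)"
    and lim0: "(\<lambda>i. \<integral>\<^sup>+x. norm (?f x - s i x) \<partial>M) \<longlonglongrightarrow> 0"
    using g[OF sets.top] unfolding bochner_has_integral_def by blast
  have "eventually (\<lambda>i. (\<integral>\<^sup>+x. norm (?f x - s i x) \<partial>M) < ennreal (\<eta> / 2)) sequentially"
    using lim0 e by (intro order_tendstoD(2)) auto
  then obtain i where i: "(\<integral>\<^sup>+x. norm (?f x - s i x) \<partial>M) < ennreal (\<eta> / 2)"
    by (meson eventually_happens trivial_limit_sequentially)
  have sf: "simple_function M (s i)" using s[of i] by (auto elim: simple_bochner_integrable.cases)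
  have meas: "(\<lambda>x. norm (?f x - s i x)) \<in> borel_measurable M"
    by (rule borel_measurable_norm_diff_simple[OF fm sf])
  define B where "B = {x \<in> space M. norm (?f x - s i x) < \<eta>}"
  have B: "B \<in> sets M" unfolding B_def using meas by measurable
  have "ennreal \<eta> * emeasure M (space M - B) = (\<integral>\<^sup>+x. ennreal \<eta> * indicator (space M - B) x \<partial>M)"
    using B by (subst nn_integral_cmult_indicator) auto
  also have "\<dots> \<le> (\<integral>\<^sup>+x. norm (?f x - s i x) \<partial>M)"
    by (intro nn_integral_mono) (auto simp: B_def indicator_def intro!: ennreal_leI)
  also have "\<dots> < ennreal (\<eta> / 2)" by (rule i)
  finally have "ennreal (\<eta> * measure M (space M - B)) < ennreal (\<eta> / 2)"
    using e by (simp add: emeasure_eq_measure ennreal_mult)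
  then have "\<eta> * measure M (space M - B) < \<eta> / 2" using e by (simp add: ennreal_less_iff)
  then have "measure M (space M - B) < 1 / 2" using e by (simp add: field_simps)
  then have "measure M B > 0" using prob_compl[OF B] by simp
  define A where "A v = B \<inter> (s i -` {v} \<inter> space M)" for v
  have A: "A v \<in> sets M" for v unfolding A_def using B simple_functionD(2)[OF sf] by blast
  have "measure M B = measure M (\<Union>v\<in>s i ` space M. A v)"
    by (rule arg_cong[where f = "measure M"]) (auto simp: A_def B_def)
  also have "\<dots> \<le> (\<Sum>v\<in>s i ` space M. measure M (A v))"
    using A simple_functionD(1)[OF sf] by (intro finite_measure_subadditive_finite) auto
  finally have "(\<Sum>v\<in>s i ` space M. measure M (A v)) > 0" using \<open>measure M B > 0\<close> by linarith
  then obtain v where v: "measure M (A v) > 0" by (meson not_less sum_nonpos)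
  show ?thesis
  proof (intro exI conjI ballI impI)
    show "A v \<in> sets M" "measure M (A v) > 0" by (fact A, fact v)
    fix C assume C: "C \<in> sets M" "C \<subseteq> A v"
    show "norm (G C - measure M C *\<^sub>R v) \<le> \<eta> * measure M C"
    proof (rule bochner_has_integral_norm_le[OF g[OF C(1)] C(1)])
      fix x assume x: "x \<in> space M"
      show "norm (indicator C x *\<^sub>R g x - indicator C x *\<^sub>R v) \<le> \<eta> * indicator C x"
      proof (cases "x \<in> C")
        case True
        then have "x \<in> A v" using C by auto
        then show ?thesis using True x unfolding A_def B_def by (auto intro: less_imp_le)
      qed simp
    qed (use e in simp)
  qed
qed

text \<open>\<open>\<kappa> n\<close> plays the role of the first \<open>n\<close> binary digits of
  a point, so each cell of level \<open>n\<close> splits into two of the next level. The underlying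
  type stays open because the Radon-Nikodym property is tied to a prescribed type.\<close>

locale dyadic_measure = prob_space M for M :: "'m measure" +
  fixes \<kappa> :: "nat \<Rightarrow> 'm \<Rightarrow> nat"
  assumes kappa_measurable: "\<kappa> n \<in> measurable M (count_space UNIV)"
    and kappa_less: "\<kappa> n x < 2 ^ n"
    and kappa_div: "\<kappa> (Suc n) x div 2 = \<kappa> n x"
    and kappa_small: "measure M {x \<in> space M. \<kappa> n x = k} \<le> (1/2) ^ n"
begin

definition cell :: "nat \<Rightarrow> nat \<Rightarrow> 'm set" where "cell n k = {x \<in> space M. \<kappa> n x = k}"

lemma cell_sets [measurable]: "cell n k \<in> sets M"
  unfolding cell_def using kappa_measurable[of n] by measurable

lemma kappa_div_power: "\<kappa> (n + j) x div 2 ^ j = \<kappa> n x"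
proof (induction j)
  case (Suc j)
  have "\<kappa> (n + Suc j) x div 2 ^ Suc j = \<kappa> (Suc (n + j)) x div 2 div 2 ^ j" by (simp add: div_mult2_eq)
  then show ?case using Suc kappa_div by simp
qed simp

lemma measure_cells:
  assumes "A \<in> sets M" shows "(\<Sum>k<2^n. measure M (A \<inter> cell n k)) = measure M A"
proof -
  have "measure M (\<Union>k\<in>{..<2^n}. A \<inter> cell n k) = (\<Sum>k<2^n. measure M (A \<inter> cell n k))"
  proof (rule finite_measure_finite_Union)
    show "(\<lambda>k. A \<inter> cell n k) ` {..<2 ^ n} \<subseteq> sets M" using assms by auto
    show "disjoint_family_on (\<lambda>k. A \<inter> cell n k) {..<2 ^ n}" by (auto simp: disjoint_family_on_def cell_def)
  qed simp
  moreover have "(\<Union>k\<in>{..<2^n}. A \<inter> cell n k) = A"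
    using kappa_less sets.sets_into_space[OF assms] by (auto simp: cell_def)
  ultimately show ?thesis by simp
qed

lemma cell_split: "measure M (A \<inter> cell n k) =
    measure M (A \<inter> cell (Suc n) (2 * k)) + measure M (A \<inter> cell (Suc n) (2 * k + 1))" if "A \<in> sets M"
proof -
  have "\<kappa> n x = k \<longleftrightarrow> \<kappa> (Suc n) x = 2 * k \<or> \<kappa> (Suc n) x = 2 * k + 1" for x
    using kappa_div[of n x] by arith
  then have "A \<inter> cell n k = (A \<inter> cell (Suc n) (2 * k)) \<union> (A \<inter> cell (Suc n) (2 * k + 1))"
    by (auto simp: cell_def)
  moreover have "(A \<inter> cell (Suc n) (2 * k)) \<inter> (A \<inter> cell (Suc n) (2 * k + 1)) = {}"
    by (auto simp: cell_def)
  ultimately show ?thesis using finite_measure_Union[OF sets.Int[OF that cell_sets] sets.Int[OF that cell_sets]] by simp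
qed

text \<open>Otherwise \<open>A\<close> would lie, up to null sets, in a single cell at every level,
  and the measures of cells tend to 0.\<close>

lemma split_exists:
  assumes A: "A \<in> sets M" "measure M A > 0"
  obtains n k where "measure M (A \<inter> cell (Suc n) (2 * k)) > 0" "measure M (A \<inter> cell (Suc n) (2 * k + 1)) > 0"
proof (rule ccontr)
  assume "\<not> thesis"
  then have no: "measure M (A \<inter> cell (Suc n) (2 * k)) = 0 \<or> measure M (A \<inter> cell (Suc n) (2 * k + 1)) = 0" for n k
    using that[of n k] measure_nonneg by (metis order_le_imp_less_or_eq)
  have full: "\<exists>k. measure M (A \<inter> cell n k) = measure M A" for n
  proof (induction n)
    case 0
    have "A \<inter> cell 0 0 = A" using kappa_less[of 0] sets.sets_into_space[OF A(1)] by (auto simp: cell_def)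
    then show ?case by metis
  next
    case (Suc n)
    then obtain k where "measure M (A \<inter> cell n k) = measure M A" by blast
    then show ?case using cell_split[OF A(1), of n k] no[of n k] by force
  qed
  have "measure M A \<le> (1/2)^n" for n
  proof -
    obtain k where "measure M A = measure M (A \<inter> cell n k)" using full by metis
    also have "\<dots> \<le> measure M (cell n k)" by (rule finite_measure_mono) auto
    also have "\<dots> \<le> (1/2)^n" unfolding cell_def by (rule kappa_small)
    finally show ?thesis .
  qed
  moreover have "(\<lambda>n. (1/2)^n :: real) \<longlonglongrightarrow> 0" by (rule LIMSEQ_realpow_zero) auto
  ultimately have "measure M A \<le> 0" by (intro LIMSEQ_le_const) auto
  then show False using A by simp
qed

end

text \<open>The Radon-Nikodym hypothesis will be used for measures on the operator type itself, so
  Lebesgue measure on the unit interval is carried to the segment of multiples of \<open>f0\<close>.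
  Evaluation at a point where \<open>f0\<close> does not vanish recovers the parameter.\<close>

lemma dyadic_measure_exists:
  fixes f0 :: "'a::real_normed_vector \<Rightarrow>\<^sub>L 'k::rc_field"
  assumes "f0 \<noteq> 0"
  obtains M :: "('a \<Rightarrow>\<^sub>L 'k) measure" and \<kappa> where "dyadic_measure M \<kappa>"
proof -
  obtain x0 where x0: "blinfun_apply f0 x0 \<noteq> 0"
    using assms by (metis blinfun_eqI zero_blinfun.rep_eq)
  define q where "q \<omega> = scalar_Re (blinfun_apply \<omega> x0 / blinfun_apply f0 x0)" for \<omega> :: "'a \<Rightarrow>\<^sub>L 'k"
  define U where "U = uniform_measure lborel {0..<1::real}"
  define j where "j t = t *\<^sub>R f0" for t :: real
  have qj: "q (j t) = t" for t
    using x0 by (simp add: q_def j_def blinfun.scaleR_left scaleR_conv_of_real)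
  have "continuous_on UNIV q"
    unfolding q_def divide_inverse
    by (intro linear_continuous_on_compose[OF _ linear_scalar_Re] continuous_intros
        bounded_linear.continuous_on[OF bounded_linear_scalar_Re])
  then have qm [measurable]: "q \<in> borel_measurable borel" by (rule borel_measurable_continuous_onI)
  have "continuous_on UNIV j" unfolding j_def by (intro continuous_intros)
  then have jb: "j \<in> borel_measurable borel" by (rule borel_measurable_continuous_onI)
  then have jm [measurable]: "j \<in> measurable U borel" unfolding U_def by (simp cong: measurable_cong_sets)
  interpret U: prob_space U unfolding U_def by (rule prob_space_uniform_measure) auto
  \<comment> \<open>The fractional part makes the digit conditions hold at every point of the type,
    not just on the segment.\<close>
  define \<kappa> where "\<kappa> n \<omega> = nat \<lfloor>2 ^ n * (q \<omega> - real_of_int \<lfloor>q \<omega>\<rfloor>)\<rfloor>" for n :: nat and \<omega>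
  define M where "M = distr U borel j"
  have km [measurable]: "\<kappa> n \<in> measurable borel (count_space UNIV)" for n
    unfolding \<kappa>_def by measurable
  have "dyadic_measure M \<kappa>"
  proof (intro dyadic_measure.intro dyadic_measure_axioms.intro)
    show "prob_space M" unfolding M_def by (rule U.prob_space_distr) measurable
    show "\<kappa> n \<in> measurable M (count_space UNIV)" for n unfolding M_def by measurable
    fix n x k
    define t where "t = q x - real_of_int \<lfloor>q x\<rfloor>"
    have t: "0 \<le> t" "t < 1" unfolding t_def by linarith+
    have kt: "\<kappa> n x = nat \<lfloor>2 ^ n * t\<rfloor>" for n by (simp add: \<kappa>_def t_def)
    have "\<lfloor>2 ^ n * t\<rfloor> < 2 ^ n" using t by (simp add: floor_less_iff)
    then have "\<kappa> n x < nat (2 ^ n)" unfolding kt by (subst nat_less_eq_zless) (use t in auto)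
    then show "\<kappa> n x < 2 ^ n" by (simp add: nat_power_eq)
    have "\<lfloor>2 ^ Suc n * t\<rfloor> div 2 = \<lfloor>2 ^ n * t\<rfloor>"
      using floor_divide_real_eq_div[of 2 "2 ^ Suc n * t"] by simp
    then show "\<kappa> (Suc n) x div 2 = \<kappa> n x"
      unfolding kt by (metis nat_div_distrib' nat_numeral zero_le_numeral)
    have "measure M {x \<in> space M. \<kappa> n x = k} = measure U (j -` {x. \<kappa> n x = k} \<inter> space U)"
      unfolding M_def by (subst measure_distr) auto
    also have "\<dots> = measure lborel ({0..<1} \<inter> {t. \<kappa> n (j t) = k})"
      using jb by (simp add: U_def measure_uniform_measure vimage_def)
    also have "\<dots> \<le> measure lborel {real k / 2 ^ n..(real k + 1) / 2 ^ n}"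
    proof (rule measure_mono_fmeasurable)
      show "{0..<1} \<inter> {t. \<kappa> n (j t) = k} \<subseteq> {real k / 2 ^ n..(real k + 1) / 2 ^ n}"
      proof
        fix t assume t: "t \<in> {0..<1} \<inter> {t. \<kappa> n (j t) = k}"
        then have "\<lfloor>t\<rfloor> = 0" by (simp add: floor_eq_iff)
        then have "nat \<lfloor>2 ^ n * t\<rfloor> = k" using t by (simp add: \<kappa>_def qj)
        then have "\<lfloor>2 ^ n * t\<rfloor> = int k" using t by (metis IntE atLeastLessThan_iff int_nat_eq mult_nonneg_nonneg zero_le_floor zero_le_numeral zero_le_power)
        then have "real k \<le> 2 ^ n * t" "2 ^ n * t < real k + 1" by linarith+
        then show "t \<in> {real k / 2 ^ n..(real k + 1) / 2 ^ n}" by (simp add: field_simps)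
      qed
      have "{t. \<kappa> n (j t) = k} \<in> sets borel" using jb by measurable
      then show "{0..<1} \<inter> {t. \<kappa> n (j t) = k} \<in> sets lborel" by simp
      show "{real k / 2 ^ n..(real k + 1) / 2 ^ n} \<in> fmeasurable lborel"
        by (rule fmeasurableI) (auto simp: emeasure_lborel_Icc_eq)
    qed
    also have "\<dots> = (1/2) ^ n" by (simp add: field_simps)
    finally show "measure M {x \<in> space M. \<kappa> n x = k} \<le> (1/2) ^ n" .
  qed
  then show thesis by (rule that)
qed

text \<open>With uncountably many indices a bounded sequence need not have a pointwise convergent
  subsequence. The limit is therefore taken along a filter: the neighbourhoods of a cluster point
  intersected with the tails of the sequence.\<close>

lemma cluster_function:
  fixes H :: "nat \<Rightarrow> 'i \<Rightarrow> 'k::rc_field"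
  assumes "\<And>n i. norm (H n i) \<le> b i"
  obtains h \<F> where "\<F> \<noteq> bot" "\<And>i. ((\<lambda>g. g i) \<longlongrightarrow> h i) \<F>"
    "\<And>P. eventually (\<lambda>n. P (H n)) sequentially \<Longrightarrow> eventually P \<F>"
proof -
  let ?K = "{F :: 'i \<Rightarrow> 'k. \<forall>i. norm (F i) \<le> b i}"
  have "\<exists>h\<in>?K. inf (nhds h) (filtermap H sequentially) \<noteq> bot"
    by (rule compact_bounded_functions[of b, unfolded compact_filter, rule_format])
       (auto simp: filtermap_bot_iff eventually_filtermap assms)
  then obtain h where h: "inf (nhds h) (filtermap H sequentially) \<noteq> bot" by blast
  show thesis
  proof (rule that[OF h])
    fix i :: 'i
    have cont: "continuous_on UNIV (\<lambda>g. g i :: 'k)" by (rule continuous_on_product_coordinates)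
    have "((\<lambda>g. g i) \<longlongrightarrow> h i) (nhds h)"
      unfolding tendsto_def eventually_nhds
    proof (intro allI impI)
      fix S assume "open S" "h i \<in> S"
      then show "\<exists>T. open T \<and> h \<in> T \<and> (\<forall>g\<in>T. g i \<in> S)"
        using open_vimage[OF _ cont] by (intro exI[of _ "(\<lambda>g. g i) -` S"]) auto
    qed
    then show "((\<lambda>g. g i) \<longlongrightarrow> h i) (inf (nhds h) (filtermap H sequentially))"
      by (rule tendsto_mono[rotated]) simp
  next
    fix P assume "eventually (\<lambda>n. P (H n)) sequentially"
    then show "eventually P (inf (nhds h) (filtermap H sequentially))"
      by (intro filter_leD[OF inf_le2]) (simp add: eventually_filtermap)
  qed
qed

text \<open>\<open>G A\<close> is a weak* cluster point of the sums of the nodes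
  \<open>P n k\<close> with weights \<open>measure M (A \<inter> cell n k)\<close>. The nodes need
  not form a martingale, so these sums need not converge. Domination by \<open>M\<close> makes
  \<open>G\<close> countably additive in norm. By the last clause a set inside one cell inherits a
  bound shared by all nodes below that cell.\<close>

lemma (in dyadic_measure) weak_star_vector_measure:
  fixes P :: "nat \<Rightarrow> nat \<Rightarrow> ('a::banach \<Rightarrow>\<^sub>L 'k::rc_field)"
  assumes P: "\<And>n k. norm (P n k) \<le> 1" "\<And>n k. P n k \<in> dual_space smul"
  shows "\<exists>G :: 'm set \<Rightarrow> ('a \<Rightarrow>\<^sub>L 'k). vector_measure M (dual_space smul) G \<and>
    (\<forall>A\<in>sets M. norm (G A) \<le> measure M A) \<and>
    (\<forall>A\<in>sets M. \<forall>n k x \<alpha> r. A \<subseteq> cell n k \<longrightarrow>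
      (\<forall>j k'. k' div 2 ^ j = k \<longrightarrow> norm (blinfun_apply (P (n + j) k') x - \<alpha>) \<le> r) \<longrightarrow>
      norm (blinfun_apply (G A) x - measure M A *\<^sub>R \<alpha>) \<le> measure M A * r)"
proof -
  \<comment> \<open>Sets and vectors form one index, so that a single cluster point serves all of
    them; the value 0 off \<open>sets M\<close> gives a bound at every index.\<close>
  define H :: "nat \<Rightarrow> 'm set \<times> 'a \<Rightarrow> 'k" where
    "H n i = (if fst i \<in> sets M
       then \<Sum>k<2^n. measure M (fst i \<inter> cell n k) *\<^sub>R blinfun_apply (P n k) (snd i) else 0)" for n i
  have H: "H n (A, x) = (\<Sum>k<2^n. measure M (A \<inter> cell n k) *\<^sub>R blinfun_apply (P n k) x)"
    if "A \<in> sets M" for n A x using that by (simp add: H_def)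
  have Px: "norm (blinfun_apply (P n k) x) \<le> norm x" for n k x
    using norm_blinfun[of "P n k" x] P(1)[of n k] mult_right_mono[of "norm (P n k)" 1 "norm x"] by simp
  have Hb: "norm (H n (A, x)) \<le> measure M A * norm x" if "A \<in> sets M" for n A x
  proof -
    have "norm (H n (A, x)) \<le> (\<Sum>k<2^n. norm (measure M (A \<inter> cell n k) *\<^sub>R blinfun_apply (P n k) x))"
      unfolding H[OF that] by (rule norm_sum)
    also have "\<dots> \<le> (\<Sum>k<2^n. measure M (A \<inter> cell n k) * norm x)"
      by (intro sum_mono) (simp add: Px mult_left_mono)
    also have "\<dots> = measure M A * norm x" by (simp add: measure_cells[OF that] flip: sum_distrib_right)
    finally show ?thesis .
  qed
  have Hs: "norm (H n i) \<le> norm (snd i)" for n i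
  proof (cases "fst i \<in> sets M")
    case True
    then have "norm (H n i) \<le> measure M (fst i) * norm (snd i)" using Hb[of "fst i" n "snd i"] by simp
    also have "\<dots> \<le> 1 * norm (snd i)" by (intro mult_right_mono) auto
    finally show ?thesis by simp
  qed (simp add: H_def)
  then obtain h \<F> where F: "\<F> \<noteq> bot" and lim: "\<And>i. ((\<lambda>g. g i) \<longlongrightarrow> h i) \<F>"
    and ev: "\<And>P. eventually (\<lambda>n. P (H n)) sequentially \<Longrightarrow> eventually P \<F>"
    using cluster_function[of H "\<lambda>i. norm (snd i)", OF Hs] by metis
  have h_eq: "a = b" if "(f \<longlongrightarrow> a) \<F>" "(g \<longlongrightarrow> b) \<F>" "\<And>n. f (H n) = g (H n)" for f g :: "_ \<Rightarrow> 'k" and a b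
  proof (rule tendsto_unique[OF F that(1)])
    have "eventually (\<lambda>z. g z = f z) \<F>" by (rule ev) (simp add: that(3))
    then show "(f \<longlongrightarrow> b) \<F>" using that(2) by (rule Lim_transform_eventually[rotated])
  qed
  have h_bound: "norm a \<le> c" if "(f \<longlongrightarrow> a) \<F>" "eventually (\<lambda>n. norm (f (H n)) \<le> c) sequentially"
    for f :: "_ \<Rightarrow> 'k" and a c
    by (rule tendsto_upperbound[OF tendsto_norm[OF that(1)] _ F]) (rule ev, rule that)
  have h_add: "h (A, x + y) = h (A, x) + h (A, y)" if "A \<in> sets M" for A x y
    by (rule h_eq[OF lim tendsto_add[OF lim lim]])
       (simp add: H[OF that] blinfun.add_right scaleR_add_right sum.distrib)
  have h_scale: "h (A, r *\<^sub>R x) = r *\<^sub>R h (A, x)" if "A \<in> sets M" for A x r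
    by (rule h_eq[OF lim tendsto_scaleR[OF tendsto_const lim]])
       (simp add: H[OF that] blinfun.scaleR_right scaleR_sum_right mult.commute)
  have h_smul: "h (A, smul c x) = c * h (A, x)" if "A \<in> sets M" for A x c
  proof (rule h_eq[OF lim tendsto_mult[OF tendsto_const lim]])
    fix n
    have "blinfun_apply (P n k) (smul c x) = c * blinfun_apply (P n k) x" for k
      using P(2) unfolding dual_space_def by blast
    then show "H n (A, smul c x) = c * H n (A, x)" by (simp add: H[OF that] sum_distrib_left)
  qed
  have h_norm: "norm (h (A, x)) \<le> measure M A * norm x" if "A \<in> sets M" for A x
    by (rule h_bound[OF lim]) (simp add: Hb[OF that])
  have h_Un: "h (A \<union> B, x) = h (A, x) + h (B, x)" if "A \<in> sets M" "B \<in> sets M" "A \<inter> B = {}" for A B x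
  proof (rule h_eq[OF lim tendsto_add[OF lim lim]])
    fix n
    have "measure M ((A \<union> B) \<inter> cell n k) = measure M (A \<inter> cell n k) + measure M (B \<inter> cell n k)" for k
      using finite_measure_Union[of "A \<inter> cell n k" "B \<inter> cell n k"] that by (auto simp: Int_Un_distrib2)
    then show "H n (A \<union> B, x) = H n (A, x) + H n (B, x)"
      using that by (simp add: H scaleR_add_left sum.distrib)
  qed
  define G where "G A = Blinfun (\<lambda>x. h (A, x))" for A
  have G: "blinfun_apply (G A) x = h (A, x)" if "A \<in> sets M" for A x
  proof -
    have "bounded_linear (\<lambda>x. h (A, x))"
      using h_add[OF that] h_scale[OF that] h_norm[OF that]
      by (intro bounded_linear_intro[where K = "measure M A"]) (auto simp: mult.commute)
    then show ?thesis unfolding G_def by (simp add: bounded_linear_Blinfun_apply)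
  qed
  have Gnorm: "norm (G A) \<le> measure M A" if "A \<in> sets M" for A
    by (rule norm_blinfun_bound) (use that h_norm G in auto)
  have GUn: "G (A \<union> B) = G A + G B" if "A \<in> sets M" "B \<in> sets M" "A \<inter> B = {}" for A B
    using that by (intro blinfun_eqI) (simp add: blinfun.add_left G h_Un)
  have Gempty: "G {} = 0" using Gnorm[of "{}"] by simp
  have "vector_measure M (dual_space smul) G"
    unfolding vector_measure_def
  proof (intro conjI ballI allI impI)
    show "G A \<in> dual_space smul" if "A \<in> sets M" for A
      using that by (simp add: dual_space_def G h_smul)
    fix A :: "nat \<Rightarrow> 'm set" assume A: "range A \<subseteq> sets M \<and> disjoint_family A"
    then have As: "A i \<in> sets M" for i by auto
    have Gfin: "G (\<Union>i<n. A i) = (\<Sum>i<n. G (A i))" for n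
    proof (induction n)
      case (Suc n)
      have "(\<Union>i<n. A i) \<inter> A n = {}" using A 
        by (simp add: disjoint_family_on_def disjoint_iff) (metis lessThan_iff less_irrefl)
      then have "G ((\<Union>i<n. A i) \<union> A n) = G (\<Union>i<n. A i) + G (A n)" using As by (intro GUn) auto
      moreover have "(\<Union>i<Suc n. A i) = (\<Union>i<n. A i) \<union> A n" by (auto simp: less_Suc_eq)
      ultimately show ?case using Suc by simp
    qed (simp add: Gempty)
    let ?A = "\<Union>i. A i"
    have rem: "norm ((\<Sum>i<n. G (A i)) - G ?A) \<le> measure M ?A - (\<Sum>i<n. measure M (A i))" for n
    proof -
      let ?B = "\<Union>i<n. A i"
      have B: "?B \<in> sets M" "?A \<in> sets M" using As by auto
      have "?B \<union> (?A - ?B) = ?A" by blast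
      then have "G ?A = G ?B + G (?A - ?B)" using GUn[of ?B "?A - ?B"] B by (metis Diff_disjoint sets.Diff)
      then have "norm ((\<Sum>i<n. G (A i)) - G ?A) = norm (G (?A - ?B))" by (simp add: Gfin)
      also have "\<dots> \<le> measure M (?A - ?B)" by (rule Gnorm) (use B in blast)
      also have "\<dots> = measure M ?A - measure M ?B" by (rule finite_measure_Diff) (use B in auto)
      also have "measure M ?B = (\<Sum>i<n. measure M (A i))"
        using A by (intro finite_measure_finite_Union) (auto simp: disjoint_family_on_def)
      finally show ?thesis .
    qed
    have "(\<lambda>n. measure M ?A - (\<Sum>i<n. measure M (A i))) \<longlonglongrightarrow> measure M ?A - measure M ?A"
      using finite_measure_UNION[of A] A unfolding sums_def by (intro tendsto_diff tendsto_const) auto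
    then have "(\<lambda>n. measure M ?A - (\<Sum>i<n. measure M (A i))) \<longlonglongrightarrow> 0" by simp
    then have "(\<lambda>n. (\<Sum>i<n. G (A i)) - G ?A) \<longlonglongrightarrow> 0"
      by (rule Lim_null_comparison[rotated]) (simp add: rem)
    then show "(\<lambda>n. G (A n)) sums G ?A" unfolding sums_def by (rule LIM_zero_cancel)
  qed
  moreover have "norm (blinfun_apply (G A) x - measure M A *\<^sub>R \<alpha>) \<le> measure M A * r"
    if A: "A \<in> sets M" "A \<subseteq> cell n k"
      and near: "\<And>j k'. k' div 2 ^ j = k \<Longrightarrow> norm (blinfun_apply (P (n + j) k') x - \<alpha>) \<le> r" for A n k x \<alpha> r
    unfolding G[OF A(1)]
  proof (rule h_bound[OF tendsto_diff[OF lim tendsto_const]])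
    have "norm (H (n + j) (A, x) - measure M A *\<^sub>R \<alpha>) \<le> measure M A * r" for j
    proof -
      let ?m = "n + j"
      have "H ?m (A, x) - measure M A *\<^sub>R \<alpha>
          = (\<Sum>k'<2^?m. measure M (A \<inter> cell ?m k') *\<^sub>R (blinfun_apply (P ?m k') x - \<alpha>))"
        by (simp add: H[OF A(1)] scaleR_diff_right sum_subtractf measure_cells[OF A(1)] flip: scaleR_sum_left)
      also have "norm \<dots> \<le> (\<Sum>k'<2^?m. norm (measure M (A \<inter> cell ?m k') *\<^sub>R (blinfun_apply (P ?m k') x - \<alpha>)))"
        by (rule norm_sum)
      also have "\<dots> \<le> (\<Sum>k'<2^?m. measure M (A \<inter> cell ?m k') * r)"
      proof (rule sum_mono)
        fix k'
        show "norm (measure M (A \<inter> cell ?m k') *\<^sub>R (blinfun_apply (P ?m k') x - \<alpha>)) \<le> measure M (A \<inter> cell ?m k') * r"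
        proof (cases "A \<inter> cell ?m k' = {}")
          case True then show ?thesis by simp
        next
          case False
          then obtain \<omega> where "\<kappa> n \<omega> = k" "\<kappa> ?m \<omega> = k'" using A(2) unfolding cell_def by blast
          then have "k' div 2 ^ j = k" using kappa_div_power by blast
          then show ?thesis using near by (simp add: mult_left_mono)
        qed
      qed
      also have "\<dots> = measure M A * r" by (simp add: measure_cells[OF A(1)] flip: sum_distrib_right)
      finally show ?thesis .
    qed
    then show "\<forall>\<^sub>F m in sequentially. norm (H m (A, x) - measure M A *\<^sub>R \<alpha>) \<le> measure M A * r"
      unfolding eventually_sequentially by (intro exI[of _ n]) (metis le_iff_add)
  qed
  ultimately show ?thesis using Gnorm by blast
qed

lemma (in finite_measure) bounded_variation_dominated:
  assumes "\<And>A. A \<in> sets M \<Longrightarrow> norm (G A) \<le> measure M A"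
  shows "bounded_variation M G"
  unfolding bounded_variation_def
proof (intro exI allI impI)
  fix P assume P: "finite P \<and> P \<subseteq> sets M \<and> partition_on (space M) P"
  have "(\<Sum>A\<in>P. norm (G A)) \<le> (\<Sum>A\<in>P. measure M A)" using assms P by (intro sum_mono) auto
  also have "\<dots> = measure M (\<Union>A\<in>P. A)"
    using P by (intro finite_measure_finite_Union[symmetric])
      (auto simp: disjoint_family_on_def partition_on_def disjoint_def)
  also have "\<dots> = measure M (space M)" using P by (simp add: partition_on_def)
  finally show "(\<Sum>A\<in>P. norm (G A)) \<le> measure M (space M)" .
qed

text \<open>If \<open>D\<close> were not fragmented, every weak* neighbourhood in \<open>D\<close> would split into two parts
  that some vector \<open>x\<close> separates. Iterating gives a dyadic tree; the measure that spreads mass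
  evenly over its branches cannot have a density, since a density is almost constant on a set that
  meets both halves of some branch.\<close>

theorem rnp_imp_fragmented:
  fixes smul :: "'k::rc_field \<Rightarrow> 'a::banach \<Rightarrow> 'a"
  assumes rnp: "radon_nikodym_property TYPE('a \<Rightarrow>\<^sub>L 'k) (dual_space smul)"
    and D: "D \<subseteq> dual_space smul" "D \<noteq> {}" "\<And>f. f \<in> D \<Longrightarrow> norm f \<le> 1" and e: "\<epsilon> > 0"
  shows "\<exists>p\<in>D. \<exists>U. open U \<and> blinfun_apply p \<in> U \<and> (\<forall>q\<in>D. blinfun_apply q \<in> U \<longrightarrow> norm (q - p) \<le> \<epsilon>)"
proof (rule ccontr)
  assume "\<not> ?thesis"
  then have nf: "\<exists>q\<in>D. blinfun_apply q \<in> U \<and> norm (q - p) > \<epsilon>"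
    if "p \<in> D" "open U" "blinfun_apply p \<in> U" for p and U :: "('a \<Rightarrow> 'k) set"
    using that not_le_imp_less by metis
  define good where "good U \<longleftrightarrow> open U \<and> (\<exists>p\<in>D. blinfun_apply p \<in> U)" for U :: "('a \<Rightarrow> 'k) set"
  \<comment> \<open>On each half, averaging will cost \<open>\<epsilon>/4\<close> and the almost
    constant density another \<open>\<epsilon>/4\<close>. Two halves cost \<open>\<epsilon>\<close>,
    which the strict gap between \<open>a True\<close> and \<open>a False\<close> excludes.\<close>
  have "\<exists>x a V. norm (a True - a False) > \<epsilon> * norm x \<and>
      (\<forall>b. good (V b) \<and> V b \<subseteq> U \<and> (\<forall>F\<in>V b. norm (F x - a b) \<le> \<epsilon>/4 * norm x))"
    if U: "good U" for U :: "('a \<Rightarrow> 'k) set"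
  proof -
    obtain p where p: "p \<in> D" "blinfun_apply p \<in> U" using U by (auto simp: good_def)
    obtain q where q: "q \<in> D" "blinfun_apply q \<in> U" "norm (q - p) > \<epsilon>"
      using nf[OF p(1) _ p(2)] U by (auto simp: good_def)
    have "\<not> (\<forall>x. norm (blinfun_apply (q - p) x) \<le> \<epsilon> * norm x)"
      using norm_blinfun_bound[of \<epsilon> "q - p"] q(3) e by auto
    then obtain x where x: "norm (blinfun_apply (q - p) x) > \<epsilon> * norm x" by (auto simp: not_le)
    then have x0: "x \<noteq> 0" by (intro notI) simp
    define a where "a b = (if b then blinfun_apply q x else blinfun_apply p x)" for b
    define V where "V b = U \<inter> {F. norm (F x - a b) < \<epsilon>/4 * norm x}" for b
    have "open {F :: 'a \<Rightarrow> 'k. norm (F x - a b) < \<epsilon>/4 * norm x}" for b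
      by (intro open_Collect_less continuous_intros continuous_on_product_coordinates)
    then have "open (V b)" for b using U by (auto simp: V_def good_def)
    moreover have "blinfun_apply (if b then q else p) \<in> V b" for b
      using p q e x0 by (auto simp: V_def a_def)
    ultimately have "good (V b)" for b unfolding good_def using p q by (metis (full_types))
    moreover have "norm (a True - a False) > \<epsilon> * norm x"
      using x by (simp add: a_def blinfun.diff_left)
    moreover have "V b \<subseteq> U \<and> (\<forall>F\<in>V b. norm (F x - a b) \<le> \<epsilon>/4 * norm x)" for b
      by (auto simp: V_def)
    ultimately show ?thesis by blast
  qed
  then obtain X a V where
    X: "\<And>U. good U \<Longrightarrow> norm (a U True - a U False) > \<epsilon> * norm (X U)"
    and V: "\<And>U b. good U \<Longrightarrow> good (V U b)" "\<And>U b. good U \<Longrightarrow> V U b \<subseteq> U"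
      "\<And>U b F. good U \<Longrightarrow> F \<in> V U b \<Longrightarrow> norm (F (X U) - a U b) \<le> \<epsilon>/4 * norm (X U)"
    by metis
  \<comment> \<open>The nodes are numbered like the cells: the parent of \<open>k\<close> is
    \<open>k div 2\<close>, and the parity of \<open>k\<close> selects the half.\<close>
  define S :: "nat \<Rightarrow> nat \<Rightarrow> ('a \<Rightarrow> 'k) set" where "S = rec_nat (\<lambda>_. UNIV) (\<lambda>n T k. V (T (k div 2)) (odd k))"
  have S0: "S 0 k = UNIV" and SSuc: "S (Suc n) k = V (S n (k div 2)) (odd k)" for n k
    by (simp_all add: S_def)
  have Sgood: "good (S n k)" for n k
    by (induction n arbitrary: k) (use D(2) V(1) in \<open>auto simp: S0 SSuc good_def[of UNIV]\<close>)
  have Snest: "S (n + j) k \<subseteq> S n (k div 2 ^ j)" for n j k :: nat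
  proof (induction j arbitrary: k)
    case (Suc j)
    have "S (n + Suc j) k \<subseteq> S (n + j) (k div 2)" using V(2)[OF Sgood] by (simp add: SSuc)
    also have "\<dots> \<subseteq> S n (k div 2 div 2 ^ j)" by (rule Suc)
    finally show ?case by (simp add: div_mult2_eq)
  qed simp
  have "\<exists>p. p \<in> D \<and> blinfun_apply p \<in> S n k" for n k using Sgood[of n k] by (auto simp: good_def)
  then obtain P where P: "\<And>n k. P n k \<in> D" "\<And>n k. blinfun_apply (P n k) \<in> S n k" by metis
  \<comment> \<open>Two distinct points of \<open>D\<close> give a nonzero functional, which is
    needed to place the dyadic measure on the type.\<close>
  obtain p0 where p0: "p0 \<in> D" using D(2) by blast
  obtain q0 where "q0 \<in> D" "norm (q0 - p0) > \<epsilon>" using nf[OF p0, of UNIV] by auto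
  then have "q0 - p0 \<noteq> 0" using e by auto
  then obtain M :: "('a \<Rightarrow>\<^sub>L 'k) measure" and \<kappa> where "dyadic_measure M \<kappa>"
    by (rule dyadic_measure_exists)
  then interpret dyadic_measure M \<kappa> .
  have P': "norm (P n k) \<le> 1" "P n k \<in> dual_space smul" for n k using P(1) D by auto
  from weak_star_vector_measure[where P = P, OF P']
  obtain G :: "('a \<Rightarrow>\<^sub>L 'k) set \<Rightarrow> ('a \<Rightarrow>\<^sub>L 'k)" where
    G: "vector_measure M (dual_space smul) G" "\<And>A. A \<in> sets M \<Longrightarrow> norm (G A) \<le> measure M A"
    and G3: "\<forall>A\<in>sets M. \<forall>n k x \<alpha> r. A \<subseteq> cell n k \<longrightarrow>
      (\<forall>j k'. k' div 2 ^ j = k \<longrightarrow> norm (blinfun_apply (P (n + j) k') x - \<alpha>) \<le> r) \<longrightarrow>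
      norm (blinfun_apply (G A) x - measure M A *\<^sub>R \<alpha>) \<le> measure M A * r"
    by blast
  have "G A = 0" if "A \<in> null_sets M" for A
    using G(2)[of A] that by (auto simp: null_sets_def measure_def)
  then obtain g where g: "\<And>A. A \<in> sets M \<Longrightarrow> bochner_has_integral M (\<lambda>x. indicator A x *\<^sub>R g x) (G A)"
    using rnp[unfolded radon_nikodym_property_def, rule_format, of M G] G(1)
      bounded_variation_dominated[of G, OF G(2)] finite_measure_axioms by blast
  have e4: "\<epsilon>/4 > 0" using e by simp
  obtain A v where A: "A \<in> sets M" "measure M A > 0"
    and Av: "\<And>C. C \<in> sets M \<Longrightarrow> C \<subseteq> A \<Longrightarrow> norm (G C - measure M C *\<^sub>R v) \<le> \<epsilon>/4 * measure M C"
    using bochner_density_almost_constant[OF g e4] by blast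
  obtain n k where pos: "measure M (A \<inter> cell (Suc n) (2 * k)) > 0"
      "measure M (A \<inter> cell (Suc n) (2 * k + 1)) > 0"
    using split_exists[OF A] by blast
  define x where "x = X (S n k)"
  have near: "norm (a (S n k) (odd i) - blinfun_apply v x) \<le> \<epsilon>/2 * norm x"
    if i: "i div 2 = k" and pos: "measure M (A \<inter> cell (Suc n) i) > 0" for i
  proof -
    define C where "C = A \<inter> cell (Suc n) i"
    define \<alpha> where "\<alpha> = a (S n k) (odd i)"
    have C: "C \<in> sets M" "C \<subseteq> A" "C \<subseteq> cell (Suc n) i" using A by (auto simp: C_def)
    have 1: "norm (blinfun_apply (G C) x - measure M C *\<^sub>R \<alpha>) \<le> measure M C * (\<epsilon>/4 * norm x)"
    proof (rule G3[rule_format, OF C(1,3)])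
      fix j k' assume "k' div 2 ^ j = i"
      then have "blinfun_apply (P (Suc n + j) k') \<in> S (Suc n) i" using P(2) Snest by blast
      then show "norm (blinfun_apply (P (Suc n + j) k') x - \<alpha>) \<le> \<epsilon>/4 * norm x"
        using V(3)[OF Sgood] i unfolding SSuc x_def \<alpha>_def by blast
    qed
    have "norm (blinfun_apply (G C) x - measure M C *\<^sub>R blinfun_apply v x)
        = norm (blinfun_apply (G C - measure M C *\<^sub>R v) x)"
      by (simp add: blinfun.diff_left blinfun.scaleR_left)
    also have "\<dots> \<le> norm (G C - measure M C *\<^sub>R v) * norm x" by (rule norm_blinfun)
    also have "\<dots> \<le> (\<epsilon>/4 * measure M C) * norm x" by (intro mult_right_mono Av C) simp
    finally have 2: "norm (blinfun_apply (G C) x - measure M C *\<^sub>R blinfun_apply v x) \<le> (\<epsilon>/4 * measure M C) * norm x" .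
    have "measure M C * norm (\<alpha> - blinfun_apply v x)
        = norm ((blinfun_apply (G C) x - measure M C *\<^sub>R blinfun_apply v x) - (blinfun_apply (G C) x - measure M C *\<^sub>R \<alpha>))"
      by (simp flip: scaleR_diff_right)
    also have "\<dots> \<le> measure M C * (\<epsilon>/2 * norm x)"
      using norm_triangle_ineq4[of "blinfun_apply (G C) x - measure M C *\<^sub>R blinfun_apply v x"
          "blinfun_apply (G C) x - measure M C *\<^sub>R \<alpha>"] 1 2 by (simp add: algebra_simps)
    finally show ?thesis using pos unfolding C_def[symmetric] \<alpha>_def by simp
  qed
  have "norm (a (S n k) True - a (S n k) False) \<le> \<epsilon>/2 * norm x + \<epsilon>/2 * norm x"
    using near[of "2 * k"] near[of "2 * k + 1"] pos
      norm_triangle_ineq4[of "a (S n k) True - blinfun_apply v x" "a (S n k) False - blinfun_apply v x"]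
    by simp
  then show False using X[OF Sgood, of n k] by (simp add: x_def)
qed

section \<open>Bounded functions on a set\<close>

instance bcontfun :: (metric_space, banach) banach ..

lemma subspace_closure:
  fixes S :: "'v::real_normed_vector set"
  assumes "subspace S" shows "subspace (closure S)"
proof -
  have "0 \<in> closure S" using subspace_0[OF assms] closure_subset by blast
  moreover have "a + b \<in> closure S" if "a \<in> closure S" "b \<in> closure S" for a b
  proof -
    obtain x y where xy: "\<And>n. x n \<in> S" "\<And>n. y n \<in> S" "x \<longlonglongrightarrow> a" "y \<longlonglongrightarrow> b"
      using \<open>a \<in> closure S\<close> \<open>b \<in> closure S\<close> unfolding closure_sequential by metis
    then show ?thesis
      unfolding closure_sequential using subspace_add[OF assms xy(1,2)] tendsto_add[OF xy(3,4)]
      by (intro exI[of _ "\<lambda>n. x n + y n"] conjI allI)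
  qed
  moreover have "c *\<^sub>R a \<in> closure S" if "a \<in> closure S" for a c
  proof -
    obtain x where x: "\<And>n. x n \<in> S" "x \<longlonglongrightarrow> a"
      using \<open>a \<in> closure S\<close> unfolding closure_sequential by metis
    then show ?thesis
      unfolding closure_sequential
      using subspace_scale[OF assms x(1), of c] tendsto_scaleR[OF tendsto_const x(2), of c]
      by (intro exI[of _ "\<lambda>n. c *\<^sub>R x n"] conjI allI)
  qed
  ultimately show ?thesis unfolding subspace_def by blast
qed

text \<open>Bounded continuous functions on a discrete copy of the type form a Banach space of all
  bounded functions; these include indicators of arbitrary sets, on which a mean has to act. The
  value 0 off \<open>Q\<close> makes the norm the supremum over \<open>Q\<close>.\<close>

definition bfun :: "'q set \<Rightarrow> ('q \<Rightarrow> real) \<Rightarrow> ('q discrete, real) bcontfun" where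
  "bfun Q g = Bcontfun (\<lambda>d. if of_discrete d \<in> Q then g (of_discrete d) else 0)"

definition bval :: "('q discrete, real) bcontfun \<Rightarrow> 'q \<Rightarrow> real" where
  "bval f q = apply_bcontfun f (discrete q)"

lemma continuous_on_discrete: "continuous_on S (f :: 'q discrete \<Rightarrow> 'b::topological_space)"
  unfolding continuous_on_topological using open_discrete by (metis singletonD insertI1)

lemma bval_bfun:
  assumes "bounded (g ` Q)" shows "bval (bfun Q g) q = (if q \<in> Q then g q else 0)"
proof -
  let ?g = "\<lambda>d. if of_discrete d \<in> Q then g (of_discrete d) else 0"
  obtain M where M: "\<And>q. q \<in> Q \<Longrightarrow> \<bar>g q\<bar> \<le> M" using assms unfolding bounded_iff by auto
  have "?g \<in> bcontfun"
    by (rule bcontfun_normI[of _ "max M 0"]) (auto simp: continuous_on_discrete M le_max_iff_disj)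
  then show ?thesis unfolding bval_def bfun_def by (simp add: Bcontfun_inverse discrete_inverse)
qed

lemma bcontfun_eqI_bval: "(\<And>q. bval f q = bval g q) \<Longrightarrow> f = g"
  unfolding bval_def by (rule bcontfun_eqI) (metis of_discrete_inverse)

lemma bval_simps [simp]:
  "bval (f + g) q = bval f q + bval g q" "bval (f - g) q = bval f q - bval g q"
  "bval (c *\<^sub>R f) q = c * bval f q" "bval 0 q = 0" "bval (- f) q = - bval f q"
  by (simp_all add: bval_def)

lemma abs_bval_le: "\<bar>bval f q\<bar> \<le> norm f"
  using norm_bounded[of f "discrete q"] by (simp add: bval_def)

lemma norm_bcontfun_le: "(\<And>q. \<bar>bval f q\<bar> \<le> b) \<Longrightarrow> norm f \<le> b"
  by (rule norm_bound) (metis bval_def of_discrete_inverse real_norm_def)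

lemma bfun_add: "bounded (f ` Q) \<Longrightarrow> bounded (g ` Q) \<Longrightarrow> bfun Q (\<lambda>q. f q + g q) = bfun Q f + bfun Q g"
  by (rule bcontfun_eqI_bval) (simp add: bval_bfun bounded_plus_comp)

lemma bounded_image_scale: "bounded (f ` Q) \<Longrightarrow> bounded ((\<lambda>q. c * f q :: real) ` Q)"
  using bounded_scaling[of "f ` Q" c] by (simp add: image_image)

lemma bfun_scale: "bounded (f ` Q) \<Longrightarrow> bfun Q (\<lambda>q. c * f q) = c *\<^sub>R bfun Q f"
  by (rule bcontfun_eqI_bval) (simp add: bval_bfun bounded_image_scale)


section \<open>Discretising functionals on a space of functions\<close>

text \<open>\<open>Y_sym\<close> makes the one-sided supremum over \<open>Q\<close> of a member of
  \<open>Y\<close> its norm. \<open>Y_frag\<close> is fragmentability for the distance given by the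
  supremum of \<open>\<bar>y q - y p\<bar>\<close> over the unit ball of \<open>Y\<close>.\<close>

locale fragmented_function_space =
  fixes Q :: "'q::topological_space set" and Y :: "('q \<Rightarrow> real) set"
  assumes compact_Q: "compact Q" and Q_ne: "Q \<noteq> {}"
    and hausdorff_Q: "p \<in> Q \<Longrightarrow> q \<in> Q \<Longrightarrow> p \<noteq> q \<Longrightarrow> \<exists>U V. open U \<and> open V \<and> p \<in> U \<and> q \<in> V \<and> U \<inter> V = {}"
    and Y_zero: "(\<lambda>_. 0) \<in> Y"
    and Y_add: "f \<in> Y \<Longrightarrow> g \<in> Y \<Longrightarrow> (\<lambda>q. f q + g q) \<in> Y"
    and Y_scale: "f \<in> Y \<Longrightarrow> (\<lambda>q. c * f q) \<in> Y"
    and Y_cont: "f \<in> Y \<Longrightarrow> continuous_on Q f"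
    and Y_sym: "q \<in> Q \<Longrightarrow> \<exists>q'\<in>Q. \<forall>f\<in>Y. f q' = - f q"
    and Y_frag: "L \<subseteq> Q \<Longrightarrow> L \<noteq> {} \<Longrightarrow> \<epsilon> > 0 \<Longrightarrow> \<exists>p\<in>L. \<exists>U. open U \<and> p \<in> U \<and>
        (\<forall>q\<in>L \<inter> U. \<forall>y\<in>Y. (\<forall>q\<in>Q. \<bar>y q\<bar> \<le> 1) \<longrightarrow> \<bar>y q - y p\<bar> \<le> \<epsilon>)"
begin

lemma bounded_continuous: "continuous_on Q f \<Longrightarrow> bounded (f ` Q)" for f :: "'q \<Rightarrow> real"
  using compact_continuous_image[OF _ compact_Q] compact_imp_bounded by blast

lemmas Y_bounded = bounded_continuous[OF Y_cont]

text \<open>The one-sided supremum, and not the norm, is the dominating functional for Hahn-Banach: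
  a linear functional below it is automatically positive and takes the value 1 at the constant
  1.\<close>

definition top_value :: "('q discrete, real) bcontfun \<Rightarrow> real" where
  "top_value f = (SUP q\<in>Q. bval f q)"

lemma bval_le_top: "q \<in> Q \<Longrightarrow> bval f q \<le> top_value f"
  unfolding top_value_def
  by (rule cSUP_upper) (use abs_bval_le[of f] in \<open>auto simp: bdd_above_def abs_le_iff intro!: exI[of _ "norm f"]\<close>)

lemma top_le: "(\<And>q. q \<in> Q \<Longrightarrow> bval f q \<le> b) \<Longrightarrow> top_value f \<le> b"
  unfolding top_value_def by (rule cSUP_least[OF Q_ne])

lemma sublinear_top: "sublinear top_value"
  unfolding sublinear_def
proof (intro conjI allI impI)
  fix f g show "top_value (f + g) \<le> top_value f + top_value g"
    by (rule top_le) (simp add: add_mono bval_le_top)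
next
  fix c :: real and f assume c: "0 \<le> c"
  have le: "top_value (c *\<^sub>R f) \<le> c * top_value f" if "0 \<le> c" for c f
    by (rule top_le) (simp add: that mult_left_mono bval_le_top)
  show "top_value (c *\<^sub>R f) = c * top_value f"
  proof (cases "c = 0")
    case True
    obtain q where "q \<in> Q" using Q_ne by blast
    then show ?thesis using True le[of 0 f] bval_le_top[of q "0 *\<^sub>R f"] by simp
  next
    case False
    then have "top_value ((1 / c) *\<^sub>R (c *\<^sub>R f)) \<le> (1 / c) * top_value (c *\<^sub>R f)" using c by (intro le) simp
    then show ?thesis using le[OF c, of f] c False by (simp add: field_simps)
  qed
qed

lemma mean_exists:
  assumes Z: "subspace Z" and phi: "linear \<phi>" and dom: "\<And>z. z \<in> Z \<Longrightarrow> \<phi> z \<le> top_value z"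
  obtains \<Lambda> where "positive_functional Q \<Lambda>"
    "\<And>y. bounded (y ` Q) \<Longrightarrow> bfun Q y \<in> Z \<Longrightarrow> \<Lambda> y = \<phi> (bfun Q y)"
proof -
  obtain F where F: "linear F" "\<And>z. z \<in> Z \<Longrightarrow> F z = \<phi> z" "\<And>f. F f \<le> top_value f"
    using hahn_banach[OF sublinear_top Z, of \<phi>] phi dom by (auto simp: linear_add linear_scale)
  define \<Lambda> where "\<Lambda> y = F (bfun Q y)" for y
  have le: "F (bfun Q y) \<le> b" if "bounded (y ` Q)" "\<And>q. q \<in> Q \<Longrightarrow> y q \<le> b" for y b
    by (rule order_trans[OF F(3) top_le]) (use that in \<open>simp add: bval_bfun\<close>)
  have neg: "F (bfun Q (\<lambda>q. - y q)) = - F (bfun Q y)" if "bounded (y ` Q)" for y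
    using bfun_scale[OF that, of "-1"] by (simp add: linear_neg[OF F(1)])
  have "positive_functional Q \<Lambda>"
  proof
    show "\<Lambda> (\<lambda>q. f q + g q) = \<Lambda> f + \<Lambda> g" if "bounded (f ` Q)" "bounded (g ` Q)" for f g
      using that by (simp add: \<Lambda>_def bfun_add linear_add[OF F(1)])
    show "\<Lambda> (\<lambda>q. c * f q) = c * \<Lambda> f" if "bounded (f ` Q)" for f c
      using that by (simp add: \<Lambda>_def bfun_scale linear_scale[OF F(1)])
    show "0 \<le> \<Lambda> f" if "bounded (f ` Q)" "\<And>q. q \<in> Q \<Longrightarrow> 0 \<le> f q" for f
    proof -
      have "bounded ((\<lambda>q. - f q) ` Q)" using bounded_image_scale[OF that(1), of "-1"] by simp
      from le[OF this, of 0] show ?thesis using that neg by (simp add: \<Lambda>_def)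
    qed
    have b1: "bounded ((\<lambda>_. c :: real) ` Q)" for c by (simp add: image_constant_conv)
    have "F (bfun Q (\<lambda>_. - 1)) \<le> - 1" by (rule le[OF b1]) simp
    moreover have "F (bfun Q (\<lambda>_. 1)) \<le> 1" by (rule le[OF b1]) simp
    ultimately show "\<Lambda> (\<lambda>_. 1) = 1" using neg[OF b1, of 1] by (simp add: \<Lambda>_def)
  qed (use compact_Q hausdorff_Q in auto)
  then show thesis using that F(2) by (simp add: \<Lambda>_def)
qed

lemma discretise_mean:
  assumes L: "positive_functional Q \<Lambda>" and M: "M \<ge> 0"
    and y0: "continuous_on Q y0" "\<And>q. q \<in> Q \<Longrightarrow> y0 q \<le> 1" "\<Lambda> y0 = 1" and e: "\<epsilon> > 0"
  shows "\<exists>(n::nat) c q. (\<forall>k<n. 0 \<le> c k \<and> q k \<in> Q \<and> y0 (q k) = 1) \<and> (\<Sum>k<n. c k) \<le> M \<and>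
    (\<forall>y\<in>Y. (\<forall>q\<in>Q. \<bar>y q\<bar> \<le> 1) \<longrightarrow> \<bar>M * \<Lambda> y - (\<Sum>k<n. c k * y (q k))\<bar> \<le> \<epsilon>)"
proof -
  interpret positive_functional Q \<Lambda> by (rule L)
  \<comment> \<open>\<open>M + 1\<close> keeps the quotient meaningful for \<open>M = 0\<close>, and
    scaling by \<open>M\<close> still leaves an error of at most \<open>\<epsilon>\<close>.\<close>
  have e': "\<epsilon> / (M + 1) > 0" using e M by simp
  have "\<exists>(n::nat) c q. (\<forall>k<n. 0 \<le> c k \<and> q k \<in> Q \<and> y0 (q k) = 1) \<and> (\<Sum>k<n. c k) \<le> 1 \<and>
     (\<forall>y\<in>{y\<in>Y. \<forall>q\<in>Q. \<bar>y q\<bar> \<le> 1}. \<bar>\<Lambda> y - (\<Sum>k<n. c k * y (q k))\<bar> \<le> \<epsilon> / (M + 1))"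
  proof (rule discretisation)
    fix L :: "'q set" and \<epsilon> :: real assume "L \<subseteq> Q" "L \<noteq> {}" "\<epsilon> > 0"
    from Y_frag[OF this] show "\<exists>p\<in>L. \<exists>U. open U \<and> p \<in> U \<and>
      (\<forall>q\<in>L \<inter> U. \<forall>y\<in>{y\<in>Y. \<forall>q\<in>Q. \<bar>y q\<bar> \<le> 1}. \<bar>y q - y p\<bar> \<le> \<epsilon>)" by blast
  qed (use Y_cont y0 e' bounded_continuous[OF y0(1)] in auto)
  then obtain n :: nat and c q where *: "\<forall>k<n. 0 \<le> c k \<and> q k \<in> Q \<and> y0 (q k) = 1" "(\<Sum>k<n. c k) \<le> 1"
     "\<forall>y\<in>{y\<in>Y. \<forall>q\<in>Q. \<bar>y q\<bar> \<le> 1}. \<bar>\<Lambda> y - (\<Sum>k<n. c k * y (q k))\<bar> \<le> \<epsilon> / (M + 1)" by blast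
  have "\<bar>M * \<Lambda> y - (\<Sum>k<n. M * c k * y (q k))\<bar> \<le> \<epsilon>"
    if y: "y \<in> Y" "\<forall>q\<in>Q. \<bar>y q\<bar> \<le> 1" for y
  proof -
    have "\<bar>M * \<Lambda> y - (\<Sum>k<n. M * c k * y (q k))\<bar> = M * \<bar>\<Lambda> y - (\<Sum>k<n. c k * y (q k))\<bar>"
      using M by (simp add: mult.assoc abs_mult flip: sum_distrib_left right_diff_distrib)
    also have "\<dots> \<le> M * (\<epsilon> / (M + 1))" using *(3) y M by (intro mult_left_mono) auto
    also have "\<dots> \<le> \<epsilon>" using M e by (simp add: field_simps)
    finally show ?thesis .
  qed
  moreover have "(\<Sum>k<n. M * c k) \<le> M"
    using *(2) M mult_left_mono[of _ 1 M] by (simp flip: sum_distrib_left)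
  moreover have "\<forall>k<n. 0 \<le> M * c k \<and> q k \<in> Q \<and> y0 (q k) = 1" using *(1) M by simp
  ultimately show ?thesis by (intro exI[of _ n] exI[of _ "\<lambda>k. M * c k"] exI[of _ q]) auto
qed

definition Yb :: "('q discrete, real) bcontfun set" where "Yb = bfun Q ` Y"

lemma subspace_Yb: "subspace Yb"
proof -
  have "bfun Q (\<lambda>_. 0) = 0" by (rule bcontfun_eqI_bval) (simp add: bval_bfun image_constant_conv)
  then have "0 \<in> Yb" using Y_zero unfolding Yb_def by (metis imageI)
  moreover have "f + g \<in> Yb" if "f \<in> Yb" "g \<in> Yb" for f g
    using that Y_add Y_bounded unfolding Yb_def by (auto simp flip: bfun_add)
  moreover have "c *\<^sub>R f \<in> Yb" if "f \<in> Yb" for f c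
    using that Y_scale Y_bounded unfolding Yb_def by (auto simp flip: bfun_scale)
  ultimately show ?thesis unfolding subspace_def by blast
qed

text \<open>Symmetry of \<open>Q\<close> supplies the lower bounds that the one-sided supremum
  ignores; approximation carries the estimate to the closure. It lets norm bounds enter Hahn-Banach
  with \<open>top_value\<close>.\<close>

lemma norm_le_top: "z \<in> closure Yb \<Longrightarrow> norm z \<le> top_value z"
proof -
  have Yb: "norm z \<le> top_value z" if "z \<in> Yb" for z
  proof -
    obtain y where y: "z = bfun Q y" "y \<in> Y" using \<open>z \<in> Yb\<close> by (auto simp: Yb_def)
    have v: "q \<in> Q \<Longrightarrow> bval z q = y q" for q using y Y_bounded by (simp add: bval_bfun)
    have *: "\<bar>bval z q\<bar> \<le> top_value z" if q: "q \<in> Q" for q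
    proof -
      obtain q' where q': "q' \<in> Q" "y q' = - y q" using Y_sym[OF q] y by blast
      show ?thesis using bval_le_top[OF q, of z] bval_le_top[OF q'(1), of z] v q q' by simp
    qed
    moreover have "bval z q = 0" if "q \<notin> Q" for q using y Y_bounded that by (simp add: bval_bfun)
    moreover have "0 \<le> top_value z" using * Q_ne by (meson abs_ge_zero all_not_in_conv order_trans)
    ultimately show ?thesis by (intro norm_bcontfun_le) (metis abs_zero)
  qed
  assume z: "z \<in> closure Yb"
  show ?thesis
  proof (rule field_le_epsilon)
    fix \<epsilon> :: real assume "0 < \<epsilon>"
    then obtain w where w: "w \<in> Yb" "dist w z < \<epsilon> / 2"
      using z unfolding closure_approachable by (meson half_gt_zero)
    have "norm z \<le> norm w + \<epsilon> / 2" using w(2) norm_triangle_ineq2[of z w]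
      by (simp add: dist_norm norm_minus_commute)
    also have "norm w \<le> top_value w" by (rule Yb[OF w(1)])
    also have "top_value w \<le> top_value z + \<epsilon> / 2"
    proof (rule top_le)
      fix q assume "q \<in> Q"
      then show "bval w q \<le> top_value z + \<epsilon> / 2"
        using bval_le_top[of q z] abs_bval_le[of "w - z" q] w(2) by (simp add: dist_norm)
    qed
    finally show "norm z \<le> top_value z + \<epsilon>" by simp
  qed
qed

lemma norm_bfun_le_1: "y \<in> Y \<Longrightarrow> (\<And>q. q \<in> Q \<Longrightarrow> \<bar>y q\<bar> \<le> 1) \<Longrightarrow> norm (bfun Q y) \<le> 1"
  by (rule norm_bcontfun_le) (simp add: bval_bfun Y_bounded)

lemma bound_on_Y:
  assumes "linear \<phi>" and le: "\<And>y. y \<in> Y \<Longrightarrow> (\<And>q. q \<in> Q \<Longrightarrow> \<bar>y q\<bar> \<le> 1) \<Longrightarrow> \<phi> (bfun Q y) \<le> M"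
    and z: "z \<in> Yb"
  shows "\<phi> z \<le> M * top_value z"
proof -
  obtain y where y: "z = bfun Q y" "y \<in> Y" using z by (auto simp: Yb_def)
  have M0: "0 \<le> M" using le[OF Y_zero] linear_0[OF assms(1)] bfun_scale[of "\<lambda>_. 0" Q 0] by (simp add: image_constant_conv)
  have top: "norm z \<le> top_value z" using norm_le_top z closure_subset by blast
  show ?thesis
  proof (rule field_le_epsilon)
    fix \<epsilon> :: real assume e: "0 < \<epsilon>"
    \<comment> \<open>\<open>top_value z\<close> may be 0, so \<open>z\<close> is normalised by a
      slightly larger number; after multiplication by \<open>M\<close> the excess is at most
      \<open>\<epsilon>\<close>.\<close>
    define t where "t = top_value z + \<epsilon> / (M + 1)"
    have eM: "\<epsilon> / (M + 1) > 0" using e M0 by simp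
    then have t: "t > 0" using top norm_ge_zero[of z] unfolding t_def by linarith
    have "\<bar>(1/t) * y q\<bar> \<le> 1" if "q \<in> Q" for q
    proof -
      have "\<bar>y q\<bar> \<le> norm z" using abs_bval_le[of z q] y that Y_bounded by (simp add: bval_bfun)
      also have "\<dots> \<le> t" using top eM by (simp add: t_def)
      finally show ?thesis using t by (simp add: abs_mult divide_le_eq)
    qed
    then have "\<phi> (bfun Q (\<lambda>q. (1/t) * y q)) \<le> M" by (intro le Y_scale y(2))
    then have "\<phi> ((1/t) *\<^sub>R z) \<le> M" by (simp only: bfun_scale[OF Y_bounded[OF y(2)]] y(1))
    then have "\<phi> z \<le> M * t" using t by (simp add: linear_scale[OF assms(1)] field_simps)
    also have "\<dots> \<le> M * top_value z + \<epsilon>" using M0 e by (simp add: t_def field_simps)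
    finally show "\<phi> z \<le> M * top_value z + \<epsilon>" .
  qed
qed

context
  fixes m :: nat and d :: "nat \<Rightarrow> real" and p :: "nat \<Rightarrow> 'q"
  assumes p: "\<And>i. i < m \<Longrightarrow> p i \<in> Q"
begin

definition \<psi> :: "('q discrete, real) bcontfun \<Rightarrow> real" where "\<psi> f = (\<Sum>i<m. d i * bval f (p i))"

lemma psi_bfun: "y \<in> Y \<Longrightarrow> \<psi> (bfun Q y) = (\<Sum>i<m. d i * y (p i))"
  unfolding \<psi>_def by (intro sum.cong refl) (simp add: bval_bfun Y_bounded p)

lemma bounded_linear_psi: "bounded_linear \<psi>"
proof (rule bounded_linear_intro[where K = "\<Sum>i<m. \<bar>d i\<bar>"])
  show "norm (\<psi> f) \<le> norm f * (\<Sum>i<m. \<bar>d i\<bar>)" for f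
  proof -
    have "norm (\<psi> f) \<le> (\<Sum>i<m. norm (d i * bval f (p i)))" unfolding \<psi>_def by (rule norm_sum)
    also have "\<dots> \<le> (\<Sum>i<m. norm f * \<bar>d i\<bar>)"
      by (intro sum_mono) (simp add: abs_mult mult.commute[of "norm f"] mult_left_mono abs_bval_le)
    finally show ?thesis by (simp add: sum_distrib_left)
  qed
qed (simp_all add: \<psi>_def distrib_left sum.distrib sum_distrib_left mult.left_commute)

text \<open>The constant 1 takes the place of the peaking function, so the points are free in
  \<open>Q\<close> and only the total weight is controlled.\<close>

lemma approximate_functional:
  assumes M: "M > 0" and e: "\<epsilon> > 0"
    and le: "\<And>y. y \<in> Y \<Longrightarrow> (\<And>q. q \<in> Q \<Longrightarrow> \<bar>y q\<bar> \<le> 1) \<Longrightarrow> (\<Sum>i<m. d i * y (p i)) \<le> M"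
  shows "\<exists>(n::nat) c q. (\<forall>k<n. 0 \<le> c k \<and> q k \<in> Q) \<and> (\<Sum>k<n. c k) \<le> M \<and>
    (\<forall>y\<in>Y. (\<forall>q\<in>Q. \<bar>y q\<bar> \<le> 1) \<longrightarrow> \<bar>(\<Sum>i<m. d i * y (p i)) - (\<Sum>k<n. c k * y (q k))\<bar> \<le> \<epsilon>)"
proof -
  have lin: "linear \<psi>" using bounded_linear_psi bounded_linear.linear by blast
  have lin': "linear (\<lambda>f. (1 / M) *\<^sub>R \<psi> f)" by (rule linear_compose_scale_right[OF lin])
  have "(1 / M) *\<^sub>R \<psi> z \<le> top_value z" if "z \<in> Yb" for z
    using bound_on_Y[OF lin _ that, of M] le psi_bfun M by (simp add: field_simps)
  then obtain \<Lambda> where L: "positive_functional Q \<Lambda>"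
    and Lpsi: "\<And>y. bounded (y ` Q) \<Longrightarrow> bfun Q y \<in> Yb \<Longrightarrow> \<Lambda> y = (1 / M) *\<^sub>R \<psi> (bfun Q y)"
    using mean_exists[OF subspace_Yb lin'] by blast
  have "\<exists>(n::nat) c q. (\<forall>k<n. 0 \<le> c k \<and> q k \<in> Q \<and> (1::real) = 1) \<and> (\<Sum>k<n. c k) \<le> M \<and>
    (\<forall>y\<in>Y. (\<forall>q\<in>Q. \<bar>y q\<bar> \<le> 1) \<longrightarrow> \<bar>M * \<Lambda> y - (\<Sum>k<n. c k * y (q k))\<bar> \<le> \<epsilon>)"
    by (rule discretise_mean[OF L less_imp_le[OF M], of "\<lambda>_. 1"])
       (use positive_functional.one[OF L] e in auto)
  then obtain n :: nat and c q where *: "\<forall>k<n. 0 \<le> c k \<and> q k \<in> Q" "(\<Sum>k<n. c k) \<le> M"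
    and approx: "\<And>y. y \<in> Y \<Longrightarrow> \<forall>q\<in>Q. \<bar>y q\<bar> \<le> 1 \<Longrightarrow> \<bar>M * \<Lambda> y - (\<Sum>k<n. c k * y (q k))\<bar> \<le> \<epsilon>"
    by blast
  have "M * \<Lambda> y = (\<Sum>i<m. d i * y (p i))" if "y \<in> Y" for y
    using Lpsi[OF Y_bounded[OF that]] that psi_bfun M by (simp add: Yb_def)
  then show ?thesis using * approx by (intro exI[of _ n] exI[of _ c] exI[of _ q]) auto
qed

text \<open>Bishop-Phelps works in the closed subspace \<open>closure Yb\<close>, so the maximiser
  is only a uniform limit of members of \<open>Y\<close>. Dividing by the maximum \<open>M\<close>
  gives a mean with \<open>\<Lambda> y0 = 1\<close>, which confines the points to the set where
  \<open>y0 = 1\<close>. One half of \<open>\<epsilon>\<close> pays for the perturbation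
  \<open>\<eta>\<close>, the other for the discretisation.\<close>

lemma approximate_functional_attaining:
  assumes e: "0 < \<epsilon>"
  shows "\<exists>(n::nat) c q y0. (\<forall>k<n. 0 \<le> c k \<and> q k \<in> Q \<and> y0 (q k) = 1) \<and>
    (\<forall>\<delta>>0. \<exists>y\<in>Y. \<forall>q\<in>Q. \<bar>y q - y0 q\<bar> \<le> \<delta>) \<and> (\<forall>q\<in>Q. \<bar>y0 q\<bar> \<le> 1) \<and>
    (\<forall>y\<in>Y. (\<forall>q\<in>Q. \<bar>y q\<bar> \<le> 1) \<longrightarrow> \<bar>(\<Sum>i<m. d i * y (p i)) - (\<Sum>k<n. c k * y (q k))\<bar> \<le> \<epsilon>)"
proof -
  let ?Z = "closure Yb"
  have Z: "subspace ?Z" by (rule subspace_closure[OF subspace_Yb])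
  have e2: "\<epsilon> / 2 > 0" using e by simp
  from bishop_phelps[OF Z closed_closure bounded_linear_psi e2]
  obtain \<eta> z0 where eta: "linear \<eta>" "\<And>v. \<eta> v \<le> \<epsilon> / 2 * norm v" and z0: "z0 \<in> ?Z" "norm z0 \<le> 1"
    and max: "\<And>z. z \<in> ?Z \<Longrightarrow> norm z \<le> 1 \<Longrightarrow> \<psi> z - \<eta> z \<le> \<psi> z0 - \<eta> z0"
    by blast
  define \<phi> where "\<phi> f = \<psi> f - \<eta> f" for f
  have lin: "linear \<phi>" unfolding \<phi>_def
    using bounded_linear.linear[OF bounded_linear_psi] eta(1) by (rule linear_compose_sub)
  define M where "M = \<phi> z0"
  have max: "\<phi> z \<le> M" if "z \<in> ?Z" "norm z \<le> 1" for z using max[OF that] by (simp add: \<phi>_def M_def)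
  have M0: "M \<ge> 0" using max[of 0] subspace_0[OF Z] by (simp add: linear_0[OF lin])
  have psi_phi: "\<bar>(\<Sum>i<m. d i * y (p i)) - \<phi> (bfun Q y)\<bar> \<le> \<epsilon> / 2"
    if y: "y \<in> Y" "\<And>q. q \<in> Q \<Longrightarrow> \<bar>y q\<bar> \<le> 1" for y
  proof -
    have n: "norm (bfun Q y) \<le> 1" by (rule norm_bfun_le_1[OF y])
    have "\<epsilon> / 2 * norm (bfun Q y) \<le> \<epsilon> / 2 * 1" using n e by (intro mult_left_mono) auto
    then have "\<bar>\<eta> (bfun Q y)\<bar> \<le> \<epsilon> / 2"
      using eta(2)[of "bfun Q y"] eta(2)[of "- bfun Q y"] by (simp add: linear_neg[OF eta(1)])
    then show ?thesis by (simp add: \<phi>_def psi_bfun[OF y(1)])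
  qed
  have ball: "bfun Q y \<in> ?Z" if "y \<in> Y" for y using that closure_subset[of Yb] by (auto simp: Yb_def)
  show ?thesis
  \<comment> \<open>For \<open>M = 0\<close> the symmetry of the unit ball makes
    \<open>\<phi>\<close> vanish on \<open>Yb\<close>, and the empty sum serves; otherwise one may
    divide by \<open>M\<close>.\<close>
  proof (cases "M = 0")
    case True
    have "\<bar>\<Sum>i<m. d i * y (p i)\<bar> \<le> \<epsilon>" if y: "y \<in> Y" "\<And>q. q \<in> Q \<Longrightarrow> \<bar>y q\<bar> \<le> 1" for y
    proof -
      have "norm (bfun Q y) \<le> 1" by (rule norm_bfun_le_1[OF y])
      then have "\<phi> (bfun Q y) \<le> 0" "\<phi> (- bfun Q y) \<le> 0"
        using max[OF ball[OF y(1)]] max[OF subspace_neg[OF Z ball[OF y(1)]]] True by auto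
      then show ?thesis using psi_phi[OF y] e by (simp add: linear_neg[OF lin])
    qed
    then show ?thesis
      using Y_zero by (intro exI[of _ "0::nat"] exI[of _ "\<lambda>_::nat. 0::real"] exI[of _ p] exI[of _ "\<lambda>_::'q. 0::real"]) force
  next
    case False
    then have M: "M > 0" using M0 by simp
    have "(1 / M) *\<^sub>R \<phi> z \<le> top_value z" if z: "z \<in> ?Z" for z
    proof (cases "z = 0")
      case True
      then show ?thesis using norm_le_top[OF z] by (simp add: linear_0[OF lin])
    next
      case False
      have "\<phi> ((1 / norm z) *\<^sub>R z) \<le> M" by (rule max) (use subspace_scale[OF Z z] False in auto)
      then have "\<phi> z \<le> M * norm z" using False by (simp add: linear_scale[OF lin] field_simps)
      also have "\<dots> \<le> M * top_value z" using M norm_le_top[OF z] by simp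
      finally show ?thesis using M by (simp add: field_simps)
    qed
    then obtain \<Lambda> where L: "positive_functional Q \<Lambda>"
      and Lphi: "\<And>y. bounded (y ` Q) \<Longrightarrow> bfun Q y \<in> ?Z \<Longrightarrow> \<Lambda> y = (1 / M) *\<^sub>R \<phi> (bfun Q y)"
      using mean_exists[OF Z linear_compose_scale_right[OF lin, of "1 / M"]] by blast
    define y0 where "y0 q = bval z0 q" for q
    have unif: "\<exists>y\<in>Y. \<forall>q\<in>Q. \<bar>y q - y0 q\<bar> \<le> \<delta>" if "\<delta> > 0" for \<delta>
    proof -
      obtain w where w: "w \<in> Yb" "dist w z0 < \<delta>" using z0(1) \<open>\<delta> > 0\<close> unfolding closure_approachable by blast
      then obtain y where y: "y \<in> Y" "w = bfun Q y" by (auto simp: Yb_def)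
      have "\<bar>y q - y0 q\<bar> \<le> \<delta>" if "q \<in> Q" for q
        using abs_bval_le[of "w - z0" q] w(2) y that Y_bounded[OF y(1)] by (simp add: y0_def bval_bfun dist_norm)
      then show ?thesis using y by blast
    qed
    have y0c: "continuous_on Q y0"
    proof -
      have "\<exists>y\<in>Y. \<forall>q\<in>Q. \<bar>y q - y0 q\<bar> \<le> 1 / Suc n" for n by (rule unif) simp
      then obtain f where f: "\<And>n. f n \<in> Y" "\<And>n q. q \<in> Q \<Longrightarrow> \<bar>f n q - y0 q\<bar> \<le> 1 / Suc n" by metis
      have "uniform_limit Q f y0 sequentially"
      proof (rule uniform_limitI)
        fix e :: real assume "e > 0"
        then obtain k where k: "1 / Suc k < e" using nat_approx_posE by blast
        have "dist (f n q) (y0 q) < e" if "n \<ge> k" "q \<in> Q" for n q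
        proof -
          have "1 / Suc n \<le> 1 / Suc k" using that by (simp add: frac_le)
          then show ?thesis using f(2)[OF that(2), of n] k by (simp add: dist_real_def)
        qed
        then show "\<forall>\<^sub>F n in sequentially. \<forall>q\<in>Q. dist (f n q) (y0 q) < e"
          unfolding eventually_sequentially by blast
      qed
      from uniform_limit_theorem[OF _ this] show ?thesis using f(1) Y_cont by simp
    qed
    have bz: "bfun Q y0 = z0"
    proof (rule bcontfun_eqI_bval)
      fix q
      have "bval z0 q = 0" if "q \<notin> Q"
      proof (rule ccontr)
        assume n: "bval z0 q \<noteq> 0"
        then obtain w where w: "w \<in> Yb" "dist w z0 < \<bar>bval z0 q\<bar>"
          using z0(1) unfolding closure_approachable by (meson zero_less_abs_iff)
        then have "bval w q = 0" using that Y_bounded by (auto simp: Yb_def bval_bfun)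
        then show False using abs_bval_le[of "w - z0" q] w(2) by (simp add: dist_norm)
      qed
      then show "bval (bfun Q y0) q = bval z0 q"
        by (simp add: bval_bfun[OF bounded_continuous[OF y0c]] y0_def)
    qed
    have y0_le: "\<bar>y0 q\<bar> \<le> 1" for q using abs_bval_le[of z0 q] z0(2) by (simp add: y0_def)
    have "\<Lambda> y0 = 1" using Lphi[OF bounded_continuous[OF y0c]] z0(1) M by (simp add: bz flip: M_def)
    moreover have "y0 q \<le> 1" for q using y0_le[of q] by simp
    ultimately have "\<exists>(n::nat) c q. (\<forall>k<n. 0 \<le> c k \<and> q k \<in> Q \<and> y0 (q k) = 1) \<and> (\<Sum>k<n. c k) \<le> M \<and>
      (\<forall>y\<in>Y. (\<forall>q\<in>Q. \<bar>y q\<bar> \<le> 1) \<longrightarrow> \<bar>M * \<Lambda> y - (\<Sum>k<n. c k * y (q k))\<bar> \<le> \<epsilon> / 2)"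
      by (intro discretise_mean[OF L less_imp_le[OF M] y0c _ _ e2])
    then
    obtain n :: nat and c q where *: "\<And>k. k < n \<Longrightarrow> 0 \<le> c k \<and> q k \<in> Q \<and> y0 (q k) = 1"
      and approx: "\<And>y. y \<in> Y \<Longrightarrow> \<forall>q\<in>Q. \<bar>y q\<bar> \<le> 1 \<Longrightarrow> \<bar>M * \<Lambda> y - (\<Sum>k<n. c k * y (q k))\<bar> \<le> \<epsilon> / 2"
      by blast
    have "\<bar>(\<Sum>i<m. d i * y (p i)) - (\<Sum>k<n. c k * y (q k))\<bar> \<le> \<epsilon>"
      if y: "y \<in> Y" "\<forall>q\<in>Q. \<bar>y q\<bar> \<le> 1" for y
    proof -
      have "M * \<Lambda> y = \<phi> (bfun Q y)" using Lphi[OF Y_bounded[OF y(1)] ball[OF y(1)]] M by simp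
      then show ?thesis using approx[OF y] psi_phi[OF y(1) bspec[OF y(2)]] by linarith
    qed
    then show ?thesis using * unif y0_le
      by (intro exI[of _ n] exI[of _ c] exI[of _ q] exI[of _ y0]) auto
  qed
qed

end

end

section \<open>Expansion of tensor powers\<close>

primrec monomials :: "nat \<Rightarrow> (nat \<Rightarrow> 's \<Rightarrow> 'k::field) \<Rightarrow> nat \<Rightarrow> ('s \<Rightarrow> 'k) set" where
  "monomials m a 0 = {\<lambda>_. 1}"
| "monomials m a (Suc j) = (\<lambda>(i, p) s. a i s * p s) ` ({..<m} \<times> monomials m a j)"

lemma finite_monomials: "finite (monomials m a j)"
  by (induction j) auto

lemma lin_comb_monomials_step:
  assumes "lin_comb (monomials m a j) S f" "i < m"
  shows "lin_comb (monomials m a (Suc j)) S (\<lambda>s. a i s * f s)"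
proof -
  obtain c where c: "\<And>s. s \<in> S \<Longrightarrow> f s = (\<Sum>p\<in>monomials m a j. c p * p s)"
    using assms(1) by (auto simp: lin_comb_def)
  have "lin_comb (monomials m a (Suc j)) S (\<lambda>s. \<Sum>p\<in>monomials m a j. c p * (a i s * p s))"
  proof (intro lin_comb_sum lin_comb_scale lin_comb_member finite_monomials)
    fix p assume "p \<in> monomials m a j"
    then show "(\<lambda>s. a i s * p s) \<in> monomials m a (Suc j)"
      using assms(2) by (auto intro!: image_eqI[of _ _ "(i, p)"])
  qed
  moreover have "(\<Sum>p\<in>monomials m a j. c p * (a i s * p s)) = a i s * f s" if "s \<in> S" for s
    by (simp add: c[OF that] sum_distrib_left mult.left_commute)
  ultimately show ?thesis unfolding lin_comb_def by auto
qed

locale sym_tensor_space = sym_tensor N E smul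
  for N :: nat and E :: "'e::real_normed_vector set" and smul :: "'k::rc_field \<Rightarrow> 'e \<Rightarrow> 'e" +
  assumes vs: "vector_space smul"
    and norm_smul: "\<And>c x. norm (smul c x) = norm c * norm x"
    and smul_E: "\<And>c x. x \<in> E \<Longrightarrow> smul c x \<in> E"
    and zero_E: "0 \<in> E"
    and N_pos: "N \<ge> 1"
    and add_E: "\<And>x y. x \<in> E \<Longrightarrow> y \<in> E \<Longrightarrow> x + y \<in> E"
begin

lemma pn_le': "urep z s \<Longrightarrow> proj_norm z \<le> s"
  by (rule pn_le[OF vs norm_smul _ zero_E N_pos]) (auto intro: smul_E)

lemma pn_ge': "urep z s \<Longrightarrow> (\<And>t. urep z t \<Longrightarrow> a \<le> t) \<Longrightarrow> a \<le> proj_norm z"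
  by (rule pn_ge[OF vs norm_smul _ zero_E N_pos]) (auto intro: smul_E)

lemma urep_def': "urep z s \<longleftrightarrow> (\<exists>n l x. s = (\<Sum>k<n. norm (l k)) \<and> z = tensor_sum n l x \<and> (\<forall>k<n. x k \<in> E \<and> norm (x k) = 1))"
  by (rule urep_def[OF vs norm_smul _ zero_E N_pos]) (auto intro: smul_E)

lemma urep_add': "urep z s \<Longrightarrow> urep w t \<Longrightarrow> urep (\<lambda>A. z A + w A) (s + t)"
  by (rule urep_add[OF vs norm_smul _ zero_E N_pos]) (auto intro: smul_E)

lemma urep_0': "urep (\<lambda>_. 0) 0"
  by (rule urep_0[OF vs norm_smul _ zero_E N_pos]) (auto intro: smul_E)

lemma span_urep': "z \<in> sym_span \<Longrightarrow> \<exists>s. urep z s"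
  by (rule span_urep[OF vs norm_smul _ zero_E N_pos]) (auto intro: smul_E)

lemma tensor_diff_span: "z \<in> sym_span \<Longrightarrow> w \<in> sym_span \<Longrightarrow> (\<lambda>A. z A - w A) \<in> sym_span"
  by (rule span_diff[OF vs norm_smul _ zero_E N_pos]) (auto intro: smul_E)

lemma tensor_power_smul': "x \<in> E \<Longrightarrow> tensor_power (smul c x) B = c ^ N * tensor_power x B"
  by (rule tensor_power_smul[OF vs norm_smul _ zero_E N_pos]) (auto intro: smul_E)

lemma tensor_power_0': "tensor_power 0 B = 0"
  by (rule tensor_power_0[OF vs norm_smul _ zero_E N_pos]) (auto intro: smul_E)

lemma ml_zero': "multilinear_form N E smul A \<Longrightarrow> length xs = N \<Longrightarrow> set xs \<subseteq> E \<Longrightarrow> i < N \<Longrightarrow> A (xs[i := 0]) = 0"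
  by (rule ml_zero[OF vs norm_smul _ zero_E N_pos]) (auto intro: smul_E)

sublocale vector_space smul by (rule vs)

sublocale pseudometric_on sym_span proj_dist
  by (rule pseudometric_sym_span[OF vs norm_smul _ zero_E N_pos]) (rule smul_E)

lemma sum_E: "(\<And>i. i \<in> I \<Longrightarrow> f i \<in> E) \<Longrightarrow> sum f I \<in> E"
  by (induction I rule: infinite_finite_induct) (auto simp: zero_E add_E)

lemma tensor_sum_span: "(\<And>k. k < n \<Longrightarrow> x k \<in> E) \<Longrightarrow> tensor_sum n l x \<in> sym_span"
  unfolding sym_span_def by blast

lemma zero_span: "(\<lambda>_. 0) \<in> sym_span"
  using tensor_sum_span[of 0] by (simp add: tensor_sum_def)

text \<open>Normalising \<open>x\<close> moves the factor \<open>norm x ^ N\<close> into the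
  coefficient; this makes representations by arbitrary vectors available for estimates.\<close>

lemma urep_power_scaled:
  assumes x: "x \<in> E" shows "urep (\<lambda>A. c * tensor_power x A) (norm c * norm x ^ N)"
proof (cases "x = 0")
  case True then show ?thesis using urep_0' N_pos by (simp add: tensor_power_0' zero_power)
next
  case False
  let ?r = "of_real (norm x) :: 'k"
  let ?y = "smul (inverse ?r) x"
  have r: "?r \<noteq> 0" using False by simp
  have y: "?y \<in> E" "norm ?y = 1" using x smul_E False by (auto simp: norm_smul norm_inverse)
  have "smul ?r ?y = x" using r by simp
  then have "tensor_power x A = ?r ^ N * tensor_power ?y A" for A
    using tensor_power_smul'[OF y(1), of ?r A] by simp
  then show ?thesis
    unfolding urep_def'
    by (intro exI[of _ 1] exI[of _ "\<lambda>_. c * ?r ^ N"] exI[of _ "\<lambda>_. ?y"])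
       (simp add: tensor_sum_def y fun_eq_iff norm_mult norm_power)
qed

lemma urep_tensor_sum:
  assumes "\<And>k. k < n \<Longrightarrow> x k \<in> E"
  shows "urep (tensor_sum n l x) (\<Sum>k<n. norm (l k) * norm (x k) ^ N)"
  using assms
proof (induction n)
  case 0 show ?case using urep_0' by (simp add: tensor_sum_def)
next
  case (Suc n)
  have "tensor_sum (Suc n) l x = (\<lambda>A. tensor_sum n l x A + l n * tensor_power (x n) A)"
    by (simp add: tensor_sum_def)
  then show ?case using urep_add'[OF Suc.IH urep_power_scaled[of "x n" "l n"]] Suc.prems by simp
qed

lemma proj_norm_tensor_sum_le:
  "(\<And>k. k < n \<Longrightarrow> x k \<in> E) \<Longrightarrow> proj_norm (tensor_sum n l x) \<le> (\<Sum>k<n. norm (l k) * norm (x k) ^ N)"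
  by (rule pn_le'[OF urep_tensor_sum])

lemma proj_norm_tensor_sum_ball_le:
  assumes "\<And>k. k < n \<Longrightarrow> x k \<in> E \<and> norm (x k) \<le> 1"
  shows "proj_norm (tensor_sum n l x) \<le> (\<Sum>k<n. norm (l k))"
proof -
  have "norm (l k) * norm (x k) ^ N \<le> norm (l k) * 1" if "k < n" for k
    using assms[OF that] by (intro mult_left_mono power_le_one) auto
  then have "(\<Sum>k<n. norm (l k) * norm (x k) ^ N) \<le> (\<Sum>k<n. norm (l k))" by (intro sum_mono) auto
  then show ?thesis using proj_norm_tensor_sum_le[of n x l] assms by fastforce
qed

lemma span_unit_form:
  assumes "z \<in> sym_span"
  shows "\<exists>n l x. z = tensor_sum n l x \<and> (\<forall>k<n. x k \<in> E \<and> norm (x k) = 1)"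
  using span_urep'[OF assms] unfolding urep_def' by blast

lemma multilinear_sum:
  assumes A: "multilinear_form N E smul A" "length xs = N" "set xs \<subseteq> E" "i < N"
    and g: "\<And>j. j < (m::nat) \<Longrightarrow> g j \<in> E"
  shows "A (xs[i := \<Sum>j<m. smul (c j) (g j)]) = (\<Sum>j<m. c j * A (xs[i := g j]))"
  using g
proof (induction m)
  case 0 then show ?case using ml_zero'[OF A] by simp
next
  case (Suc m)
  have "(\<Sum>j<m. smul (c j) (g j)) \<in> E" using Suc.prems by (intro sum_E smul_E) auto
  then have "A (xs[i := smul (c m) (g m) + (\<Sum>j<m. smul (c j) (g j))])
      = c m * A (xs[i := g m]) + A (xs[i := \<Sum>j<m. smul (c j) (g j)])"
    using A Suc.prems[of m] unfolding multilinear_form_def by blast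
  then show ?case using Suc by (simp add: add.commute)
qed

lemma tensor_power_lin_comb:
  assumes g: "\<And>j. j < m \<Longrightarrow> g j \<in> E"
  shows "lin_comb (monomials m a N) S (\<lambda>s. tensor_power (\<Sum>j<m. smul (a j s) (g j)) A)"
proof (cases "multilinear_form N E smul A")
  case False
  then show ?thesis by (simp add: tensor_power_def tensor_def lin_comb_def exI[of _ "\<lambda>_. 0"])
next
  case A: True
  define v where "v s = (\<Sum>j<m. smul (a j s) (g j))" for s
  have vE: "v s \<in> E" for s unfolding v_def by (intro sum_E smul_E g) simp
  \<comment> \<open>The first \<open>j\<close> slots still hold \<open>v s\<close>, and the slots in
    \<open>ys\<close> have been expanded; the step expands one more slot into the vectors
    \<open>g i\<close>, so \<open>ys\<close> has to vary in the induction.\<close>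
  have "lin_comb (monomials m a j) S (\<lambda>s. A (replicate j (v s) @ ys))"
    if "j + length ys = N" "set ys \<subseteq> E" for j ys
    using that
  proof (induction j arbitrary: ys)
    case 0
    show ?case by (auto simp: lin_comb_def intro: exI[of _ "\<lambda>_. A ys"])
  next
    case (Suc j)
    have "A (replicate (Suc j) (v s) @ ys) = (\<Sum>i<m. a i s * A (replicate j (v s) @ g i # ys))" for s
    proof -
      let ?xs = "replicate j (v s) @ 0 # ys"
      have upd: "?xs[j := u] = replicate j (v s) @ u # ys" for u by (simp add: list_update_append)
      have "A (?xs[j := v s]) = (\<Sum>i<m. a i s * A (?xs[j := g i]))"
        unfolding v_def[of s, THEN arg_cong[where f = "\<lambda>u. ?xs[j := u]"]]
        by (rule multilinear_sum[OF A]) (use Suc.prems vE zero_E g in auto)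
      then show ?thesis unfolding upd by (simp add: replicate_app_Cons_same)
    qed
    moreover have "lin_comb (monomials m a (Suc j)) S (\<lambda>s. \<Sum>i<m. a i s * A (replicate j (v s) @ g i # ys))"
      by (intro lin_comb_sum lin_comb_monomials_step Suc.IH) (use Suc.prems g in auto)
    ultimately show ?case by simp
  qed
  from this[of N "[]"] show ?thesis using A by (simp add: tensor_power_def tensor_def v_def)
qed

text \<open>Nodes and coefficients depend neither on \<open>g\<close> nor on \<open>A\<close>, so
  this is an identity of tensors: the power of a varying sum is a combination of finitely many fixed
  powers, without mixed products. Estimates thus stay within the symmetric norm, and all variation
  is confined to the scalars \<open>\<beta> k s\<close>.\<close>

lemma tensor_power_interpolation:
  fixes a :: "nat \<Rightarrow> 's \<Rightarrow> 'k"
  shows "\<exists>(r::nat) t \<beta>. (\<forall>k<r. t k \<in> S \<and> lin_comb (monomials m a N) S (\<beta> k)) \<and>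
    (\<forall>g s A. (\<forall>j<m. g j \<in> E) \<longrightarrow> s \<in> S \<longrightarrow> tensor_power (\<Sum>j<m. smul (a j s) (g j)) A
      = (\<Sum>k<r. \<beta> k s * tensor_power (\<Sum>j<m. smul (a j (t k)) (g j)) A))"
proof -
  obtain r :: nat and t \<beta> where *: "\<And>k. k < r \<Longrightarrow> t k \<in> S" "\<And>k. k < r \<Longrightarrow> lin_comb (monomials m a N) S (\<beta> k)"
    "\<And>f s. lin_comb (monomials m a N) S f \<Longrightarrow> s \<in> S \<Longrightarrow> f s = (\<Sum>k<r. f (t k) * \<beta> k s)"
    using interpolation[OF finite_monomials, of S m a N] by blast
  have "tensor_power (\<Sum>j<m. smul (a j s) (g j)) A
      = (\<Sum>k<r. \<beta> k s * tensor_power (\<Sum>j<m. smul (a j (t k)) (g j)) A)"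
    if "\<forall>j<m. g j \<in> E" "s \<in> S" for g s A
    using *(3)[OF tensor_power_lin_comb[of m g] that(2), of A] that by (simp add: mult.commute)
  then show ?thesis using *(1,2) by blast
qed

text \<open>For \<open>x + smul s h\<close> the interpolation coefficients are polynomials in
  \<open>s\<close> alone. The difference of powers has the coefficients
  \<open>\<beta> k s - \<beta> k 0\<close>, small near \<open>s = 0\<close>, on vectors bounded
  uniformly in \<open>x\<close> and \<open>h\<close>.\<close>

lemma tensor_power_perturbation:
  assumes "\<epsilon> > 0"
  shows "\<exists>\<delta>>0. \<forall>x\<in>E. \<forall>h\<in>E. \<forall>s. norm x \<le> 1 \<longrightarrow> norm h \<le> 1 \<longrightarrow> norm s \<le> \<delta> \<longrightarrow>
    proj_norm (\<lambda>A. tensor_power (x + smul s h) A - tensor_power x A) \<le> \<epsilon>"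
proof -
  define a :: "nat \<Rightarrow> 'k \<Rightarrow> 'k" where "a j s = (if j = 0 then 1 else s)" for j s
  from tensor_power_interpolation[where S = "UNIV :: 'k set" and m = 2 and a = a]
  obtain r :: nat and t \<beta> where b: "\<And>k. k < r \<Longrightarrow> lin_comb (monomials 2 a N) UNIV (\<beta> k)"
    and eq': "\<forall>g s A. (\<forall>j<2. g j \<in> E) \<longrightarrow> s \<in> UNIV \<longrightarrow> tensor_power (\<Sum>j<2. smul (a j s) (g j)) A
      = (\<Sum>k<r. \<beta> k s * tensor_power (\<Sum>j<2. smul (a j (t k)) (g j)) A)"
    by blast
  have eq: "tensor_power (\<Sum>j<2. smul (a j s) (g j)) A
      = (\<Sum>k<r. \<beta> k s * tensor_power (\<Sum>j<2. smul (a j (t k)) (g j)) A)"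
    if "\<forall>j<2. g j \<in> E" for g s A
    by (rule eq'[rule_format]) (use that in auto)
  have sum2: "(\<Sum>j<2. smul (a j s) ((\<lambda>j. if j = 0 then x else h) j)) = x + smul s h" for s x h
    by (simp add: a_def numeral_2_eq_2)
  have expand: "tensor_power (x + smul s h) A = (\<Sum>k<r. \<beta> k s * tensor_power (x + smul (t k) h) A)"
    if "x \<in> E" "h \<in> E" for x h s A
    using eq[of "\<lambda>j. if j = 0 then x else h" s A] that unfolding sum2 by simp
  have cm: "continuous_on UNIV p" if "p \<in> monomials 2 a j" for p j
    using that
  proof (induction j arbitrary: p)
    case (Suc j)
    then obtain i p' where p: "p = (\<lambda>s. a i s * p' s)" "p' \<in> monomials 2 a j" by auto
    have "continuous_on UNIV (a i)" by (cases "i = 0") (auto simp: a_def[abs_def] intro: continuous_intros)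
    then show ?case unfolding p(1) by (rule continuous_on_mult[OF _ Suc.IH[OF p(2)]])
  qed auto
  have cb: "continuous_on UNIV (\<beta> k)" if k: "k < r" for k
  proof -
    obtain c where "\<And>s. \<beta> k s = (\<Sum>p\<in>monomials 2 a N. c p * p s)"
      using b[OF k] by (auto simp: lin_comb_def)
    then have "\<beta> k = (\<lambda>s. \<Sum>p\<in>monomials 2 a N. c p * p s)" by (rule ext)
    then show ?thesis by (auto intro!: continuous_on_sum continuous_on_mult[OF continuous_on_const cm])
  qed
  define err where "err s = (\<Sum>k<r. norm (\<beta> k s - \<beta> k 0) * (1 + norm (t k)) ^ N)" for s
  have "continuous_on UNIV err" unfolding err_def by (intro continuous_intros cb) auto
  then have "\<exists>\<delta>>0. \<forall>s. dist s 0 < \<delta> \<longrightarrow> dist (err s) (err 0) < \<epsilon>"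
    using assms unfolding continuous_on_iff by blast
  then obtain \<delta> where d: "\<delta> > 0" "\<And>s. norm s < \<delta> \<Longrightarrow> \<bar>err s\<bar> < \<epsilon>" by (auto simp: err_def)
  show ?thesis
  proof (intro exI[of _ "\<delta> / 2"] conjI ballI allI impI)
    show "\<delta> / 2 > 0" using d by simp
    fix x h and s :: 'k assume x: "x \<in> E" "norm x \<le> 1" and h: "h \<in> E" "norm h \<le> 1" and s: "norm s \<le> \<delta> / 2"
    have xh: "x + smul c h \<in> E" for c using x h by (intro add_E smul_E)
    have "(\<lambda>A. tensor_power (x + smul s h) A - tensor_power x A)
        = tensor_sum r (\<lambda>k. \<beta> k s - \<beta> k 0) (\<lambda>k. x + smul (t k) h)"
    proof
      fix A
      have "tensor_power x A = (\<Sum>k<r. \<beta> k 0 * tensor_power (x + smul (t k) h) A)"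
        using expand[OF x(1) h(1), of 0 A] by simp
      then show "tensor_power (x + smul s h) A - tensor_power x A
          = tensor_sum r (\<lambda>k. \<beta> k s - \<beta> k 0) (\<lambda>k. x + smul (t k) h) A"
        by (simp add: expand[OF x(1) h(1), of s A] tensor_sum_def left_diff_distrib sum_subtractf)
    qed
    then have "proj_norm (\<lambda>A. tensor_power (x + smul s h) A - tensor_power x A)
        \<le> (\<Sum>k<r. norm (\<beta> k s - \<beta> k 0) * norm (x + smul (t k) h) ^ N)"
      using proj_norm_tensor_sum_le[of r "\<lambda>k. x + smul (t k) h" "\<lambda>k. \<beta> k s - \<beta> k 0"] xh by simp
    also have "\<dots> \<le> err s"
      unfolding err_def
    proof (intro sum_mono mult_left_mono power_mono)
      fix k
      have "norm (x + smul (t k) h) \<le> norm x + norm (t k) * norm h"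
        using norm_triangle_ineq[of x "smul (t k) h"] by (simp add: norm_smul)
      also have "\<dots> \<le> 1 + norm (t k) * 1" using x h by (intro add_mono mult_left_mono) auto
      finally show "norm (x + smul (t k) h) \<le> 1 + norm (t k)" by simp
    qed auto
    also have "\<dots> \<le> \<epsilon>" using d(2)[of s] s d(1) by simp
    finally show "proj_norm (\<lambda>A. tensor_power (x + smul s h) A - tensor_power x A) \<le> \<epsilon>" .
  qed
qed

end

section \<open>Symmetric tensors over a dual space\<close>

locale dual_tensor =
  fixes scale :: "'k::rc_field \<Rightarrow> 'a::banach \<Rightarrow> 'a" and N :: nat
  assumes banach: "banach_space_over scale" and N_ge: "N \<ge> 1"
begin

abbreviation dual :: "('a \<Rightarrow>\<^sub>L 'k) set" where "dual \<equiv> dual_space scale"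

lemma dual_add: "f \<in> dual \<Longrightarrow> g \<in> dual \<Longrightarrow> f + g \<in> dual"
  by (simp add: dual_space_def blinfun.add_left algebra_simps)

sublocale sym_tensor_space N dual dual_scale
  by (intro sym_tensor_space.intro dual_banach(1)[OF banach] dual_banach(2)[OF banach]
      dual_banach(3)[OF banach] dual_banach(4)[OF banach] N_ge dual_add)

lemma dual_scale_apply: "blinfun_apply (dual_scale c f) x = c * blinfun_apply f x"
  by (simp add: dual_scale_def)

lemma scaleR_eq_dual_scale: "r *\<^sub>R f = dual_scale (of_real r) (f :: 'a \<Rightarrow>\<^sub>L 'k)"
  by (intro blinfun_eqI) (simp add: dual_scale_apply blinfun.scaleR_left scaleR_conv_of_real)

lemma scaleR_dual: "f \<in> dual \<Longrightarrow> r *\<^sub>R f \<in> dual"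
  by (simp add: scaleR_eq_dual_scale smul_E)

lemma diff_dual: "f \<in> dual \<Longrightarrow> g \<in> dual \<Longrightarrow> f - g \<in> dual"
  using dual_add[of f "(-1) *\<^sub>R g"] scaleR_dual[of g "-1"] by simp

text \<open>The polynomials \<open>\<Sum>j<r. b j * x j ^ N\<close> of finite type on the dual, as polynomials on all
  functions and as multilinear forms.\<close>

definition ftpoly :: "nat \<Rightarrow> (nat \<Rightarrow> 'k) \<Rightarrow> (nat \<Rightarrow> 'a) \<Rightarrow> ('a \<Rightarrow> 'k) \<Rightarrow> 'k" where
  "ftpoly r b x F = (\<Sum>j<r. b j * F (x j) ^ N)"

definition ftform :: "nat \<Rightarrow> (nat \<Rightarrow> 'k) \<Rightarrow> (nat \<Rightarrow> 'a) \<Rightarrow> ('a \<Rightarrow>\<^sub>L 'k) list \<Rightarrow> 'k" where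
  "ftform r b x fs = (\<Sum>j<r. b j * prod_list (map (\<lambda>f. blinfun_apply f (x j)) fs))"

lemma multilinear_ftform: "multilinear_form N dual dual_scale (ftform r b x)"
  unfolding multilinear_form_def
proof (intro allI impI)
  fix xs :: "('a \<Rightarrow>\<^sub>L 'k) list" and i f g c
  assume "length xs = N \<and> set xs \<subseteq> dual \<and> i < N \<and> f \<in> dual \<and> g \<in> dual"
  then have i: "i < length xs" by simp
  have "prod_list (map h (xs[i := v])) = prod_list (map h (take i xs)) * h v * prod_list (map h (drop (Suc i) xs))"
    for h :: "('a \<Rightarrow>\<^sub>L 'k) \<Rightarrow> 'k" and v
    by (simp add: upd_conv_take_nth_drop[OF i] mult.assoc)
  then show "ftform r b x (xs[i := dual_scale c f + g]) = c * ftform r b x (xs[i := f]) + ftform r b x (xs[i := g])"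
    unfolding ftform_def
    by (simp add: blinfun.add_left dual_scale_apply sum_distrib_left distrib_left distrib_right sum.distrib ac_simps)
qed

lemma tensor_power_ftform: "tensor_power f (ftform r b x) = ftpoly r b x (blinfun_apply f)"
  by (simp add: tensor_power_def tensor_def multilinear_ftform ftform_def ftpoly_def)

lemma tensor_sum_ftform:
  "tensor_sum n l f (ftform r b x) = (\<Sum>k<n. l k * ftpoly r b x (blinfun_apply (f k)))"
  by (simp add: tensor_sum_def tensor_power_ftform)

lemma ftform_scale: "tensor_sum n l f (ftform r (\<lambda>j. c * b j) x) = c * tensor_sum n l f (ftform r b x)"
  by (simp add: tensor_sum_ftform ftpoly_def sum_distrib_left mult.left_commute mult.assoc)

definition unit_ft :: "nat \<Rightarrow> (nat \<Rightarrow> 'k) \<Rightarrow> (nat \<Rightarrow> 'a) \<Rightarrow> bool" where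
  "unit_ft r b x \<longleftrightarrow> (\<forall>f\<in>dual. norm f \<le> 1 \<longrightarrow> norm (ftpoly r b x (blinfun_apply f)) \<le> 1)"

text \<open>The norm of a tensor as a functional on the polynomials of finite type.\<close>

definition dual_bound :: "((('a \<Rightarrow>\<^sub>L 'k) list \<Rightarrow> 'k) \<Rightarrow> 'k) \<Rightarrow> real \<Rightarrow> bool" where
  "dual_bound z \<theta> \<longleftrightarrow> (\<forall>r b x. unit_ft r b x \<longrightarrow> norm (z (ftform r b x)) \<le> \<theta>)"

lemma dual_bound_proj_norm:
  assumes z: "z \<in> sym_span" shows "dual_bound z (proj_norm z)"
  unfolding dual_bound_def
proof (intro allI impI)
  fix r b x assume u: "unit_ft r b x"
  obtain s0 where s0: "urep z s0" using span_urep'[OF z] by blast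
  show "norm (z (ftform r b x)) \<le> proj_norm z"
  proof (rule pn_ge'[OF s0])
    fix t assume "urep z t"
    then obtain n l f where t: "t = (\<Sum>k<n. norm (l k))" "z = tensor_sum n l f" "\<forall>k<n. f k \<in> dual \<and> norm (f k) = 1"
      unfolding urep_def' by blast
    have "norm (z (ftform r b x)) \<le> (\<Sum>k<n. norm (l k * ftpoly r b x (blinfun_apply (f k))))"
      unfolding t(2) tensor_sum_ftform by (rule norm_sum)
    also have "\<dots> \<le> (\<Sum>k<n. norm (l k) * 1)"
      using t(3) u unfolding unit_ft_def norm_mult by (intro sum_mono mult_left_mono) auto
    finally show "norm (z (ftform r b x)) \<le> t" by (simp add: t(1))
  qed
qed

text \<open>A unimodular factor can be absorbed into the coefficients \<open>b\<close>, so a bound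
  on real parts is a bound on absolute values.\<close>

lemma dual_bound_Re:
  assumes z: "z \<in> sym_span" and le: "\<And>r b x. unit_ft r b x \<Longrightarrow> scalar_Re (z (ftform r b x)) \<le> \<theta>"
  shows "dual_bound z \<theta>"
  unfolding dual_bound_def
proof (intro allI impI)
  fix r b x assume u: "unit_ft r b x"
  obtain c where c: "norm c = 1" "c * z (ftform r b x) = of_real (norm (z (ftform r b x)))"
    by (rule unimodular_rotation)
  have "unit_ft r (\<lambda>j. c * b j) x"
    using u c(1) unfolding unit_ft_def ftpoly_def
    by (simp add: mult.assoc norm_mult flip: sum_distrib_left)
  moreover obtain n l f where "z = tensor_sum n l f" using z unfolding sym_span_def by blast
  ultimately show "norm (z (ftform r b x)) \<le> \<theta>" using le[of r "\<lambda>j. c * b j" x] c by (simp add: ftform_scale)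
qed

text \<open>Functionals enter as plain functions, so the product topology restricts to the weak*
  topology. With the unimodular coordinate, the supremum of the real functions below is the supremum
  norm of the polynomial.\<close>

definition ball_points :: "('k \<times> ('a \<Rightarrow> 'k)) set" where
  "ball_points = {u. norm u = 1} \<times> blinfun_apply ` {f \<in> dual. norm f \<le> 1}"

definition poly_fun :: "nat \<Rightarrow> (nat \<Rightarrow> 'k) \<Rightarrow> (nat \<Rightarrow> 'a) \<Rightarrow> 'k \<times> ('a \<Rightarrow> 'k) \<Rightarrow> real" where
  "poly_fun r b x q = scalar_Re (fst q * ftpoly r b x (snd q))"

definition poly_funs :: "('k \<times> ('a \<Rightarrow> 'k) \<Rightarrow> real) set" where
  "poly_funs = {poly_fun r b x |r b x. True}"

lemma ball_pointsE:
  assumes "q \<in> ball_points"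
  obtains u f where "q = (u, blinfun_apply f)" "norm u = 1" "f \<in> dual" "norm f \<le> 1"
  using assms unfolding ball_points_def by auto

lemma ball_pointsI: "norm u = 1 \<Longrightarrow> f \<in> dual \<Longrightarrow> norm f \<le> 1 \<Longrightarrow> (u, blinfun_apply f) \<in> ball_points"
  unfolding ball_points_def by auto

text \<open>The first set on the right is compact by Tychonoff and the others are closed under
  pointwise convergence; this is the Banach-Alaoglu theorem.\<close>

lemma dual_ball_eq:
  "blinfun_apply ` {f \<in> dual. norm f \<le> 1} = {F. \<forall>x. norm (F x) \<le> norm x} \<inter>
    ({F. \<forall>x y. F (x + y) = F x + F y} \<inter> {F. \<forall>c x. F (scale c x) = c * F x})"
proof (intro equalityI subsetI)
  fix F assume "F \<in> blinfun_apply ` {f \<in> dual. norm f \<le> 1}"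
  then obtain f where f: "F = blinfun_apply f" "f \<in> dual" "norm f \<le> 1" by blast
  have "norm (F x) \<le> norm x" for x
    using norm_blinfun[of f x] f(1,3) mult_right_mono[of "norm f" 1 "norm x"] by simp
  then show "F \<in> {F. \<forall>x. norm (F x) \<le> norm x} \<inter>
    ({F. \<forall>x y. F (x + y) = F x + F y} \<inter> {F. \<forall>c x. F (scale c x) = c * F x})"
    using f by (simp add: dual_space_def blinfun.add_right)
next
  fix F assume F: "F \<in> {F. \<forall>x. norm (F x) \<le> norm x} \<inter>
    ({F. \<forall>x y. F (x + y) = F x + F y} \<inter> {F. \<forall>c x. F (scale c x) = c * F x})"
  have "F (r *\<^sub>R x) = r *\<^sub>R F x" for r x
    using F banach_space_over.scale_of_real[OF banach, of r x] by (simp add: scaleR_conv_of_real) metis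
  then have "bounded_linear F" using F by (intro bounded_linear_intro[where K = 1]) auto
  then have a: "blinfun_apply (Blinfun F) = F" by (rule bounded_linear_Blinfun_apply)
  have "norm (Blinfun F) \<le> 1" by (rule norm_blinfun_bound) (use F a in auto)
  moreover have "Blinfun F \<in> dual" using F a by (simp add: dual_space_def)
  ultimately show "F \<in> blinfun_apply ` {f \<in> dual. norm f \<le> 1}" using a by (metis (mono_tags, lifting) imageI mem_Collect_eq)
qed

lemma compact_ball_points: "compact ball_points"
proof -
  have "{u::'k. norm u = 1} = cball 0 1 \<inter> {u. norm u = 1}" by auto
  moreover have "closed {u::'k. norm u = 1}" by (intro closed_Collect_eq continuous_intros)
  ultimately have 1: "compact {u::'k. norm u = 1}" using compact_cball_rc_field compact_Int_closed by metis
  have c: "continuous_on UNIV (\<lambda>F::'a \<Rightarrow> 'k. F x)" for x by (rule continuous_on_product_coordinates)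
  have "closed {F::'a \<Rightarrow> 'k. F (x + y) = F x + F y}" for x y
    by (intro closed_Collect_eq continuous_on_add c)
  then have 2: "closed {F::'a \<Rightarrow> 'k. \<forall>x y. F (x + y) = F x + F y}" by (intro closed_Collect_all)
  have "closed {F::'a \<Rightarrow> 'k. F (scale c x) = c * F x}" for c x
    by (intro closed_Collect_eq continuous_on_mult continuous_on_const \<open>\<And>x. continuous_on UNIV (\<lambda>F. F x)\<close>)
  then have 3: "closed {F::'a \<Rightarrow> 'k. \<forall>c x. F (scale c x) = c * F x}" by (intro closed_Collect_all)
  show ?thesis
    unfolding ball_points_def dual_ball_eq
    by (intro compact_Times 1 compact_Int_closed compact_bounded_functions closed_Int 2 3)
qed

lemma unit_poly_fun:
  assumes "\<forall>q\<in>ball_points. \<bar>poly_fun r b x q\<bar> \<le> M"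
    and f: "f \<in> dual" "norm f \<le> 1"
  shows "norm (ftpoly r b x (blinfun_apply f)) \<le> M"
proof -
  obtain u where u: "norm u = 1"
    "u * ftpoly r b x (blinfun_apply f) = of_real (norm (ftpoly r b x (blinfun_apply f)))"
    by (rule unimodular_rotation)
  have "\<bar>poly_fun r b x (u, blinfun_apply f)\<bar> \<le> M" by (intro bspec[OF assms(1)] ball_pointsI u f)
  then show ?thesis by (simp add: poly_fun_def u(2))
qed

lemma poly_fun_add:
  "\<exists>r'' b'' x''. \<forall>q. poly_fun r b x q + poly_fun r' b' x' q = poly_fun r'' b'' x'' q"
proof -
  have "poly_fun r b x q + poly_fun r' b' x' q = poly_fun (r + r')
    (\<lambda>j. if j < r then b j else b' (j - r)) (\<lambda>j. if j < r then x j else x' (j - r)) q" for q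
    by (simp add: poly_fun_def ftpoly_def sum_lessThan_add distrib_left)
  then show ?thesis by blast
qed

lemma tensor_power_close:
  assumes "\<epsilon> > 0"
  shows "\<exists>\<delta>>0. \<forall>f\<in>dual. \<forall>g\<in>dual. norm f \<le> 1 \<longrightarrow> norm (g - f) \<le> \<delta> \<longrightarrow>
    proj_norm (\<lambda>A. tensor_power g A - tensor_power f A) \<le> \<epsilon>"
proof -
  obtain \<delta> where d: "\<delta> > 0" and *: "\<And>x h s. x \<in> dual \<Longrightarrow> h \<in> dual \<Longrightarrow> norm x \<le> 1 \<Longrightarrow> norm h \<le> 1 \<Longrightarrow>
      norm s \<le> \<delta> \<Longrightarrow> proj_norm (\<lambda>A. tensor_power (x + dual_scale s h) A - tensor_power x A) \<le> \<epsilon>"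
    using tensor_power_perturbation[OF assms] by blast
  have "proj_norm (\<lambda>A. tensor_power g A - tensor_power f A) \<le> \<epsilon>"
    if fg: "f \<in> dual" "g \<in> dual" "norm f \<le> 1" "norm (g - f) \<le> \<delta>" for f g
  proof -
    let ?h = "(1 / \<delta>) *\<^sub>R (g - f)"
    have "f + dual_scale (of_real \<delta>) ?h = g"
      using d by (simp flip: scaleR_eq_dual_scale)
    moreover have "norm ?h \<le> 1" using fg d by simp
    moreover have "?h \<in> dual" by (intro scaleR_dual diff_dual fg)
    ultimately show ?thesis using *[of f ?h "of_real \<delta>"] fg d by simp
  qed
  then show ?thesis using d by blast
qed

end

section \<open>Discretisation of tensors under the Radon-Nikodym property\<close>

locale rnp_dual_tensor = dual_tensor scale N for scale :: "'k::rc_field \<Rightarrow> 'a::banach \<Rightarrow> 'a" and N +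
  assumes rnp: "radon_nikodym_property TYPE('a \<Rightarrow>\<^sub>L 'k) (dual_space scale)"
begin

sublocale poly: fragmented_function_space ball_points poly_funs
proof
  show "compact ball_points" by (rule compact_ball_points)
  have "(1, blinfun_apply 0) \<in> ball_points" by (intro ball_pointsI) (auto simp: zero_E)
  then show "ball_points \<noteq> {}" by blast
  show "\<exists>U V. open U \<and> open V \<and> p \<in> U \<and> q \<in> V \<and> U \<inter> V = {}"
    if "p \<in> ball_points" "q \<in> ball_points" "p \<noteq> q" for p q :: "'k \<times> ('a \<Rightarrow> 'k)"
  proof (cases "fst p = fst q")
    case True
    then have "snd p \<noteq> snd q" using that by (auto simp: prod_eq_iff)
    then obtain U V where "open U" "open V" "snd p \<in> U" "snd q \<in> V" "U \<inter> V = {}"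
      using hausdorff_fun by metis
    then show ?thesis
      by - (rule exI[of _ "UNIV \<times> U"], rule exI[of _ "UNIV \<times> V"], auto simp: open_Times mem_Times_iff)
  next
    case False
    then obtain U V where "open U" "open V" "fst p \<in> U" "fst q \<in> V" "U \<inter> V = {}"
      using hausdorff by metis
    then show ?thesis
      by - (rule exI[of _ "U \<times> UNIV"], rule exI[of _ "V \<times> UNIV"], auto simp: open_Times mem_Times_iff)
  qed
  have "(\<lambda>_. 0) = poly_fun 0 b x" for b x by (simp add: poly_fun_def ftpoly_def fun_eq_iff)
  then show "(\<lambda>_. 0) \<in> poly_funs" unfolding poly_funs_def by blast
  show "(\<lambda>q. f q + g q) \<in> poly_funs" if fg: "f \<in> poly_funs" "g \<in> poly_funs" for f g
  proof -
    obtain r b x r' b' x' where "f = poly_fun r b x" "g = poly_fun r' b' x'"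
      using fg unfolding poly_funs_def by blast
    moreover obtain r'' b'' x'' where "\<And>q. poly_fun r b x q + poly_fun r' b' x' q = poly_fun r'' b'' x'' q"
      using poly_fun_add by blast
    ultimately have "(\<lambda>q. f q + g q) = poly_fun r'' b'' x''" by (simp add: fun_eq_iff)
    then show ?thesis unfolding poly_funs_def by blast
  qed
  show "(\<lambda>q. c * f q) \<in> poly_funs" if f: "f \<in> poly_funs" for f c
  proof -
    obtain r b x where "f = poly_fun r b x" using f unfolding poly_funs_def by blast
    then have "(\<lambda>q. c * f q) = poly_fun r (\<lambda>j. of_real c * b j) x"
      by (simp add: fun_eq_iff poly_fun_def ftpoly_def mult.assoc mult.left_commute[of _ "of_real c"] flip: sum_distrib_left)
    then show ?thesis unfolding poly_funs_def by blast
  qed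
  show "continuous_on ball_points f" if f: "f \<in> poly_funs" for f
  proof -
    obtain r b x where "f = poly_fun r b x" using f unfolding poly_funs_def by blast
    moreover have "continuous_on ball_points (\<lambda>q. snd q y)" for y :: 'a
      by (rule continuous_on_product_then_coordinatewise[OF continuous_on_snd[OF continuous_on_id]])
    then have "continuous_on ball_points (\<lambda>q. fst q * ftpoly r b x (snd q))"
      unfolding ftpoly_def by (intro continuous_intros) auto
    then have "continuous_on ball_points (\<lambda>q. scalar_Re (fst q * ftpoly r b x (snd q)))"
      by (rule bounded_linear.continuous_on[OF bounded_linear_scalar_Re])
    ultimately show ?thesis unfolding poly_fun_def[abs_def] by simp
  qed
  show "\<exists>q'\<in>ball_points. \<forall>f\<in>poly_funs. f q' = - f q" if q: "q \<in> ball_points" for q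
    using q by (elim ball_pointsE) (intro bexI[of _ "(- fst q, snd q)"];
      auto simp: poly_funs_def poly_fun_def intro!: ball_pointsI)
  show "\<exists>p\<in>L. \<exists>U. open U \<and> p \<in> U \<and>
      (\<forall>q\<in>L \<inter> U. \<forall>y\<in>poly_funs. (\<forall>q\<in>ball_points. \<bar>y q\<bar> \<le> 1) \<longrightarrow> \<bar>y q - y p\<bar> \<le> \<epsilon>)"
    if L: "L \<subseteq> ball_points" "L \<noteq> {}" and e: "\<epsilon> > 0" for L and \<epsilon> :: real
  proof -
    \<comment> \<open>One half of \<open>\<epsilon>\<close> is for the functional, through
      fragmentability of the projection \<open>D\<close> of \<open>L\<close>; the other is for the
      scalar, through a small ball around \<open>w\<close>.\<close>
    have "\<epsilon> / 2 > 0" using e by simp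
    from tensor_power_close[OF this] obtain \<delta> where d: "\<delta> > 0"
      and close: "\<And>f g. f \<in> dual \<Longrightarrow> g \<in> dual \<Longrightarrow> norm f \<le> 1 \<Longrightarrow> norm (g - f) \<le> \<delta> \<Longrightarrow>
        proj_norm (\<lambda>A. tensor_power g A - tensor_power f A) \<le> \<epsilon> / 2" by blast
    define D where "D = {f \<in> dual. norm f \<le> 1 \<and> (\<exists>u. (u, blinfun_apply f) \<in> L)}"
    have inD: "f \<in> D" if "(u, blinfun_apply f) \<in> L" for u f
    proof -
      have "(u, blinfun_apply f) \<in> ball_points" using that L by blast
      then show ?thesis using that unfolding D_def by (auto elim!: ball_pointsE simp: blinfun_apply_inject)
    qed
    have "D \<noteq> {}" using L inD by (metis all_not_in_conv ball_pointsE subset_iff)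
    moreover have "D \<subseteq> dual" "\<And>f. f \<in> D \<Longrightarrow> norm f \<le> 1" unfolding D_def by auto
    ultimately have "\<exists>p\<in>D. \<exists>U. open U \<and> blinfun_apply p \<in> U \<and>
        (\<forall>q\<in>D. blinfun_apply q \<in> U \<longrightarrow> norm (q - p) \<le> \<delta>)"
      by (intro rnp_imp_fragmented[OF rnp] d)
    then obtain p0 U0 where p0: "p0 \<in> D" and U0: "open U0" "blinfun_apply p0 \<in> U0"
      and near: "\<And>q. q \<in> D \<Longrightarrow> blinfun_apply q \<in> U0 \<Longrightarrow> norm (q - p0) \<le> \<delta>"
      by blast
    obtain w where w: "(w, blinfun_apply p0) \<in> L" using p0 by (auto simp: D_def)
    have p0': "p0 \<in> dual" "norm p0 \<le> 1" using p0 by (auto simp: D_def)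
    show ?thesis
    proof (intro bexI[OF _ w] exI[of _ "ball w (\<epsilon> / 2) \<times> U0"] conjI ballI impI)
      show "open (ball w (\<epsilon> / 2) \<times> U0)" using U0 by (intro open_Times) auto
      show "(w, blinfun_apply p0) \<in> ball w (\<epsilon> / 2) \<times> U0" using U0 e by simp
      fix q y assume q: "q \<in> L \<inter> ball w (\<epsilon> / 2) \<times> U0" and y: "y \<in> poly_funs" "\<forall>q\<in>ball_points. \<bar>y q\<bar> \<le> 1"
      have "q \<in> ball_points" using q L by blast
      then obtain u f where uf: "q = (u, blinfun_apply f)" "norm u = 1" "f \<in> dual" "norm f \<le> 1"
        by (rule ball_pointsE)
      have fD: "f \<in> D" using inD q uf by blast
      obtain r b x where yp: "y = poly_fun r b x" using y unfolding poly_funs_def by blast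
      have unit: "unit_ft r b x" unfolding unit_ft_def using unit_poly_fun y(2) yp by blast
      have w1: "norm w = 1" using w L unfolding ball_points_def by auto
      have "norm (f - p0) \<le> \<delta>" using near[OF fD] q uf by auto
      then have c: "proj_norm (\<lambda>A. tensor_power f A - tensor_power p0 A) \<le> \<epsilon> / 2"
        by (rule close[OF p0'(1) uf(3) p0'(2)])
      have ts: "tensor_power g = tensor_sum 1 (\<lambda>_. 1) (\<lambda>_. g)" for g by (simp add: tensor_sum_def fun_eq_iff)
      \<comment> \<open>Norm closeness of \<open>f\<close> and \<open>p0\<close> bounds the
        difference of their powers in the projective norm, which controls all unit polynomials at
        once.\<close>
      have "(\<lambda>A. tensor_power f A - tensor_power p0 A) \<in> sym_span"
        unfolding ts using uf p0' by (intro tensor_diff_span tensor_sum_span) auto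
      from dual_bound_proj_norm[OF this, unfolded dual_bound_def, rule_format, OF unit] c
      have 1: "norm (ftpoly r b x (blinfun_apply f) - ftpoly r b x (blinfun_apply p0)) \<le> \<epsilon> / 2"
        unfolding tensor_power_ftform by (rule order_trans)
      have 2: "norm (ftpoly r b x (blinfun_apply f)) \<le> 1" using unit uf unfolding unit_ft_def by blast
      have "y q - y (w, blinfun_apply p0) = scalar_Re ((u - w) * ftpoly r b x (blinfun_apply f)
          + w * (ftpoly r b x (blinfun_apply f) - ftpoly r b x (blinfun_apply p0)))"
        unfolding yp poly_fun_def uf(1) by (simp flip: scalar_Re_diff scalar_Re_add) (simp add: algebra_simps)
      also have "\<bar>\<dots>\<bar> \<le> norm ((u - w) * ftpoly r b x (blinfun_apply f)
          + w * (ftpoly r b x (blinfun_apply f) - ftpoly r b x (blinfun_apply p0)))"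
        by (rule abs_scalar_Re_le)
      also have "\<dots> \<le> norm (u - w) * norm (ftpoly r b x (blinfun_apply f))
          + norm w * norm (ftpoly r b x (blinfun_apply f) - ftpoly r b x (blinfun_apply p0))"
        by (metis norm_mult norm_triangle_ineq)
      also have "\<dots> \<le> \<epsilon> / 2 * 1 + 1 * (\<epsilon> / 2)"
        using q uf(1) e by (intro add_mono mult_mono 1 2) (auto simp: w1 dist_norm norm_minus_commute)
      finally show "\<bar>y q - y (w, blinfun_apply p0)\<bar> \<le> \<epsilon>" by simp
    qed
  qed
qed

text \<open>Tensors and finite sums of point evaluations on \<open>ball_points\<close> are translated into each other by
  splitting a scalar into its modulus and its phase.\<close>

lemma tensor_to_points:
  assumes "\<And>k. k < n \<Longrightarrow> x k \<in> dual \<and> norm (x k) \<le> 1"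
  shows "\<exists>d p. (\<forall>k<n. p k \<in> ball_points) \<and>
    (\<forall>r b y. scalar_Re (tensor_sum n l x (ftform r b y)) = (\<Sum>k<n. d k * poly_fun r b y (p k)))"
proof -
  have "\<exists>u. norm u = 1 \<and> l k = of_real (norm (l k)) * u" for k
  proof -
    obtain u where u: "norm u = 1" "u * l k = of_real (norm (l k))" by (rule unimodular_rotation)
    then have "u \<noteq> 0" by auto
    then have "l k = (u * l k) * inverse u" by simp
    then show ?thesis using u by (intro exI[of _ "inverse u"]) (simp add: norm_inverse)
  qed
  then obtain u where u: "\<And>k. norm (u k) = 1" "\<And>k. l k = of_real (norm (l k)) * u k" by metis
  show ?thesis
  proof (intro exI conjI allI impI)
    show "(u k, blinfun_apply (x k)) \<in> ball_points" if "k < n" for k using assms[OF that] u by (intro ball_pointsI) auto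
    show "scalar_Re (tensor_sum n l x (ftform r b y))
        = (\<Sum>k<n. norm (l k) * poly_fun r b y (u k, blinfun_apply (x k)))" for r b y
      unfolding tensor_sum_ftform scalar_Re_sum
    proof (rule sum.cong)
      fix k
      show "scalar_Re (l k * ftpoly r b y (blinfun_apply (x k))) = norm (l k) * poly_fun r b y (u k, blinfun_apply (x k))"
        by (subst u(2)) (simp add: poly_fun_def mult.assoc)
    qed simp
  qed
qed

lemma points_to_tensor:
  fixes n :: nat
  assumes "\<forall>k<n. 0 \<le> c k \<and> q k \<in> ball_points"
  shows "\<exists>l x. (\<forall>k<n. x k \<in> dual \<and> norm (x k) \<le> 1) \<and> (\<Sum>k<n. norm (l k)) = (\<Sum>k<n. c k) \<and>
    (\<forall>r b y. scalar_Re (tensor_sum n l x (ftform r b y)) = (\<Sum>k<n. c k * poly_fun r b y (q k)))"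
proof -
  have "\<exists>u f. q k = (u, blinfun_apply f) \<and> norm u = 1 \<and> f \<in> dual \<and> norm f \<le> 1" if "k < n" for k
  proof -
    have "q k \<in> ball_points" using assms that by blast
    then show ?thesis by (rule ball_pointsE) blast
  qed
  then obtain u f where uf: "\<And>k. k < n \<Longrightarrow> q k = (u k, blinfun_apply (f k)) \<and> norm (u k) = 1 \<and> f k \<in> dual \<and> norm (f k) \<le> 1"
    by metis
  show ?thesis
  proof (intro exI conjI allI impI)
    show "f k \<in> dual" "norm (f k) \<le> 1" if "k < n" for k using uf that by blast+
    show "(\<Sum>k<n. norm (of_real (c k) * u k)) = (\<Sum>k<n. c k)"
      using assms uf by (intro sum.cong) (auto simp: norm_mult)
    show "scalar_Re (tensor_sum n (\<lambda>k. of_real (c k) * u k) f (ftform r b y)) = (\<Sum>k<n. c k * poly_fun r b y (q k))"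
      for r b y
      unfolding tensor_sum_ftform scalar_Re_sum
      by (intro sum.cong) (auto simp: uf poly_fun_def mult.assoc)
  qed
qed

lemma unit_poly_funs:
  assumes "y \<in> poly_funs" "\<forall>q\<in>ball_points. \<bar>y q\<bar> \<le> 1"
  obtains r b x where "y = poly_fun r b x" "unit_ft r b x"
  using assms unit_poly_fun unfolding poly_funs_def unit_ft_def by blast

lemma abs_poly_fun_le: "unit_ft r b x \<Longrightarrow> q \<in> ball_points \<Longrightarrow> \<bar>poly_fun r b x q\<bar> \<le> 1"
  by (elim ball_pointsE) (auto simp: poly_fun_def unit_ft_def norm_mult intro!: order_trans[OF abs_scalar_Re_le])

lemma dual_bound_points:
  assumes z: "z \<in> sym_span" and x: "\<And>k. k < n \<Longrightarrow> x k \<in> dual"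
    and zd: "\<And>r b y. scalar_Re (z (ftform r b y)) = (\<Sum>i<m. d i * poly_fun r b y (p i))"
    and wd: "\<And>r b y. scalar_Re (tensor_sum n l x (ftform r b y)) = (\<Sum>k<n. c k * poly_fun r b y (q k))"
    and close: "\<forall>y\<in>poly_funs. (\<forall>q\<in>ball_points. \<bar>y q\<bar> \<le> 1) \<longrightarrow>
      \<bar>(\<Sum>i<m. d i * y (p i)) - (\<Sum>k<n. c k * y (q k))\<bar> \<le> \<epsilon>"
  shows "dual_bound (\<lambda>A. z A - tensor_sum n l x A) \<epsilon>"
proof (rule dual_bound_Re)
  show "(\<lambda>A. z A - tensor_sum n l x A) \<in> sym_span" by (intro tensor_diff_span z tensor_sum_span x)
  fix r b y assume u: "unit_ft r b y"
  have "poly_fun r b y \<in> poly_funs" unfolding poly_funs_def by blast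
  with close abs_poly_fun_le[OF u]
  have "\<bar>(\<Sum>i<m. d i * poly_fun r b y (p i)) - (\<Sum>k<n. c k * poly_fun r b y (q k))\<bar> \<le> \<epsilon>" by blast
  then show "scalar_Re (z (ftform r b y) - tensor_sum n l x (ftform r b y)) \<le> \<epsilon>" by (simp add: zd wd)
qed

text \<open>The new coefficients are bounded by the functional norm \<open>\<theta>\<close>, however
  large the given representation of \<open>z\<close> is. This is what makes the procedure worth
  iterating.\<close>

lemma discretise_tensor:
  assumes z: "z \<in> sym_span" "dual_bound z \<theta>" and "\<theta> > 0" "\<epsilon> > 0"
  shows "\<exists>n l x. (\<forall>k<n. x k \<in> dual \<and> norm (x k) \<le> 1) \<and> (\<Sum>k<n. norm (l k)) \<le> \<theta> \<and>
    dual_bound (\<lambda>A. z A - tensor_sum n l x A) \<epsilon>"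
proof -
  obtain m l0 x0 where z0: "z = tensor_sum m l0 x0" "\<forall>k<m. x0 k \<in> dual \<and> norm (x0 k) = 1"
    using span_unit_form[OF z(1)] by blast
  have "\<exists>d p. (\<forall>k<m. p k \<in> ball_points) \<and>
    (\<forall>r b y. scalar_Re (z (ftform r b y)) = (\<Sum>k<m. d k * poly_fun r b y (p k)))"
    unfolding z0(1) by (rule tensor_to_points) (use z0 in auto)
  then obtain d p where p: "\<And>k. k < m \<Longrightarrow> p k \<in> ball_points"
    and zd: "\<And>r b y. scalar_Re (z (ftform r b y)) = (\<Sum>k<m. d k * poly_fun r b y (p k))"
    by blast
  have le: "(\<Sum>i<m. d i * y (p i)) \<le> \<theta>" if y: "y \<in> poly_funs" "\<And>q. q \<in> ball_points \<Longrightarrow> \<bar>y q\<bar> \<le> 1" for y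
  proof -
    obtain r b x where "y = poly_fun r b x" "unit_ft r b x" using unit_poly_funs y by metis
    then have "norm (z (ftform r b x)) \<le> \<theta>" "(\<Sum>i<m. d i * y (p i)) = scalar_Re (z (ftform r b x))"
      using z(2) zd by (auto simp: dual_bound_def)
    then show ?thesis using abs_scalar_Re_le[of "z (ftform r b x)"] by linarith
  qed
  have "\<exists>(n::nat) c q. (\<forall>k<n. 0 \<le> c k \<and> q k \<in> ball_points) \<and> (\<Sum>k<n. c k) \<le> \<theta> \<and>
    (\<forall>y\<in>poly_funs. (\<forall>q\<in>ball_points. \<bar>y q\<bar> \<le> 1) \<longrightarrow>
      \<bar>(\<Sum>i<m. d i * y (p i)) - (\<Sum>k<n. c k * y (q k))\<bar> \<le> \<epsilon>)"
    by (rule poly.approximate_functional[where m = m and p = p and d = d, OF _ \<open>\<theta> > 0\<close> \<open>\<epsilon> > 0\<close>])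
       (use p le in auto)
  then obtain n :: nat and c q where c: "\<forall>k<n. 0 \<le> c k \<and> q k \<in> ball_points" "(\<Sum>k<n. c k) \<le> \<theta>"
    and close: "\<forall>y\<in>poly_funs. (\<forall>q\<in>ball_points. \<bar>y q\<bar> \<le> 1) \<longrightarrow>
      \<bar>(\<Sum>i<m. d i * y (p i)) - (\<Sum>k<n. c k * y (q k))\<bar> \<le> \<epsilon>"
    by blast
  obtain l x where lx: "\<And>k. k < n \<Longrightarrow> x k \<in> dual \<and> norm (x k) \<le> 1" "(\<Sum>k<n. norm (l k)) = (\<Sum>k<n. c k)"
    and wd: "\<And>r b y. scalar_Re (tensor_sum n l x (ftform r b y)) = (\<Sum>k<n. c k * poly_fun r b y (q k))"
    using points_to_tensor[OF c(1)] by blast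
  have "dual_bound (\<lambda>A. z A - tensor_sum n l x A) \<epsilon>"
    by (rule dual_bound_points[OF z(1) _ zd wd close]) (use lx in blast)
  then show ?thesis using lx c(2) by (intro exI[of _ n] exI[of _ l] exI[of _ x]) simp
qed

text \<open>All weights are nonnegative and sit at points where \<open>y0 = 1\<close>, so the
  pairing with \<open>y0\<close> returns the full sum of the weights, and no other representation of
  the tensor can be cheaper.\<close>

lemma attaining_tensor:
  assumes z: "z \<in> sym_span" and "\<epsilon> > 0"
  shows "\<exists>n l x. (\<forall>k<n. x k \<in> dual \<and> norm (x k) \<le> 1) \<and> proj_norm (tensor_sum n l x) = (\<Sum>k<n. norm (l k)) \<and>
    dual_bound (\<lambda>A. z A - tensor_sum n l x A) \<epsilon>"
proof -
  obtain m l0 x0 where z0: "z = tensor_sum m l0 x0" "\<forall>k<m. x0 k \<in> dual \<and> norm (x0 k) = 1"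
    using span_unit_form[OF z(1)] by blast
  have "\<exists>d p. (\<forall>k<m. p k \<in> ball_points) \<and>
    (\<forall>r b y. scalar_Re (z (ftform r b y)) = (\<Sum>k<m. d k * poly_fun r b y (p k)))"
    unfolding z0(1) by (rule tensor_to_points) (use z0 in auto)
  then obtain d p where p: "\<And>k. k < m \<Longrightarrow> p k \<in> ball_points"
    and zd: "\<And>r b y. scalar_Re (z (ftform r b y)) = (\<Sum>k<m. d k * poly_fun r b y (p k))"
    by blast
  have "\<exists>(n::nat) c q y0. (\<forall>k<n. 0 \<le> c k \<and> q k \<in> ball_points \<and> y0 (q k) = 1) \<and>
    (\<forall>\<delta>>0. \<exists>y\<in>poly_funs. \<forall>q\<in>ball_points. \<bar>y q - y0 q\<bar> \<le> \<delta>) \<and> (\<forall>q\<in>ball_points. \<bar>y0 q\<bar> \<le> 1) \<and>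
    (\<forall>y\<in>poly_funs. (\<forall>q\<in>ball_points. \<bar>y q\<bar> \<le> 1) \<longrightarrow>
      \<bar>(\<Sum>i<m. d i * y (p i)) - (\<Sum>k<n. c k * y (q k))\<bar> \<le> \<epsilon>)"
    by (rule poly.approximate_functional_attaining[where m = m and p = p and d = d, OF _ \<open>\<epsilon> > 0\<close>]) (rule p)
  then obtain n :: nat and c q y0 where c: "\<forall>k<n. 0 \<le> c k \<and> q k \<in> ball_points \<and> y0 (q k) = 1"
    and unif: "\<forall>\<delta>>0. \<exists>y\<in>poly_funs. \<forall>q\<in>ball_points. \<bar>y q - y0 q\<bar> \<le> \<delta>"
    and y0: "\<forall>q\<in>ball_points. \<bar>y0 q\<bar> \<le> 1"
    and close: "\<forall>y\<in>poly_funs. (\<forall>q\<in>ball_points. \<bar>y q\<bar> \<le> 1) \<longrightarrow>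
      \<bar>(\<Sum>i<m. d i * y (p i)) - (\<Sum>k<n. c k * y (q k))\<bar> \<le> \<epsilon>"
    by (elim exE conjE)
  have c': "\<forall>k<n. 0 \<le> c k \<and> q k \<in> ball_points" using c by blast
  obtain l x where lx: "\<And>k. k < n \<Longrightarrow> x k \<in> dual \<and> norm (x k) \<le> 1" "(\<Sum>k<n. norm (l k)) = (\<Sum>k<n. c k)"
    and wd: "\<And>r b y. scalar_Re (tensor_sum n l x (ftform r b y)) = (\<Sum>k<n. c k * poly_fun r b y (q k))"
    using points_to_tensor[OF c'] by blast
  let ?w = "tensor_sum n l x"
  let ?C = "\<Sum>k<n. c k"
  have C0: "?C \<ge> 0" using c by (intro sum_nonneg) auto
  have xd: "\<And>k. k < n \<Longrightarrow> x k \<in> dual" using lx by blast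
  \<comment> \<open>\<open>y0\<close> is only a limit of polynomials, so it is replaced by a
    polynomial \<open>y\<close> that is at least \<open>1 - \<delta>\<close> at each
    \<open>q k\<close> and bounded by \<open>1 + \<delta>\<close> on the ball; both representations
    of the tensor are paired with it.\<close>
  have "?C \<le> t" if t: "urep ?w t" for t
  proof (rule field_le_epsilon)
    fix e :: real assume e: "e > 0"
    obtain n' l' x' where t': "t = (\<Sum>k<n'. norm (l' k))" "?w = tensor_sum n' l' x'"
      "\<forall>k<n'. x' k \<in> dual \<and> norm (x' k) = 1" using t unfolding urep_def' by blast
    have t0: "t \<ge> 0" unfolding t'(1) by (rule sum_nonneg) simp
    \<comment> \<open>Chosen so that \<open>\<delta> * (?C + t) \<le> e\<close>; the summand 1 keeps
      the denominator positive.\<close>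
    define \<delta> where "\<delta> = e / (?C + t + 1)"
    have d: "\<delta> > 0" unfolding \<delta>_def using e C0 t0 by simp
    obtain y where y: "y \<in> poly_funs" "\<And>q. q \<in> ball_points \<Longrightarrow> \<bar>y q - y0 q\<bar> \<le> \<delta>" using unif d by blast
    obtain r b a where ya: "y = poly_fun r b a" using y(1) unfolding poly_funs_def by blast
    have "\<forall>q\<in>ball_points. \<bar>poly_fun r b a q\<bar> \<le> 1 + \<delta>"
      using y(2) y0 unfolding ya by (smt (verit, best))
    note bound = unit_poly_fun[OF this]
    have "(\<Sum>k<n. c k * (1 - \<delta>)) \<le> (\<Sum>k<n. c k * y (q k))"
    proof (rule sum_mono)
      fix k assume k: "k \<in> {..<n}"
      have "\<bar>y (q k) - y0 (q k)\<bar> \<le> \<delta>" "y0 (q k) = 1" using y(2)[of "q k"] c k by auto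
      then show "c k * (1 - \<delta>) \<le> c k * y (q k)" using c k by (intro mult_left_mono) auto
    qed
    also have "\<dots> = scalar_Re (?w (ftform r b a))" using wd ya by simp
    also have "\<dots> \<le> norm (?w (ftform r b a))" using abs_scalar_Re_le[of "?w (ftform r b a)"] by linarith
    also have "\<dots> \<le> (\<Sum>k<n'. norm (l' k * ftpoly r b a (blinfun_apply (x' k))))"
      unfolding t'(2) tensor_sum_ftform by (rule norm_sum)
    also have "\<dots> \<le> (\<Sum>k<n'. norm (l' k) * (1 + \<delta>))"
      unfolding norm_mult using t'(3) by (intro sum_mono mult_left_mono bound) auto
    also have "\<dots> = t * (1 + \<delta>)" by (simp add: t'(1) sum_distrib_right)
    finally have "?C * (1 - \<delta>) \<le> t * (1 + \<delta>)" by (simp add: sum_distrib_right)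
    then have "?C \<le> t + \<delta> * (?C + t)" by (simp add: algebra_simps)
    also have "\<delta> * (?C + t) \<le> e" unfolding \<delta>_def using e C0 t0 by (simp add: field_simps)
    finally show "?C \<le> t + e" by simp
  qed
  moreover have "\<exists>s. urep ?w s" using urep_tensor_sum xd by blast
  ultimately have "?C \<le> proj_norm ?w" using pn_ge' by blast
  moreover have "proj_norm ?w \<le> ?C" using proj_norm_tensor_sum_ball_le[of n x l] lx by auto
  moreover have "dual_bound (\<lambda>A. z A - ?w A) \<epsilon>"
    by (rule dual_bound_points[OF z xd zd wd close])
  ultimately show ?thesis using lx by (intro exI[of _ n] exI[of _ l] exI[of _ x]) simp
qed

end

section \<open>Null sequences and vanishing power series\<close>

lemma compact_insert_range:
  fixes f :: "nat \<Rightarrow> 'b::topological_space"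
  assumes "f \<longlonglongrightarrow> l" shows "compact (insert l (range f))"
proof (rule compactI)
  fix \<C> assume C: "\<forall>U\<in>\<C>. open U" "insert l (range f) \<subseteq> \<Union>\<C>"
  then obtain U where U: "U \<in> \<C>" "l \<in> U" by blast
  then obtain n where n: "\<And>i. i \<ge> n \<Longrightarrow> f i \<in> U"
    using topological_tendstoD[OF assms, of U] C(1) unfolding eventually_sequentially by blast
  have "\<forall>i. \<exists>V\<in>\<C>. f i \<in> V" using C(2) by blast
  then obtain V where V: "\<And>i. V i \<in> \<C>" "\<And>i. f i \<in> V i" by metis
  have "f i \<in> \<Union>(insert U (V ` {..<n}))" for i using n[of i] V(2)[of i] by (cases "i < n") auto
  then show "\<exists>\<C>'\<subseteq>\<C>. finite \<C>' \<and> insert l (range f) \<subseteq> \<Union>\<C>'"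
    using U V(1) by (intro exI[of _ "insert U (V ` {..<n})"]) auto
qed

text \<open>By the binomial theorem the sum is a polynomial in \<open>t\<close>, whose coefficients
  are absolutely convergent series. It vanishes identically, so its linear coefficient,
  \<open>M\<close> times the series in question, is 0.\<close>

lemma sums_linear_coefficient:
  fixes \<kappa> s r :: "nat \<Rightarrow> 'k::rc_field"
  assumes k: "summable (\<lambda>i. norm (\<kappa> i))" and R: "\<And>i. norm (s i) \<le> R" "\<And>i. norm (r i) \<le> R" and M: "M \<ge> 1"
    and zero: "\<And>t. (\<lambda>i. \<kappa> i * (s i + t * r i) ^ M) sums 0"
  shows "(\<lambda>i. \<kappa> i * s i ^ (M - 1) * r i) sums 0"
proof -
  have R0: "0 \<le> R" using R(1)[of 0] norm_ge_zero order_trans by blast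
  have summ: "summable (\<lambda>i. \<kappa> i * (of_nat (M choose m) * r i ^ m * s i ^ (M - m)))" if "m \<le> M" for m
  proof (rule summable_norm_cancel, rule summable_comparison_test')
    show "summable (\<lambda>i. norm (\<kappa> i) * (real (M choose m) * R ^ M))" by (intro summable_mult2 k)
    fix i
    have "norm (r i) ^ m * norm (s i) ^ (M - m) \<le> R ^ m * R ^ (M - m)"
      by (intro mult_mono power_mono R) (use R0 in auto)
    also have "\<dots> = R ^ M" using that by (simp flip: power_add)
    finally have "norm (\<kappa> i) * (real (M choose m) * (norm (r i) ^ m * norm (s i) ^ (M - m)))
        \<le> norm (\<kappa> i) * (real (M choose m) * R ^ M)" by (intro mult_left_mono) auto
    then show "norm (norm (\<kappa> i * (of_nat (M choose m) * r i ^ m * s i ^ (M - m)))) \<le> norm (\<kappa> i) * (real (M choose m) * R ^ M)"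
      by (simp add: norm_mult norm_power mult.assoc)
  qed
  define c where "c m = (\<Sum>i. \<kappa> i * (of_nat (M choose m) * r i ^ m * s i ^ (M - m)))" for m
  have "(\<Sum>m\<le>M. c m * t ^ m) = 0" for t
  proof -
    have "(\<lambda>i. \<Sum>m\<le>M. (\<kappa> i * (of_nat (M choose m) * r i ^ m * s i ^ (M - m))) * t ^ m) sums (\<Sum>m\<le>M. c m * t ^ m)"
      unfolding c_def by (intro sums_sum sums_mult2 summable_sums summ) auto
    moreover have "(\<Sum>m\<le>M. (\<kappa> i * (of_nat (M choose m) * r i ^ m * s i ^ (M - m))) * t ^ m) = \<kappa> i * (s i + t * r i) ^ M" for i
      by (subst add.commute, subst binomial_ring) (simp add: sum_distrib_left power_mult_distrib ac_simps)
    ultimately show ?thesis using zero[of t] sums_unique2 by fastforce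
  qed
  then have "c 1 = 0" using Transcendental.polyfun_eq_0[where n = M and c = c] M by blast
  then have "(\<lambda>i. of_nat M * (\<kappa> i * s i ^ (M - 1) * r i)) sums (of_nat M * 0)"
    using summable_sums[OF summ[OF M]] by (simp add: c_def ac_simps)
  then show ?thesis using M by (subst (asm) sums_mult_iff) auto
qed

section \<open>Seminorm rules for the projective norm\<close>

context sym_tensor_space
begin

lemma proj_norm_zero_dist: "proj_norm z = proj_dist z (\<lambda>_. 0)"
  by (simp add: proj_dist_def)

lemma tensor_sum_add_span: "z \<in> sym_span \<Longrightarrow> w \<in> sym_span \<Longrightarrow> (\<lambda>A. z A + w A) \<in> sym_span"
  using tensor_diff_span[of z "\<lambda>A. 0 - w A"] tensor_diff_span[OF zero_span, of w] by simp

lemma proj_norm_add: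
  assumes z: "z \<in> sym_span" and w: "w \<in> sym_span"
  shows "proj_norm (\<lambda>A. z A + w A) \<le> proj_norm z + proj_norm w"
proof -
  obtain s t where s: "urep z s" and t: "urep w t" using span_urep' z w by blast
  have "proj_norm (\<lambda>A. z A + w A) - t' \<le> proj_norm z" if "urep w t'" for t'
    using pn_le'[OF urep_add'[OF _ that]] by (intro pn_ge'[OF s]) (simp add: diff_le_eq)
  then have "proj_norm (\<lambda>A. z A + w A) - proj_norm z \<le> proj_norm w"
    by (intro pn_ge'[OF t]) (simp add: diff_le_eq add.commute)
  then show ?thesis by simp
qed

lemma tensor_sum_scale: "(\<lambda>A. c * tensor_sum n l x A) = tensor_sum n (\<lambda>k. c * l k) x"
  by (simp add: tensor_sum_def sum_distrib_left mult.assoc fun_eq_iff)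

lemma scale_span: "z \<in> sym_span \<Longrightarrow> (\<lambda>A. c * z A) \<in> sym_span"
  using tensor_sum_scale unfolding sym_span_def by (auto, metis)

lemma proj_norm_scale:
  assumes z: "z \<in> sym_span" shows "proj_norm (\<lambda>A. c * z A) \<le> norm c * proj_norm z"
proof (cases "c = 0")
  case True
  then show ?thesis using pn_le'[OF urep_0'] by simp
next
  case False
  obtain s where s: "urep z s" using span_urep' z by blast
  have "proj_norm (\<lambda>A. c * z A) / norm c \<le> proj_norm z"
  proof (rule pn_ge'[OF s])
    fix t assume "urep z t"
    then obtain n l x where t: "t = (\<Sum>k<n. norm (l k))" "z = tensor_sum n l x" "\<forall>k<n. x k \<in> E \<and> norm (x k) = 1"
      unfolding urep_def' by blast
    then have "urep (\<lambda>A. c * z A) (norm c * t)"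
      unfolding urep_def' t(2) tensor_sum_scale
      by (intro exI[of _ n] exI[of _ "\<lambda>k. c * l k"] exI[of _ x]) (simp add: norm_mult sum_distrib_left)
    from pn_le'[OF this] show "proj_norm (\<lambda>A. c * z A) / norm c \<le> t"
      using False by (simp add: divide_le_eq mult.commute)
  qed
  then show ?thesis using False by (simp add: divide_le_eq mult.commute)
qed

lemma weighted_sum_span: "(\<And>k. k < (n::nat) \<Longrightarrow> z k \<in> sym_span) \<Longrightarrow> (\<lambda>A. \<Sum>k<n. l k * z k A) \<in> sym_span"
  by (induction n) (simp_all add: zero_span tensor_sum_add_span scale_span)

lemma proj_norm_weighted_sum:
  fixes n :: nat
  assumes "\<And>k. k < n \<Longrightarrow> z k \<in> sym_span"
  shows "proj_norm (\<lambda>A. \<Sum>k<n. l k * z k A) \<le> (\<Sum>k<n. norm (l k) * proj_norm (z k))"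
  using assms
proof (induction n)
  case 0 then show ?case using pn_le'[OF urep_0'] by simp
next
  case (Suc n)
  have "proj_norm (\<lambda>A. (\<Sum>k<n. l k * z k A) + l n * z n A)
      \<le> proj_norm (\<lambda>A. \<Sum>k<n. l k * z k A) + proj_norm (\<lambda>A. l n * z n A)"
    using Suc.prems by (intro proj_norm_add weighted_sum_span scale_span) auto
  also have "\<dots> \<le> (\<Sum>k<n. norm (l k) * proj_norm (z k)) + norm (l n) * proj_norm (z n)"
    using Suc by (intro add_mono proj_norm_scale) auto
  finally show ?case by simp
qed

lemma tensor_power_span: "x \<in> E \<Longrightarrow> tensor_power x \<in> sym_span"
  using tensor_sum_span[of 1 "\<lambda>_. x" "\<lambda>_. 1"] by (simp add: tensor_sum_def)

end

section \<open>Null series and the approximation property\<close>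

context dual_tensor
begin

text \<open>Interpolation, applied to the range of \<open>T\<close> as a space of functions on the
  predual, takes the values of \<open>T f\<close> at finitely many points as coordinates. In this
  form they are bounded and linear in \<open>f\<close> as soon as \<open>T\<close> is.\<close>

lemma finite_rank_coordinates:
  assumes TE: "\<And>f. f \<in> dual \<Longrightarrow> T f \<in> dual" and B: "finite B" "T ` dual \<subseteq> module.span dual_scale B"
  shows "\<exists>(m::nat) y g. (\<forall>j<m. g j \<in> dual) \<and>
    (\<forall>f\<in>dual. T f = (\<Sum>j<m. dual_scale (blinfun_apply (T f) (y j)) (g j)))"
proof -
  \<comment> \<open>\<open>B\<close> may leave the dual, so it is exchanged for a basis of the
    range, which lies inside.\<close>
  obtain C where C: "C \<subseteq> T ` dual" "independent C" "T ` dual \<subseteq> local.span C"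
    using maximal_independent_subset[of "T ` dual"] by blast
  have fC: "finite C" using independent_span_bound[OF B(1) C(2)] C(1) B(2) by auto
  have Cd: "C \<subseteq> dual" using C(1) TE by blast
  have app_sum: "blinfun_apply (\<Sum>b\<in>C. dual_scale (u b) b) y = (\<Sum>b\<in>C. u b * blinfun_apply b y)" for u y
    by (induction C rule: infinite_finite_induct) (simp_all add: blinfun.add_left dual_scale_apply)
  have lc: "lin_comb (blinfun_apply ` C) UNIV (blinfun_apply (T f))" if f: "f \<in> dual" for f
  proof -
    have "T f \<in> local.span C" using C(3) f by blast
    then obtain u where "T f = (\<Sum>b\<in>C. dual_scale (u b) b)"
      unfolding span_finite[OF fC] by (rule imageE)
    then have "blinfun_apply (T f) = (\<lambda>y. \<Sum>b\<in>C. u b * blinfun_apply b y)" by (simp add: app_sum fun_eq_iff)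
    then show ?thesis using fC by (auto intro!: lin_comb_sum lin_comb_scale lin_comb_member)
  qed
  obtain m :: nat and y h where *: "\<And>j. j < m \<Longrightarrow> lin_comb (blinfun_apply ` C) UNIV (h j)"
    "\<And>F s. lin_comb (blinfun_apply ` C) UNIV F \<Longrightarrow> F s = (\<Sum>j<m. F (y j) * h j s)"
    using interpolation[OF finite_imageI[OF fC, of blinfun_apply], where S = UNIV] by (metis UNIV_I)
  have "\<exists>g\<in>dual. h j = blinfun_apply g" if j: "j < m" for j
  proof -
    obtain c where c: "\<And>s. h j s = (\<Sum>F\<in>blinfun_apply ` C. c F * F s)"
      using *(1)[OF j] by (auto simp: lin_comb_def)
    have "inj_on blinfun_apply C" by (simp add: inj_on_def blinfun_apply_inject)
    then have "h j s = (\<Sum>b\<in>C. c (blinfun_apply b) * blinfun_apply b s)" for s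
      unfolding c by (simp add: sum.reindex)
    then have "h j = blinfun_apply (\<Sum>b\<in>C. dual_scale (c (blinfun_apply b)) b)" by (simp add: app_sum fun_eq_iff)
    moreover have "(\<Sum>b\<in>C. dual_scale (c (blinfun_apply b)) b) \<in> dual" using Cd by (intro sum_E smul_E) auto
    ultimately show ?thesis by blast
  qed
  then obtain g where g: "\<And>j. j < m \<Longrightarrow> g j \<in> dual" "\<And>j. j < m \<Longrightarrow> h j = blinfun_apply (g j)" by metis
  have app: "blinfun_apply (\<Sum>j<m. dual_scale (c j) (g j)) s = (\<Sum>j<m. c j * blinfun_apply (g j) s)" for c s and m :: nat
    by (induction m) (simp_all add: blinfun.add_left dual_scale_apply)
  have "T f = (\<Sum>j<m. dual_scale (blinfun_apply (T f) (y j)) (g j))" if "f \<in> dual" for f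
  proof (rule blinfun_eqI)
    fix s
    show "blinfun_apply (T f) s = blinfun_apply (\<Sum>j<m. dual_scale (blinfun_apply (T f) (y j)) (g j)) s"
      unfolding app using *(2)[OF lc[OF that], of s] g(2) by simp
  qed
  then show ?thesis using g(1) by blast
qed

text \<open>Polarisation in one slot at a time: \<open>x i y ^ (N - j)\<close> is linearised in one factor, whose
  evaluation at points is then replaced by the functional \<open>a\<close>; this needs only that \<open>a\<close> is continuous
  in norm, not in the weak* topology.\<close>

lemma sums_monomials:
  fixes l :: "nat \<Rightarrow> 'k" and x :: "nat \<Rightarrow> ('a \<Rightarrow>\<^sub>L 'k)"
  assumes x: "\<And>i. x i \<in> dual" "\<And>i. norm (x i) \<le> 1" and l: "summable (\<lambda>i. norm (l i))"
    and zero: "\<And>y. (\<lambda>i. l i * blinfun_apply (x i) y ^ N) sums 0"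
    and a_lin: "\<And>j f g. f \<in> dual \<Longrightarrow> g \<in> dual \<Longrightarrow> a j (f + g) = a j f + a j g"
      "\<And>j c f. f \<in> dual \<Longrightarrow> a j (dual_scale c f) = c * a j f"
    and a_bd: "\<And>j f. f \<in> dual \<Longrightarrow> norm (a j f) \<le> C j * norm f"
  shows "j \<le> N \<Longrightarrow> p \<in> monomials m a j \<Longrightarrow>
    (\<exists>K. \<forall>f\<in>dual. norm f \<le> 1 \<longrightarrow> norm (p f) \<le> K) \<and>
    (\<forall>y. (\<lambda>i. l i * p (x i) * blinfun_apply (x i) y ^ (N - j)) sums 0)"
proof (induction j arbitrary: p)
  case 0
  then show ?case using zero by (auto intro!: exI[of _ 1])
next
  case (Suc j)
  then obtain i0 p0 where p: "p = (\<lambda>f. a i0 f * p0 f)" "p0 \<in> monomials m a j" by auto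
  obtain K where K: "\<And>f. f \<in> dual \<Longrightarrow> norm f \<le> 1 \<Longrightarrow> norm (p0 f) \<le> K"
    and IH: "\<And>y. (\<lambda>i. l i * p0 (x i) * blinfun_apply (x i) y ^ (N - j)) sums 0"
    using Suc.IH[OF _ p(2)] Suc.prems(1) by auto
  have "norm (p0 0) \<le> K" by (rule K) (simp_all add: zero_E)
  then have K0: "0 \<le> K" using norm_ge_zero[of "p0 0"] by linarith
  have a_ball: "norm (a i0 f) \<le> \<bar>C i0\<bar>" if "f \<in> dual" "norm f \<le> 1" for f
  proof -
    have "C i0 * norm f \<le> \<bar>C i0\<bar> * 1" using that by (intro mult_mono) auto
    then show ?thesis using a_bd[OF that(1), of i0] by simp
  qed
  have bound: "norm (p f) \<le> \<bar>C i0\<bar> * K" if "f \<in> dual" "norm f \<le> 1" for f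
    unfolding p(1) norm_mult using a_ball[OF that] K[OF that] by (intro mult_mono) auto
  define M where "M = N - j"
  have M: "M \<ge> 1" "N - Suc j = M - 1" using Suc.prems(1) by (auto simp: M_def)
  have "(\<lambda>i. l i * p (x i) * blinfun_apply (x i) y ^ (M - 1)) sums 0" for y
  proof -
    define \<kappa> where "\<kappa> i = l i * p0 (x i)" for i
    have xy: "norm (blinfun_apply (x i) z) \<le> norm z" for i z
      using norm_blinfun[of "x i" z] x(2)[of i] mult_right_mono[of "norm (x i)" 1 "norm z"] by simp
    have sk: "summable (\<lambda>i. norm (\<kappa> i))"
    proof (rule summable_comparison_test')
      show "summable (\<lambda>i. norm (l i) * K)" by (intro summable_mult2 l)
      show "norm (norm (\<kappa> i)) \<le> norm (l i) * K" for i
        using K[OF x(1,2)] by (simp add: \<kappa>_def norm_mult mult_left_mono)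
    qed
    \<comment> \<open>With \<open>y + scale t z\<close> in place of \<open>y\<close> the vanishing
      sum is a polynomial in \<open>t\<close>; its linear coefficient frees one factor, evaluated at
      the independent point \<open>z\<close>.\<close>
    have lincoef: "(\<lambda>i. \<kappa> i * blinfun_apply (x i) y ^ (M - 1) * blinfun_apply (x i) z) sums 0" for z
    proof (rule sums_linear_coefficient[OF sk _ _ M(1)])
      show "norm (blinfun_apply (x i) y) \<le> norm y + norm z" for i using xy[of i y] norm_ge_zero[of z] by linarith
      show "norm (blinfun_apply (x i) z) \<le> norm y + norm z" for i using xy[of i z] norm_ge_zero[of y] by linarith
      show "(\<lambda>i. \<kappa> i * (blinfun_apply (x i) y + t * blinfun_apply (x i) z) ^ M) sums 0" for t
      proof -
        have "blinfun_apply (x i) (y + scale t z) = blinfun_apply (x i) y + t * blinfun_apply (x i) z" for i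
          using x(1)[of i] by (simp add: dual_space_def blinfun.add_right)
        then show ?thesis using IH[of "y + scale t z"] by (simp add: \<kappa>_def M_def)
      qed
    qed
    define \<mu> where "\<mu> i = \<kappa> i * blinfun_apply (x i) y ^ (M - 1)" for i
    have "norm (\<mu> i) \<le> norm (\<kappa> i) * norm y ^ (M - 1)" for i
      unfolding \<mu>_def norm_mult norm_power by (intro mult_left_mono power_mono xy) auto
    then have smu: "summable (\<lambda>i. norm (\<mu> i))"
      by (intro summable_comparison_test'[OF summable_mult2[OF sk]]) auto
    have "summable (\<lambda>i. norm (dual_scale (\<mu> i) (x i)))"
      by (rule summable_comparison_test'[OF smu, of 0]) (use x(2) in \<open>simp add: norm_smul mult_left_le\<close>)
    then have "summable (\<lambda>i. dual_scale (\<mu> i) (x i))" by (rule summable_norm_cancel)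
    then obtain v where v: "(\<lambda>i. dual_scale (\<mu> i) (x i)) sums v" by (auto simp: summable_def)
    \<comment> \<open>The series of functionals converges in norm and its sum vanishes at every
      \<open>z\<close>. Norm convergence then allows \<open>a i0\<close> to be applied term by
      term.\<close>
    have "v = 0"
    proof (rule blinfun_eqI)
      fix z
      have "(\<lambda>i. blinfun_apply (dual_scale (\<mu> i) (x i)) z) sums blinfun_apply v z"
        by (rule bounded_linear.sums[OF blinfun.bounded_linear_left v])
      then show "blinfun_apply v z = blinfun_apply 0 z"
        using lincoef[of z] sums_unique2 by (fastforce simp: dual_scale_apply \<mu>_def)
    qed
    define V where "V n = (\<Sum>i<n. dual_scale (\<mu> i) (x i))" for n
    have V0: "V \<longlonglongrightarrow> 0" using v \<open>v = 0\<close> unfolding sums_def V_def by simp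
    have Vd: "V n \<in> dual" for n unfolding V_def by (intro sum_E smul_E x)
    have a0: "a i0 0 = 0" using a_lin(2)[OF zero_E, of i0 0] by simp
    have aV: "a i0 (V n) = (\<Sum>i<n. \<mu> i * a i0 (x i))" for n
    proof (induction n)
      case 0 then show ?case by (simp add: V_def a0)
    next
      case (Suc n)
      have "V (Suc n) = V n + dual_scale (\<mu> n) (x n)" by (simp add: V_def)
      then show ?case using Suc by (simp add: a_lin Vd x smul_E)
    qed
    have "(\<lambda>n. a i0 (V n)) \<longlonglongrightarrow> 0"
    proof (rule Lim_null_comparison)
      show "\<forall>\<^sub>F n in sequentially. norm (a i0 (V n)) \<le> C i0 * norm (V n)"
        by (intro always_eventually allI a_bd Vd)
      show "(\<lambda>n. C i0 * norm (V n)) \<longlonglongrightarrow> 0"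
        using tendsto_mult[OF tendsto_const tendsto_norm[OF V0], of "C i0"] by simp
    qed
    then have "(\<lambda>i. \<mu> i * a i0 (x i)) sums 0" unfolding sums_def aV .
    moreover have "\<mu> i * a i0 (x i) = l i * p (x i) * blinfun_apply (x i) y ^ (M - 1)" for i
      by (simp add: \<mu>_def \<kappa>_def p(1))
    ultimately show ?thesis by simp
  qed
  then show ?case using bound M(2) by auto
qed

text \<open>Rescaling makes \<open>x\<close> a null sequence, so that the approximation property replaces it, with a small
  error in the projective norm, by its image under a finite-rank operator; there the series is a
  finite-dimensional one with vanishing coefficients.\<close>

lemma null_series_small:
  fixes l :: "nat \<Rightarrow> 'k" and x :: "nat \<Rightarrow> ('a \<Rightarrow>\<^sub>L 'k)"
  assumes ap: "approximation_property dual (dual_scale :: 'k \<Rightarrow> ('a \<Rightarrow>\<^sub>L 'k) \<Rightarrow> _)"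
    and x: "\<And>i. x i \<in> dual" "\<And>i. norm (x i) \<le> 1" and l: "summable (\<lambda>i. norm (l i))"
    and zero: "\<And>y. (\<lambda>i. l i * blinfun_apply (x i) y ^ N) sums 0" and e: "\<epsilon> > 0"
  shows "\<exists>n0. \<forall>n\<ge>n0. proj_norm (tensor_sum n l x) \<le> \<epsilon>"
proof -
  obtain r where r: "\<And>i. 1 \<le> r i" "filterlim r at_top sequentially" "summable (\<lambda>i. norm (l i) * r i)"
    by (rule rescaling_sequence[of "\<lambda>i. norm (l i)"]) (use l in auto)
  define l' where "l' i = l i * of_real (r i)" for i
  \<comment> \<open>The weights \<open>r i\<close> tend to infinity, so taking their
    \<open>N\<close>-th roots out of \<open>x\<close> leaves a null sequence; by \<open>tp\<close>
    the weighted powers do not change.\<close>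
  define x' where "x' i = root N (1 / r i) *\<^sub>R x i" for i
  have rootp: "root N (1 / r i) ^ N = 1 / r i" for i
    using r(1)[of i] N_pos by (intro real_root_pow_pos2) auto
  have root1: "0 \<le> root N (1 / r i)" "root N (1 / r i) \<le> 1" for i
    using r(1)[of i] N_pos by auto
  have x'd: "x' i \<in> dual" for i unfolding x'_def by (intro scaleR_dual x)
  have x'1: "norm (x' i) \<le> 1" for i
    using root1[of i] x(2)[of i] by (simp add: x'_def mult_le_one)
  have nl': "norm (l' i) = norm (l i) * r i" for i using r(1)[of i] by (simp add: l'_def norm_mult)
  have l'_sum: "summable (\<lambda>i. norm (l' i))" unfolding nl' by (rule r(3))
  have tp: "l' i * tensor_power (x' i) A = l i * tensor_power (x i) A" for i A
  proof -
    have "tensor_power (x' i) A = of_real (root N (1 / r i)) ^ N * tensor_power (x i) A"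
      unfolding x'_def scaleR_eq_dual_scale by (rule tensor_power_smul'[OF x(1)])
    also have "of_real (root N (1 / r i)) ^ N = (of_real (1 / r i) :: 'k)" by (simp only: rootp flip: of_real_power)
    finally show ?thesis using r(1)[of i] by (simp add: l'_def)
  qed
  have zero': "(\<lambda>i. l' i * blinfun_apply (x' i) y ^ N) sums 0" for y
  proof -
    have "l' i * blinfun_apply (x' i) y ^ N = l i * blinfun_apply (x i) y ^ N" for i
    proof -
      have "blinfun_apply (x' i) y ^ N = of_real (root N (1 / r i)) ^ N * blinfun_apply (x i) y ^ N"
        by (simp add: x'_def blinfun.scaleR_left scaleR_conv_of_real power_mult_distrib)
      also have "of_real (root N (1 / r i)) ^ N = (of_real (1 / r i) :: 'k)" by (simp only: rootp flip: of_real_power)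
      finally show ?thesis using r(1)[of i] by (simp add: l'_def)
    qed
    then show ?thesis using zero by simp
  qed
  have x'0: "x' \<longlonglongrightarrow> 0"
  proof (rule Lim_null_comparison)
    have "(\<lambda>i. 1 / r i) \<longlonglongrightarrow> 0"
      using r(2) by (intro tendsto_divide_0[OF tendsto_const] filterlim_at_top_imp_at_infinity)
    from tendsto_real_root[OF this, of N] show "(\<lambda>i. root N (1 / r i)) \<longlonglongrightarrow> 0" by simp
    show "\<forall>\<^sub>F i in sequentially. norm (x' i) \<le> root N (1 / r i)"
      using x(2) root1 by (intro always_eventually allI) (simp add: x'_def mult_left_le)
  qed
  define L where "L = (\<Sum>i. norm (l' i)) + 1"
  have L0: "L > 0" unfolding L_def using suminf_nonneg[OF l'_sum] by simp
  have Lsum: "(\<Sum>i<n. norm (l' i)) \<le> L" for n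
    unfolding L_def using sum_le_suminf[OF l'_sum, of "{..<n}"] by simp
  have "\<epsilon> / (2 * L) > 0" using e L0 by simp
  from tensor_power_close[OF this] obtain \<delta> where d: "\<delta> > 0"
    and close: "\<And>f g. f \<in> dual \<Longrightarrow> g \<in> dual \<Longrightarrow> norm f \<le> 1 \<Longrightarrow> norm (g - f) \<le> \<delta> \<Longrightarrow>
        proj_norm (\<lambda>A. tensor_power g A - tensor_power f A) \<le> \<epsilon> / (2 * L)" by blast
  let ?K = "insert 0 (range x')"
  have "?K \<subseteq> dual" "compact ?K" using x'd zero_E compact_insert_range[OF x'0] by auto
  with ap[unfolded approximation_property_def, THEN spec[of _ ?K], THEN spec[of _ \<delta>]] d
  obtain T where T': "\<forall>f\<in>dual. T f \<in> dual" "\<forall>f\<in>dual. \<forall>g\<in>dual. T (f + g) = T f + T g"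
      "\<forall>c. \<forall>f\<in>dual. T (dual_scale c f) = dual_scale c (T f)"
    and Tbd: "\<exists>C. \<forall>f\<in>dual. norm (T f) \<le> C * norm f"
    and Tfin: "\<exists>B. finite B \<and> T ` dual \<subseteq> module.span dual_scale B"
    and Tclose: "\<forall>f\<in>?K. norm (T f - f) \<le> \<delta>"
    by auto
  have T: "T f \<in> dual" "T (f + g) = T f + T g" "T (dual_scale c f) = dual_scale c (T f)"
    if "f \<in> dual" "g \<in> dual" for f g c using T' that by blast+
  have Td: "f \<in> dual \<Longrightarrow> T f \<in> dual" for f using T'(1) by blast
  obtain C where C: "\<And>f. f \<in> dual \<Longrightarrow> norm (T f) \<le> C * norm f" using Tbd by blast
  obtain B where B: "finite B" "T ` dual \<subseteq> module.span dual_scale B" using Tfin by blast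
  from finite_rank_coordinates[OF Td B]
  obtain m :: nat and y g where g: "\<And>j. j < m \<Longrightarrow> g j \<in> dual"
    and Tg: "\<And>f. f \<in> dual \<Longrightarrow> T f = (\<Sum>j<m. dual_scale (blinfun_apply (T f) (y j)) (g j))"
    by blast
  define a where "a j f = blinfun_apply (T f) (y j)" for j f
  \<comment> \<open>The \<open>a j\<close> are the coordinates of \<open>T f\<close>, so every power
    of a \<open>T f\<close> is a combination of finitely many fixed powers \<open>P k\<close>, with
    scalar coefficients \<open>\<beta> k f\<close>.\<close>
  from tensor_power_interpolation[where S = dual and m = m and a = a]
  obtain s :: nat and t \<beta> where t: "\<forall>k<s. t k \<in> dual \<and> lin_comb (monomials m a N) dual (\<beta> k)"
    and int: "\<forall>g f A. (\<forall>j<m. g j \<in> dual) \<longrightarrow> f \<in> dual \<longrightarrow> tensor_power (\<Sum>j<m. dual_scale (a j f) (g j)) A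
      = (\<Sum>k<s. \<beta> k f * tensor_power (\<Sum>j<m. dual_scale (a j (t k)) (g j)) A)"
    by blast
  define P where "P k = (\<Sum>j<m. dual_scale (a j (t k)) (g j))" for k
  have Pd: "P k \<in> dual" for k unfolding P_def by (intro sum_E smul_E g) simp
  have TP: "tensor_power (T f) A = (\<Sum>k<s. \<beta> k f * tensor_power (P k) A)" if "f \<in> dual" for f A
    using int[THEN spec[of _ g], THEN spec[of _ f], THEN spec[of _ A]] g that Tg[OF that] by (simp add: a_def P_def)
  have mono: "(\<lambda>i. l' i * p (x' i)) sums 0" if "p \<in> monomials m a N" for p
  proof -
    \<comment> \<open>At \<open>j = N\<close> all evaluations at points have been exchanged for the
      \<open>a j\<close>, and the remaining power has exponent 0.\<close>
    have "\<forall>y. (\<lambda>i. l' i * p (x' i) * blinfun_apply (x' i) y ^ (N - N)) sums 0"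
    proof (rule sums_monomials[where C = "\<lambda>j. C * norm (y j)",
          OF x'd x'1 l'_sum zero' _ _ _ order_refl that, THEN conjunct2])
      show "a j (f + g) = a j f + a j g" if "f \<in> dual" "g \<in> dual" for j f g
        using that by (simp add: a_def T blinfun.add_left)
      show "a j (dual_scale c f) = c * a j f" if "f \<in> dual" for j c f
        using T'(3) that by (simp add: a_def dual_scale_apply)
      show "norm (a j f) \<le> C * norm (y j) * norm f" if "f \<in> dual" for j f
      proof -
        have "norm (a j f) \<le> norm (T f) * norm (y j)" unfolding a_def by (rule norm_blinfun)
        also have "\<dots> \<le> (C * norm f) * norm (y j)" by (intro mult_right_mono C that) simp
        finally show ?thesis by (simp add: ac_simps)
      qed
    qed
    then show ?thesis by simp
  qed
  have beta: "(\<lambda>i. l' i * \<beta> k (x' i)) sums 0" if k: "k < s" for k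
  proof -
    obtain c where c: "\<And>f. f \<in> dual \<Longrightarrow> \<beta> k f = (\<Sum>p\<in>monomials m a N. c p * p f)"
      using t k unfolding lin_comb_def by blast
    have "(\<lambda>i. \<Sum>p\<in>monomials m a N. c p * (l' i * p (x' i))) sums (\<Sum>p\<in>monomials m a N. c p * 0)"
      by (intro sums_sum sums_mult mono)
    moreover have "(\<Sum>p\<in>monomials m a N. c p * (l' i * p (x' i))) = l' i * \<beta> k (x' i)" for i
      by (simp add: c[OF x'd] sum_distrib_left mult.left_commute)
    ultimately show ?thesis by simp
  qed
  define D where "D n = (\<Sum>k<s. norm (\<Sum>i<n. l' i * \<beta> k (x' i)) * norm (P k) ^ N)" for n
  have "D \<longlonglongrightarrow> (\<Sum>k<s. norm (0::'k) * norm (P k) ^ N)"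
    unfolding D_def using beta unfolding sums_def
    by (intro tendsto_sum tendsto_mult tendsto_norm tendsto_const) auto
  then have "\<forall>\<^sub>F n in sequentially. D n < \<epsilon> / 2" using e by (intro order_tendstoD(2)) auto
  then obtain n0 where n0: "\<And>n. n \<ge> n0 \<Longrightarrow> D n < \<epsilon> / 2" unfolding eventually_sequentially by blast
  have "proj_norm (tensor_sum n l x) \<le> \<epsilon>" if "n \<ge> n0" for n
  proof -
    \<comment> \<open>Two parts: the error of passing from \<open>x' i\<close> to
      \<open>T (x' i)\<close>, at most \<open>\<epsilon> / (2 * L)\<close> per unit of mass, and a
      combination of the \<open>P k\<close> whose coefficients tend to 0.\<close>
    have eq1: "tensor_sum n l x = (\<lambda>A. (\<Sum>i<n. (- l' i) * (tensor_power (T (x' i)) A - tensor_power (x' i) A))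
        + (\<Sum>i<n. l' i * tensor_power (T (x' i)) A))"
      unfolding tensor_sum_def by (simp add: tp right_diff_distrib sum_subtractf sum_negf fun_eq_iff)
    have eq2: "(\<lambda>A. \<Sum>i<n. l' i * tensor_power (T (x' i)) A)
        = tensor_sum s (\<lambda>k. \<Sum>i<n. l' i * \<beta> k (x' i)) P"
    proof
      fix A
      have "(\<Sum>i<n. l' i * tensor_power (T (x' i)) A) = (\<Sum>i<n. \<Sum>k<s. (l' i * \<beta> k (x' i)) * tensor_power (P k) A)"
        by (simp add: TP[OF x'd] sum_distrib_left mult.assoc)
      also have "\<dots> = tensor_sum s (\<lambda>k. \<Sum>i<n. l' i * \<beta> k (x' i)) P A"
        by (subst sum.swap) (simp add: tensor_sum_def sum_distrib_right)
      finally show "(\<Sum>i<n. l' i * tensor_power (T (x' i)) A) = tensor_sum s (\<lambda>k. \<Sum>i<n. l' i * \<beta> k (x' i)) P A" .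
    qed
    have span1: "(\<lambda>A. tensor_power (T (x' i)) A - tensor_power (x' i) A) \<in> sym_span" for i
      by (intro tensor_diff_span tensor_power_span Td x'd)
    have "proj_norm (\<lambda>A. \<Sum>i<n. (- l' i) * (tensor_power (T (x' i)) A - tensor_power (x' i) A))
        \<le> (\<Sum>i<n. norm (- l' i) * proj_norm (\<lambda>A. tensor_power (T (x' i)) A - tensor_power (x' i) A))"
      by (rule proj_norm_weighted_sum) (rule span1)
    also have "\<dots> \<le> (\<Sum>i<n. norm (- l' i) * (\<epsilon> / (2 * L)))"
      by (intro sum_mono mult_left_mono close x'd x'1 Td bspec[OF Tclose]) auto
    also have "\<dots> = (\<Sum>i<n. norm (l' i)) * (\<epsilon> / (2 * L))"
      by (simp only: norm_minus_cancel sum_distrib_right)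
    also have "\<dots> \<le> L * (\<epsilon> / (2 * L))" using e L0 by (intro mult_right_mono Lsum) auto
    also have "\<dots> = \<epsilon> / 2" using L0 by simp
    finally have 1: "proj_norm (\<lambda>A. \<Sum>i<n. (- l' i) * (tensor_power (T (x' i)) A - tensor_power (x' i) A)) \<le> \<epsilon> / 2" .
    have 2: "proj_norm (\<lambda>A. \<Sum>i<n. l' i * tensor_power (T (x' i)) A) \<le> \<epsilon> / 2"
      unfolding eq2 using proj_norm_tensor_sum_le[of s P "\<lambda>k. \<Sum>i<n. l' i * \<beta> k (x' i)"] Pd n0[OF that]
      by (simp add: D_def)
    have "proj_norm (tensor_sum n l x) \<le> proj_norm (\<lambda>A. \<Sum>i<n. (- l' i) * (tensor_power (T (x' i)) A - tensor_power (x' i) A))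
        + proj_norm (\<lambda>A. \<Sum>i<n. l' i * tensor_power (T (x' i)) A)"
      unfolding eq1 by (intro proj_norm_add weighted_sum_span span1 tensor_power_span Td x'd)
    then show ?thesis using 1 2 by simp
  qed
  then show ?thesis by blast
qed

end

section \<open>Approximation by norm-attaining tensors\<close>

text \<open>Blocks of varying length are spread over the pairs \<open>(k, i)\<close>, padded with
  zeros, and enumerated by the pairing function; absolute summability makes the order of summation
  immaterial.\<close>

lemma sums_prod_decode:
  fixes h :: "nat \<times> nat \<Rightarrow> 'b::banach" and n :: "nat \<Rightarrow> nat"
  assumes supp: "\<And>k i. n k \<le> i \<Longrightarrow> h (k, i) = 0"
    and bd: "\<And>K. (\<Sum>k<K. \<Sum>i<n k. norm (h (k, i))) \<le> C"
  shows "summable (\<lambda>j. norm (h (prod_decode j)))" "(\<Sum>j<m. norm (h (prod_decode j))) \<le> C"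
    and "(\<lambda>k. \<Sum>i<n k. h (k, i)) sums s \<Longrightarrow> (\<lambda>j. h (prod_decode j)) sums s"
proof -
  have fin: "(\<Sum>p\<in>F. norm (h p)) \<le> C" if F: "finite F" for F
  proof -
    obtain K where K: "fst ` F \<subseteq> {..<K}"
      using finite_nat_bounded[OF finite_imageI[OF F, of fst]] by blast
    let ?S = "Sigma {..<K} (\<lambda>k. {..<n k})"
    have "(\<Sum>p\<in>F. norm (h p)) = (\<Sum>p\<in>F \<inter> ?S. norm (h p))"
    proof (rule sum.mono_neutral_right[OF F], blast, rule ballI)
      fix p assume p: "p \<in> F - F \<inter> ?S"
      then have "fst p < K" using K by auto
      then have "n (fst p) \<le> snd p" using p by (cases p) auto
      then show "norm (h p) = 0" using supp[of "fst p" "snd p"] by simp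
    qed
    also have "\<dots> \<le> (\<Sum>p\<in>?S. norm (h p))" by (rule sum_mono2) auto
    also have "\<dots> = (\<Sum>k<K. \<Sum>i<n k. norm (h (k, i)))" by (simp add: sum.Sigma)
    finally show ?thesis using bd[of K] by simp
  qed
  show part: "(\<Sum>j<m. norm (h (prod_decode j))) \<le> C" for m
    using fin[of "prod_decode ` {..<m}"] inj_prod_decode[of "{..<m}"] by (simp add: sum.reindex)
  show "summable (\<lambda>j. norm (h (prod_decode j)))"
    by (rule summableI_nonneg_bounded[of _ C]) (use part in auto)
  have "(\<lambda>p. norm (h p)) summable_on UNIV"
    by (rule nonneg_bdd_above_summable_on) (use fin in \<open>auto simp: bdd_above_def intro!: exI[of _ C]\<close>)
  then have "h summable_on UNIV" by (rule abs_summable_summable)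
  then obtain t where t: "(h has_sum t) UNIV" by (auto simp: summable_on_def)
  then have dec: "(\<lambda>j. h (prod_decode j)) sums t"
    using has_sum_reindex_bij_betw[OF bij_prod_decode, of h t] by (intro has_sum_imp_sums) simp
  have inner: "((\<lambda>i. h (k, i)) has_sum (\<Sum>i<n k. h (k, i))) UNIV" for k
    by (rule has_sum_finite_neutralI[of "{..<n k}"]) (auto simp: supp)
  then have "((\<lambda>k. \<Sum>i<n k. h (k, i)) has_sum t) UNIV"
    using t by (intro has_sum_SigmaD[where f = h and S = t and B = "\<lambda>_. UNIV", OF _ inner]) simp
  then have "(\<lambda>k. \<Sum>i<n k. h (k, i)) sums t" by (rule has_sum_imp_sums)
  then show "(\<lambda>j. h (prod_decode j)) sums s" if "(\<lambda>k. \<Sum>i<n k. h (k, i)) sums s"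
    using dec sums_unique2[OF that] by simp
qed

context rnp_dual_tensor
begin

text \<open>Remainders are discretised again and again: step \<open>k\<close> has mass at most
  \<open>\<theta> / 2 ^ k\<close> and leaves a remainder of functional norm at most half of that.
  Remainders are known to vanish only as functionals on polynomials, so the conclusion speaks of
  powers of single vectors \<open>y\<close> and not of convergence of tensors.\<close>

lemma exact_series:
  assumes z: "z \<in> sym_span" "dual_bound z \<theta>" and th: "\<theta> > 0"
  shows "\<exists>l x. (\<forall>j. x j \<in> dual \<and> norm (x j) \<le> 1) \<and> summable (\<lambda>j. norm (l j)) \<and>
    (\<forall>m. (\<Sum>j<m. norm (l j)) \<le> 2 * \<theta>) \<and>
    (\<forall>y. (\<lambda>j. l j * blinfun_apply (x j) y ^ N) sums z (ftform 1 (\<lambda>_. 1) (\<lambda>_. y)))"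
proof -
  let ?ok = "\<lambda>z k. z \<in> sym_span \<and> dual_bound z (\<theta> / 2 ^ k)"
  define good where "good z k n l x \<longleftrightarrow> (\<forall>i<n. x i \<in> dual \<and> norm (x i) \<le> 1) \<and>
      (\<Sum>i<n. norm (l i)) \<le> \<theta> / 2 ^ k \<and> ?ok (\<lambda>A. z A - tensor_sum n l x A) (Suc k)" for z k n l x
  have "\<exists>n l x. good z k n l x" if "?ok z k" for z k
  proof -
    have "\<theta> / 2 ^ k > 0" "\<theta> / 2 ^ Suc k > 0" using th by auto
    from discretise_tensor[OF _ _ this, of z] that obtain n l x where
      *: "\<forall>k<n. x k \<in> dual \<and> norm (x k) \<le> 1" "(\<Sum>k<n. norm (l k)) \<le> \<theta> / 2 ^ k"
      "dual_bound (\<lambda>A. z A - tensor_sum n l x A) (\<theta> / 2 ^ Suc k)" by blast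
    moreover have "(\<lambda>A. z A - tensor_sum n l x A) \<in> sym_span"
      using that *(1) by (intro tensor_diff_span tensor_sum_span) auto
    ultimately show ?thesis unfolding good_def by blast
  qed
  then obtain n l x where "\<And>z k. ?ok z k \<Longrightarrow> good z k (n z k) (l z k) (x z k)" by metis
  then have step: "(\<forall>i<n z k. x z k i \<in> dual \<and> norm (x z k i) \<le> 1) \<and>
      (\<Sum>i<n z k. norm (l z k i)) \<le> \<theta> / 2 ^ k \<and>
      ?ok (\<lambda>A. z A - tensor_sum (n z k) (l z k) (x z k) A) (Suc k)" if "?ok z k" for z k
    using that unfolding good_def by blast
  define Z where "Z = rec_nat z (\<lambda>k w A. w A - tensor_sum (n w k) (l w k) (x w k) A)"
  have Z0: "Z 0 = z" and ZSuc: "Z (Suc k) = (\<lambda>A. Z k A - tensor_sum (n (Z k) k) (l (Z k) k) (x (Z k) k) A)" for k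
    by (simp_all add: Z_def)
  have ok: "?ok (Z k) k" for k
  proof (induction k)
    case 0 then show ?case using z by (simp add: Z0)
  next
    case (Suc k) then show ?case unfolding ZSuc using step by blast
  qed
  define nn where "nn k = n (Z k) k" for k
  define lp where "lp p = (if snd p < nn (fst p) then l (Z (fst p)) (fst p) (snd p) else 0)" for p
  define xp where "xp p = (if snd p < nn (fst p) then x (Z (fst p)) (fst p) (snd p) else 0)" for p
  have xp: "xp p \<in> dual \<and> norm (xp p) \<le> 1" for p
    using step[OF ok] by (simp add: xp_def nn_def zero_E)
  have block: "tensor_sum (n (Z k) k) (l (Z k) k) (x (Z k) k) (ftform r b y) =
      (\<Sum>i<nn k. lp (k, i) * ftpoly r b y (blinfun_apply (xp (k, i))))" for k r b y
    unfolding tensor_sum_ftform nn_def[symmetric] by (intro sum.cong) (auto simp: lp_def xp_def)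
  have lsum: "(\<Sum>k<K. \<Sum>i<nn k. norm (lp (k, i))) \<le> 2 * \<theta>" for K
  proof -
    have "(\<Sum>k<K. \<Sum>i<nn k. norm (lp (k, i))) \<le> (\<Sum>k<K. \<theta> * (1/2) ^ k)"
    proof (rule sum_mono)
      fix k
      have "(\<Sum>i<nn k. norm (lp (k, i))) = (\<Sum>i<nn k. norm (l (Z k) k i))"
        by (intro sum.cong) (auto simp: lp_def)
      also have "\<dots> \<le> \<theta> / 2 ^ k" using step[OF ok] unfolding nn_def by blast
      finally show "(\<Sum>i<nn k. norm (lp (k, i))) \<le> \<theta> * (1/2) ^ k" by (simp add: power_one_over)
    qed
    also have "\<dots> = \<theta> * (\<Sum>k<K. (1/2) ^ k)" by (simp add: sum_distrib_left)
    also have "\<dots> \<le> \<theta> * 2" using th by (intro mult_left_mono) (simp_all add: sum_gp_strict)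
    finally show ?thesis by simp
  qed
  note dec = sums_prod_decode[of nn lp "2 * \<theta>", OF _ lsum]
  have lp0: "nn k \<le> i \<Longrightarrow> lp (k, i) = 0" for k i by (simp add: lp_def)
  have sums: "(\<lambda>j. lp (prod_decode j) * blinfun_apply (xp (prod_decode j)) y ^ N) sums z (ftform 1 (\<lambda>_. 1) (\<lambda>_. y))" for y
  proof (rule sums_prod_decode(3)[of nn "\<lambda>p. lp p * blinfun_apply (xp p) y ^ N" "2 * \<theta> * norm y ^ N"])
    let ?f = "ftform 1 (\<lambda>_. 1) (\<lambda>_. y)"
    show "lp (k, i) * blinfun_apply (xp (k, i)) y ^ N = 0" if "nn k \<le> i" for k i using lp0[OF that] by simp
    show "(\<Sum>k<K. \<Sum>i<nn k. norm (lp (k, i) * blinfun_apply (xp (k, i)) y ^ N)) \<le> 2 * \<theta> * norm y ^ N" for K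
    proof -
      have xy: "norm (blinfun_apply (xp p) y) \<le> norm y" for p
        using norm_blinfun[of "xp p" y] xp[of p] mult_right_mono[of "norm (xp p)" 1 "norm y"] by simp
      have "(\<Sum>k<K. \<Sum>i<nn k. norm (lp (k, i) * blinfun_apply (xp (k, i)) y ^ N))
          \<le> (\<Sum>k<K. \<Sum>i<nn k. norm (lp (k, i)) * norm y ^ N)"
        unfolding norm_mult norm_power by (intro sum_mono mult_left_mono power_mono xy) auto
      also have "\<dots> = (\<Sum>k<K. \<Sum>i<nn k. norm (lp (k, i))) * norm y ^ N" by (simp add: sum_distrib_right)
      also have "\<dots> \<le> 2 * \<theta> * norm y ^ N" by (intro mult_right_mono lsum) auto
      finally show ?thesis .
    qed
    have blk: "(\<Sum>i<nn k. lp (k, i) * blinfun_apply (xp (k, i)) y ^ N) = Z k ?f - Z (Suc k) ?f" for k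
      unfolding ZSuc block by (simp add: ftpoly_def)
    have partial: "(\<Sum>k<K. \<Sum>i<nn k. lp (k, i) * blinfun_apply (xp (k, i)) y ^ N) = z ?f - Z K ?f" for K
      unfolding blk by (induction K) (simp_all add: Z0)
    have "(\<lambda>K. Z K ?f) \<longlonglongrightarrow> 0"
    proof (rule Lim_null_comparison)
      \<comment> \<open>Scaling by \<open>1 / c\<close> brings the power of \<open>y\<close> into
        the unit ball of polynomials; \<open>1 + norm y\<close> keeps \<open>c\<close> positive for
        \<open>y = 0\<close>.\<close>
      define c where "c = (1 + norm y) ^ N"
      have c: "c > 0" unfolding c_def using norm_ge_zero[of y] by (intro zero_less_power) linarith
      have "norm (Z K ?f) \<le> c * (\<theta> * (1/2) ^ K)" for K
      proof -
        have "unit_ft 1 (\<lambda>_. of_real (1 / c)) (\<lambda>_. y)"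
          unfolding unit_ft_def
        proof (intro ballI impI)
          fix f assume f: "f \<in> dual" "norm f \<le> 1"
          have "norm (blinfun_apply f y) \<le> 1 + norm y"
            using norm_blinfun[of f y] f mult_right_mono[of "norm f" 1 "norm y"] by simp
          then have "norm (blinfun_apply f y) ^ N \<le> c" unfolding c_def by (intro power_mono) auto
          then show "norm (ftpoly 1 (\<lambda>_. of_real (1 / c)) (\<lambda>_. y) (blinfun_apply f)) \<le> 1"
            using c by (simp add: ftpoly_def norm_mult norm_power norm_divide)
        qed
        then have "norm (Z K (ftform 1 (\<lambda>_. of_real (1 / c) * 1) (\<lambda>_. y))) \<le> \<theta> / 2 ^ K"
          using ok[of K] unfolding dual_bound_def by simp
        moreover obtain m l0 x0 where "Z K = tensor_sum m l0 x0" using ok[of K] unfolding sym_span_def by blast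
        ultimately have "norm (of_real (1 / c) * Z K ?f) \<le> \<theta> / 2 ^ K" by (simp only: ftform_scale)
        then show ?thesis using c by (simp add: norm_mult norm_divide field_simps power_one_over)
      qed
      then show "\<forall>\<^sub>F K in sequentially. norm (Z K ?f) \<le> c * (\<theta> * (1/2) ^ K)" by simp
      have "(\<lambda>K. c * (\<theta> * (1/2) ^ K)) \<longlonglongrightarrow> c * (\<theta> * 0)"
        by (intro tendsto_mult tendsto_const LIMSEQ_realpow_zero) auto
      then show "(\<lambda>K. c * (\<theta> * (1/2) ^ K)) \<longlonglongrightarrow> 0" by simp
    qed
    then show "(\<lambda>k. \<Sum>i<nn k. lp (k, i) * blinfun_apply (xp (k, i)) y ^ N) sums z ?f"
      unfolding sums_def partial using tendsto_diff[OF tendsto_const, of _ 0 _ "z ?f"] by fastforce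
  qed
  show ?thesis
    using xp dec(1,2)[OF lp0] sums
    by (intro exI[of _ "\<lambda>j. lp (prod_decode j)"] exI[of _ "\<lambda>j. xp (prod_decode j)"]) auto
qed

text \<open>A representation of \<open>z\<close> followed by the negated series of
  \<open>exact_series\<close> vanishes at all powers of points, so its late partial sums have
  projective norm at most \<open>\<theta>\<close>. The part of the series used there costs at most
  \<open>2 * \<theta>\<close>.\<close>

lemma proj_norm_le_dual_bound:
  assumes ap: "approximation_property dual (dual_scale :: 'k \<Rightarrow> ('a \<Rightarrow>\<^sub>L 'k) \<Rightarrow> _)"
    and z: "z \<in> sym_span" "dual_bound z \<theta>" and th: "\<theta> > 0"
  shows "proj_norm z \<le> 3 * \<theta>"
proof -
  obtain m l0 x0 where z0: "z = tensor_sum m l0 x0" "\<forall>k<m. x0 k \<in> dual \<and> norm (x0 k) = 1"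
    using span_unit_form[OF z(1)] by blast
  from exact_series[OF z th] obtain l x where x: "\<And>j. x j \<in> dual" "\<And>j. norm (x j) \<le> 1"
    and l: "summable (\<lambda>j. norm (l j))" "\<And>m. (\<Sum>j<m. norm (l j)) \<le> 2 * \<theta>"
    and s: "\<And>y. (\<lambda>j. l j * blinfun_apply (x j) y ^ N) sums z (ftform 1 (\<lambda>_. 1) (\<lambda>_. y))" by blast
  define l' where "l' j = (if j < m then l0 j else - l (j - m))" for j
  define x' where "x' j = (if j < m then x0 j else x (j - m))" for j
  have "\<exists>n0. \<forall>n\<ge>n0. proj_norm (tensor_sum n l' x') \<le> \<theta>"
  proof (rule null_series_small[OF ap _ _ _ _ th])
    show "x' i \<in> dual" "norm (x' i) \<le> 1" for i using z0(2) x by (auto simp: x'_def)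
    have "summable (\<lambda>j. norm (l' (j + m)))" using l(1) by (simp add: l'_def)
    then show "summable (\<lambda>j. norm (l' j))" by (rule summable_iff_shift[THEN iffD1])
    fix y
    have "z (ftform 1 (\<lambda>_. 1) (\<lambda>_. y)) = (\<Sum>j<m. l' j * blinfun_apply (x' j) y ^ N)"
      unfolding z0(1) tensor_sum_ftform ftpoly_def by (intro sum.cong) (auto simp: l'_def x'_def)
    moreover have "(\<lambda>j. l' (j + m) * blinfun_apply (x' (j + m)) y ^ N) sums (- z (ftform 1 (\<lambda>_. 1) (\<lambda>_. y)))"
      using sums_minus[OF s[of y]] by (simp add: l'_def x'_def)
    ultimately show "(\<lambda>j. l' j * blinfun_apply (x' j) y ^ N) sums 0"
      by (simp add: sums_iff_shift[of "\<lambda>j. l' j * blinfun_apply (x' j) y ^ N"])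
  qed
  \<comment> \<open>An index of the form \<open>m + n\<close> keeps the representation of
    \<open>z\<close> whole; only the series is cut off.\<close>
  then obtain n where "proj_norm (tensor_sum (m + n) l' x') \<le> \<theta>" by (meson le_add2)
  moreover have "tensor_sum (m + n) l' x' = (\<lambda>A. z A - tensor_sum n l x A)"
    unfolding z0(1) tensor_sum_def by (simp add: sum_lessThan_add l'_def x'_def sum_negf fun_eq_iff)
  ultimately have 1: "proj_norm (\<lambda>A. z A - tensor_sum n l x A) \<le> \<theta>" by simp
  have 2: "proj_norm (tensor_sum n l x) \<le> 2 * \<theta>"
    using proj_norm_tensor_sum_ball_le[of n x l] x l(2)[of n] by fastforce
  have "proj_norm (\<lambda>A. (z A - tensor_sum n l x A) + tensor_sum n l x A)
      \<le> proj_norm (\<lambda>A. z A - tensor_sum n l x A) + proj_norm (tensor_sum n l x)"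
    using x by (intro proj_norm_add tensor_diff_span z tensor_sum_span)
  then show ?thesis using 1 2 by simp
qed

end

section \<open>Passage to the completion\<close>

context sym_tensor_space
begin

lemma const_cauchy: "z \<in> sym_span \<Longrightarrow> (\<lambda>_. z) \<in> cauchy_seqs sym_span proj_dist"
  by (auto simp: cauchy_seqs_def refl0)

lemma embed_completion: "z \<in> sym_span \<Longrightarrow> pst_embed z \<in> proj_sym_tensor"
  unfolding pst_embed_def proj_sym_tensor_def cauchy_completion_embed_def cauchy_completion_def
  by (intro quotientI const_cauchy)

lemma const_in_embed: "z \<in> sym_span \<Longrightarrow> (\<lambda>_. z) \<in> pst_embed z"
  unfolding pst_embed_def cauchy_completion_embed_def
  by (rule equiv_class_self[OF equiv_null_rel const_cauchy])

lemma pst_dist_lim: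
  assumes "Z \<in> proj_sym_tensor" "W \<in> proj_sym_tensor" "u \<in> Z" "v \<in> W"
  shows "(\<lambda>n. proj_dist (u n) (v n)) \<longlonglongrightarrow> pst_dist Z W"
  using cauchy_completion_dist_eq[of Z W u v] assms unfolding proj_sym_tensor_def pst_dist_def by blast

lemma pst_dist_embed:
  assumes "z \<in> sym_span" "w \<in> sym_span"
  shows "pst_dist (pst_embed z) (pst_embed w) = proj_dist z w"
  using pst_dist_lim[OF embed_completion embed_completion const_in_embed const_in_embed, OF assms assms]
  by (simp add: LIMSEQ_const_iff)

lemma pst_norm_embed: "z \<in> sym_span \<Longrightarrow> pst_norm (pst_embed z) = proj_norm z"
  unfolding pst_norm_def by (simp add: pst_dist_embed zero_span proj_norm_zero_dist)

lemma embed_dense: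
  assumes Z: "Z \<in> proj_sym_tensor" and e: "\<epsilon> > 0"
  shows "\<exists>z\<in>sym_span. pst_dist Z (pst_embed z) < \<epsilon>"
proof -
  have "Z \<noteq> {}" using in_quotient_imp_non_empty[OF equiv_null_rel] Z
    unfolding proj_sym_tensor_def cauchy_completion_def by blast
  then obtain u where u: "u \<in> Z" by blast
  have uc: "u \<in> cauchy_seqs sym_span proj_dist"
    using in_quotient_imp_subset[OF equiv_null_rel] Z u unfolding proj_sym_tensor_def cauchy_completion_def by blast
  then have "\<forall>\<epsilon>>0. \<exists>n0. \<forall>m\<ge>n0. \<forall>n\<ge>n0. proj_dist (u m) (u n) < \<epsilon>" by (simp add: cauchy_seqs_def)
  from this[THEN spec[of _ "\<epsilon> / 2"]] e
  obtain n0 where n0: "\<forall>m\<ge>n0. \<forall>n\<ge>n0. proj_dist (u m) (u n) < \<epsilon> / 2" by auto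
  have un: "u n0 \<in> sym_span" using uc by (rule cs)
  have "(\<lambda>n. proj_dist (u n) (u n0)) \<longlonglongrightarrow> pst_dist Z (pst_embed (u n0))"
    by (rule pst_dist_lim[OF Z embed_completion[OF un] u const_in_embed[OF un]])
  then have "pst_dist Z (pst_embed (u n0)) \<le> \<epsilon> / 2"
    by (rule LIMSEQ_le_const2) (use n0 in \<open>auto intro!: exI[of _ n0] less_imp_le\<close>)
  then show ?thesis using un e by (intro bexI[of _ "u n0"]) auto
qed

text \<open>Padding with zeros turns a finite optimal representation into a series; the vector 0 is
  admissible because norm attainment asks for points of the ball, not of the sphere.\<close>

lemma norm_attaining_embed:
  assumes x: "\<And>k. k < n \<Longrightarrow> x k \<in> E \<and> norm (x k) \<le> 1"
    and eq: "proj_norm (tensor_sum n l x) = (\<Sum>k<n. norm (l k))"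
  shows "pst_embed (tensor_sum n l x) \<in> norm_attaining"
proof -
  let ?w = "tensor_sum n l x"
  define l' where "l' k = (if k < n then l k else 0)" for k
  define x' where "x' k = (if k < n then x k else 0)" for k
  have w: "?w \<in> sym_span" using x by (intro tensor_sum_span) auto
  have "range l' \<subseteq> insert 0 (l ` {..<n})" by (auto simp: l'_def)
  then have "bounded (range l')" using finite_imp_bounded finite_subset by (metis finite_imageI finite_insert finite_lessThan)
  moreover have "x' k \<in> E \<and> norm (x' k) \<le> 1" for k using x zero_E by (simp add: x'_def)
  moreover have "(\<lambda>m. pst_dist (pst_embed (tensor_sum m l' x')) (pst_embed ?w)) \<longlonglongrightarrow> 0"
  proof (rule tendsto_eventually)
    have "tensor_sum m l' x' = ?w" if "m \<ge> n" for m
    proof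
      fix A
      have "(\<Sum>k<m. l' k * tensor_power (x' k) A) = (\<Sum>k<n. l k * tensor_power (x k) A)"
        by (rule sum.mono_neutral_cong_right) (use that in \<open>auto simp: l'_def x'_def\<close>)
      then show "tensor_sum m l' x' A = ?w A" by (simp add: tensor_sum_def)
    qed
    then show "\<forall>\<^sub>F m in sequentially. pst_dist (pst_embed (tensor_sum m l' x')) (pst_embed ?w) = 0"
      unfolding eventually_sequentially by (intro exI[of _ n]) (simp add: pst_dist_embed w refl0)
  qed
  moreover have "(\<lambda>k. norm (l' k)) sums pst_norm (pst_embed ?w)"
  proof -
    have "(\<lambda>k. norm (l' k)) sums (\<Sum>k<n. norm (l' k))" by (rule sums_finite) (auto simp: l'_def)
    moreover have "(\<Sum>k<n. norm (l' k)) = pst_norm (pst_embed ?w)"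
      unfolding pst_norm_embed[OF w] eq by (intro sum.cong) (auto simp: l'_def)
    ultimately show ?thesis by simp
  qed
  ultimately show ?thesis
    unfolding norm_attaining_def using embed_completion[OF w] by blast
qed

end

theorem theorem3p8:
  fixes smul :: "'k::rc_field \<Rightarrow> 'a::banach \<Rightarrow> 'a" and N :: nat
  assumes "banach_space_over smul"
    and "N \<ge> 1"
    and "radon_nikodym_property TYPE('a \<Rightarrow>\<^sub>L 'k) (dual_space smul)"
    and "approximation_property (dual_space smul) dual_scale"
  shows "sym_tensor.pst_topology N (dual_space smul) dual_scale
           closure_of sym_tensor.norm_attaining N (dual_space smul) dual_scale
         = sym_tensor.proj_sym_tensor N (dual_space smul) dual_scale"
proof -
  interpret rnp_dual_tensor smul N
    by (intro rnp_dual_tensor.intro dual_tensor.intro rnp_dual_tensor_axioms.intro assms)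
  interpret M: Metric_space proj_sym_tensor pst_dist
    by (rule Metric_space_proj_sym_tensor_dual[OF assms(1,2)])
  have "\<exists>W\<in>norm_attaining. W \<in> M.mball Z \<epsilon>" if Z: "Z \<in> proj_sym_tensor" and e: "\<epsilon> > 0" for Z \<epsilon>
  proof -
    obtain z where z: "z \<in> sym_span" "pst_dist Z (pst_embed z) < \<epsilon> / 2"
      using embed_dense[OF Z, of "\<epsilon> / 2"] e by auto
    \<comment> \<open>The factor 3 of \<open>proj_norm_le_dual_bound\<close> turns
      \<open>\<epsilon> / 6\<close> into \<open>\<epsilon> / 2\<close>; the other half is the
      distance from \<open>Z\<close> to the dense span.\<close>
    have "\<epsilon> / 6 > 0" using e by simp
    from attaining_tensor[OF z(1) this] obtain n l x where x: "\<forall>k<n. x k \<in> dual \<and> norm (x k) \<le> 1"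
      and att: "proj_norm (tensor_sum n l x) = (\<Sum>k<n. norm (l k))"
      and bd: "dual_bound (\<lambda>A. z A - tensor_sum n l x A) (\<epsilon> / 6)" by blast
    let ?w = "tensor_sum n l x"
    have w: "?w \<in> sym_span" using x by (intro tensor_sum_span) auto
    have "proj_dist z ?w \<le> 3 * (\<epsilon> / 6)"
      unfolding proj_dist_def using e
      by (intro proj_norm_le_dual_bound[OF assms(4) _ bd] tensor_diff_span z w) simp
    then have "pst_dist (pst_embed z) (pst_embed ?w) \<le> \<epsilon> / 2" by (simp add: pst_dist_embed z w)
    then have "pst_dist Z (pst_embed ?w) < \<epsilon>"
      using M.triangle[OF Z embed_completion[OF z(1)] embed_completion[OF w]] z(2) by linarith
    moreover have "pst_embed ?w \<in> norm_attaining" using x by (intro norm_attaining_embed att) auto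
    ultimately show ?thesis using Z embed_completion[OF w] by (intro bexI[of _ "pst_embed ?w"]) auto
  qed
  then show ?thesis unfolding M.metric_closure_of by auto
qed

end
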